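(* Let $k\geq 2$ be an integer and let $G$ be a nontrivial finite CI-group. Then $G$ has the $k$-if property if and only if $G$ is a direct product of elementary abelian groups (equivalently, $G$ is abelian and every Sylow subgroup of $G$ is elementary abelian) and, for every prime $p$ dividing $|G|$, the Sylow $p$-subgroup $G_p$ of $G$ satisfies $2k\mid |G_p|-1$ if $p$ is odd, and $k\mid |G_p|-1$ if $p=2$.
   Context: For a finite group $G$ let $G^*=G\setminus\{1\}$. For an inverse-closed subset $S\subseteq G^*$ (i.e. $S^{-1}=S$), the Cayley graph $\mathrm{Cay}(G,S)$ has vertex set $G$ and edges $\{h,g\}$ with $gh^{-1}\in S$. An inverse-closed $S\subseteq G^*$ is a CI-set if for every inverse-closed $T\subseteq G^*$, $\mathrm{Cay}(G,S)\cong\mathrm{Cay}(G,T)$ implies $T=S^{\alpha}$ for some $\alpha\in\mathrm{Aut}(G)$; $G$ is a CI-group if every inverse-closed subset of $G^*$ is a CI-set. A partition of a set is a collection of non-empty pairwise disjoint subsets whose union is the set. For an integer $k\geq 2$, $\mathrm{Cay}(G,S)$ is a $k$-if Cayley graph if there is a partition $\{S_0=S,S_1,\dots,S_{k-1}\}$ of $G^*$ into inverse-closed subsets with $\mathrm{Cay}(G,S_i)\cong\mathrm{Cay}(G,S)$ for all $i$ (i.e. the complete graph on vertex set $G$ is edge-partitioned into $k$ spanning Cayley graphs of $G$, each isomorphic to $\mathrm{Cay}(G,S)$). $G$ has the $k$-if property if some $\mathrm{Cay}(G,S)$ is a $k$-if Cayley graph. *)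

theory Defs
  imports
    "HOL-Algebra.Bij"
    "HOL-Algebra.Sylow"
    "HOL-Algebra.Multiplicative_Group"
    "HOL-Algebra.Product_Groups"
    "HOL-Library.Disjoint_Sets"
begin

section \<open>Graphs and Cayley graphs\<close>

text \<open>A simple graph is a pair of a vertex set and a set of two-element edges.\<close>

type_synonym 'a sgraph = "'a set \<times> 'a set set"

definition graph_iso :: "'a sgraph \<Rightarrow> 'b sgraph \<Rightarrow> bool" where
  "graph_iso X Y \<longleftrightarrow>
    (\<exists>f. bij_betw f (fst X) (fst Y) \<and>
         (\<forall>u\<in>fst X. \<forall>v\<in>fst X. {u, v} \<in> snd X \<longleftrightarrow> {f u, f v} \<in> snd Y))"

text \<open>Inverse-closed subsets of \<open>G\<close> are always understood to omit the identity; in particular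
  the Cayley graph of such a set has no singleton edges.\<close>

definition inverse_closed :: "('a, 'b) monoid_scheme \<Rightarrow> 'a set \<Rightarrow> bool" where
  "inverse_closed G S \<longleftrightarrow> S \<subseteq> carrier G - {\<one>\<^bsub>G\<^esub>} \<and> m_inv G ` S = S"

definition cayley_graph :: "('a, 'b) monoid_scheme \<Rightarrow> 'a set \<Rightarrow> 'a sgraph" where
  "cayley_graph G S =
    (carrier G, {{h, g} | h g. h \<in> carrier G \<and> g \<in> carrier G \<and> g \<otimes>\<^bsub>G\<^esub> inv\<^bsub>G\<^esub> h \<in> S})"

section \<open>CI-groups and the k-if property\<close>

definition CI_set :: "('a, 'b) monoid_scheme \<Rightarrow> 'a set \<Rightarrow> bool" where
  "CI_set G S \<longleftrightarrow> inverse_closed G S \<and>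
    (\<forall>T. inverse_closed G T \<longrightarrow> graph_iso (cayley_graph G S) (cayley_graph G T) \<longrightarrow>
      (\<exists>\<alpha>\<in>auto G. T = \<alpha> ` S))"

definition CI_group :: "('a, 'b) monoid_scheme \<Rightarrow> bool" where
  "CI_group G \<longleftrightarrow> group G \<and> finite (carrier G) \<and> (\<forall>S. inverse_closed G S \<longrightarrow> CI_set G S)"

definition k_if_cayley_graph :: "nat \<Rightarrow> ('a, 'b) monoid_scheme \<Rightarrow> 'a set \<Rightarrow> bool" where
  "k_if_cayley_graph k G S \<longleftrightarrow>
    (\<exists>P. partition_on (carrier G - {\<one>\<^bsub>G\<^esub>}) P \<and> card P = k \<and> S \<in> P \<and>
      (\<forall>T\<in>P. inverse_closed G T \<and> graph_iso (cayley_graph G T) (cayley_graph G S)))"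

definition k_if_property :: "nat \<Rightarrow> ('a, 'b) monoid_scheme \<Rightarrow> bool" where
  "k_if_property k G \<longleftrightarrow> (\<exists>S. inverse_closed G S \<and> k_if_cayley_graph k G S)"

section \<open>Elementary abelian groups and Sylow subgroups\<close>

definition elementary_abelian :: "('a, 'b) monoid_scheme \<Rightarrow> bool" where
  "elementary_abelian H \<longleftrightarrow> comm_group H \<and>
    (\<exists>p::nat. Factorial_Ring.prime p \<and> (\<forall>x\<in>carrier H. x \<noteq> \<one>\<^bsub>H\<^esub> \<longrightarrow> group.ord H x = p))"

text \<open>The factors may be taken with elements in the type of \<open>G\<close>, since each factor
  of a direct product isomorphic to \<open>G\<close> embeds into \<open>G\<close>.\<close>

definition direct_product_of_elementary_abelian :: "('a, 'b) monoid_scheme \<Rightarrow> bool" where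
  "direct_product_of_elementary_abelian G \<longleftrightarrow>
    (\<exists>(I :: nat set) (H :: nat \<Rightarrow> 'a monoid).
      finite I \<and> (\<forall>i\<in>I. elementary_abelian (H i)) \<and> G \<cong> product_group I H)"

definition sylow_subgroup :: "('a, 'b) monoid_scheme \<Rightarrow> nat \<Rightarrow> 'a set \<Rightarrow> bool" where
  "sylow_subgroup G p P \<longleftrightarrow> subgroup P G \<and> card P = p ^ multiplicity p (order G)"

end

theory Submission
  imports Defs "HOL-Algebra.Group_Action" "HOL-Algebra.Algebraic_Closure" "HOL-Number_Theory.Residues"
begin

text \<open>In a CI-group the parts of a \<open>k\<close>-if partition are images of \<open>S\<close> under automorphisms, so \<open>k\<close>
  divides the size of every characteristic subset of \<open>G\<^sup>*\<close>, and \<open>2k\<close> does if it contains no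
  involution; in particular \<open>k\<close> is coprime to \<open>|G|\<close>. Moreover any two elements of the same order are,
  up to inversion, conjugate under automorphisms.

  The necessity of commutativity is proved by induction on \<open>|G|\<close>. Comparing Cayley graphs that differ
  only inside a subgroup, and counting for \<open>p \<le> 3\<close>, excludes elements of order \<open>p\<^sup>2\<close>. The same comparison shows that an element of prime order
  acting on an elementary abelian normal subgroup of coprime order acts trivially, by scalars
  (and then has order at most \<open>3\<close>), or on a group of order \<open>4\<close>. A count of the elements of
  order \<open>p\<close>, for \<open>p\<close> the smallest prime divisor of \<open>|G|\<close>, removes the last case, so a Sylow
  \<open>p\<close>-subgroup \<open>P\<close> is central in its normalizer and has a normal complement by Burnside's transfer
  theorem. The complement is characteristic, hence abelian by induction. If \<open>P\<close> acted nontrivially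
  on it, \<open>P\<close> would have rank at least two and act by scalars on some \<open>x\<close> of prime order \<open>q\<close>, so that
  some elements of order \<open>p\<close> centralize \<open>x\<close> and some do not, although automorphisms permute the
  subgroups of order \<open>p q\<close> transitively.

  Conversely, multiplication by an element of order \<open>2k\<close> (or \<open>k\<close> in characteristic \<open>2\<close>) of a finite
  field is an automorphism \<open>\<beta>\<close> of its additive group such that \<open>\<beta>\<^sup>k\<close> is inversion and no smaller positive
  power has a nontrivial fixed point. These automorphisms combine on the direct product of the
  Sylow subgroups, and a suitable union of representatives of their orbits is the required set.\<close>

section \<open>Cayley graphs and automorphisms\<close>

text \<open>The CI property yields an automorphism of the whole group about which nothing is known
  except the image of one inverse-closed set. Elements are therefore controlled only up to
  inversion, and this is where the bound 3 comes from: comparing an element with its square leads to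
  2 = 1 or 2 = -1 modulo p, so p divides 1 or 3. For p = 2 and p = 3 every unit modulo p is 1 or -1
  and the comparison is empty. There the counting takes over: the elements of order p cannot form
  one class up to inversion, so subgroups of order p^2 and exponent p exist. The smallest prime p is
  chosen because an element of prime order r that acts nontrivially on P then has r > p. Acting by
  scalars, that is, sending every element to a power of itself, requires r \<le> 3, hence p = 2,
  where the only scalar is 1. Since P has exponent p, the transfer can be evaluated with orbits of
  length 1 and p only.\<close>

lemma (in group) inv_mult_cancel_left [simp]:
  "x \<in> carrier G \<Longrightarrow> y \<in> carrier G \<Longrightarrow> inv x \<otimes> (x \<otimes> y) = y"
  by (simp flip: m_assoc)

lemma (in group) mult_inv_cancel_left [simp]:
  "x \<in> carrier G \<Longrightarrow> y \<in> carrier G \<Longrightarrow> x \<otimes> (inv x \<otimes> y) = y"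
  by (simp flip: m_assoc)

lemma autoD:
  assumes "\<alpha> \<in> auto G"
  shows "\<alpha> \<in> hom G G" "bij_betw \<alpha> (carrier G) (carrier G)" "\<alpha> \<in> iso G G"
  using assms by (auto simp: auto_def Bij_def iso_def)

lemma (in group) isoD_auto:
  assumes "h \<in> iso G G"
  shows "restrict h (carrier G) \<in> auto G"
  using assms by (auto simp: auto_def Bij_def iso_def hom_def)

lemma inverse_closedD:
  assumes "inverse_closed G S"
  shows "S \<subseteq> carrier G" "\<one>\<^bsub>G\<^esub> \<notin> S" "x \<in> S \<Longrightarrow> inv\<^bsub>G\<^esub> x \<in> S"
  using assms unfolding inverse_closed_def by auto

lemma (in group) inverse_closedI:
  assumes "S \<subseteq> carrier G" "\<one> \<notin> S" "\<And>x. x \<in> S \<Longrightarrow> inv x \<in> S"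
  shows "inverse_closed G S"
proof -
  have "x \<in> m_inv G ` S" if "x \<in> S" for x
    using that assms by (intro image_eqI[of _ _ "inv x"]) auto
  then show ?thesis
    using assms unfolding inverse_closed_def by blast
qed

lemma (in group) inv_mem_iff:
  assumes "inverse_closed G S" "x \<in> carrier G"
  shows "inv x \<in> S \<longleftrightarrow> x \<in> S"
  using inverse_closedD[OF assms(1)] assms(2) by (metis inv_inv)

text \<open>Edges are unordered while \<open>v \<otimes> inv u\<close> depends on the order of its
  arguments; inverse-closedness makes the two possible quotients equivalent.\<close>

lemma (in group) cayley_edge_iff:
  assumes S: "inverse_closed G S" and u: "u \<in> carrier G" and v: "v \<in> carrier G"
  shows "{u, v} \<in> snd (cayley_graph G S) \<longleftrightarrow> v \<otimes> inv u \<in> S"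
proof -
  have "inv (v \<otimes> inv u) = u \<otimes> inv v"
    using u v by (simp add: inv_mult_group)
  then have "v \<otimes> inv u \<in> S \<longleftrightarrow> u \<otimes> inv v \<in> S"
    using inv_mem_iff[OF S, of "v \<otimes> inv u"] u v by simp
  then show ?thesis
    unfolding cayley_graph_def using u v by (auto simp: doubleton_eq_iff)
qed

lemma graph_iso_cayley_iff:
  assumes G: "group G" and H: "group H" and S: "inverse_closed G S" and T: "inverse_closed H T"
  shows "graph_iso (cayley_graph G S) (cayley_graph H T) \<longleftrightarrow>
    (\<exists>f. bij_betw f (carrier G) (carrier H) \<and>
      (\<forall>u\<in>carrier G. \<forall>v\<in>carrier G. v \<otimes>\<^bsub>G\<^esub> inv\<^bsub>G\<^esub> u \<in> S \<longleftrightarrow> f v \<otimes>\<^bsub>H\<^esub> inv\<^bsub>H\<^esub> (f u) \<in> T))"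
proof -
  have fst: "fst (cayley_graph G S) = carrier G" "fst (cayley_graph H T) = carrier H"
    by (auto simp: cayley_graph_def)
  have "({u, v} \<in> snd (cayley_graph G S) \<longleftrightarrow> {f u, f v} \<in> snd (cayley_graph H T)) \<longleftrightarrow>
      (v \<otimes>\<^bsub>G\<^esub> inv\<^bsub>G\<^esub> u \<in> S \<longleftrightarrow> f v \<otimes>\<^bsub>H\<^esub> inv\<^bsub>H\<^esub> (f u) \<in> T)"
    if "bij_betw f (carrier G) (carrier H)" "u \<in> carrier G" "v \<in> carrier G" for f u v
    using group.cayley_edge_iff[OF G S that(2,3)]
      group.cayley_edge_iff[OF H T, of "f u" "f v"] bij_betwE[OF that(1)] that by simp
  then show ?thesis
    unfolding graph_iso_def fst by (intro ex_cong1 conj_cong refl) auto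
qed

lemma CI_groupD:
  assumes "CI_group G"
  shows "group G" "finite (carrier G)"
  using assms by (auto simp: CI_group_def)

text \<open>The form in which graph isomorphisms built by hand are fed into the CI hypothesis. The
  map \<open>f\<close> is only a bijection, and \<open>\<alpha>\<close> is tied to it by nothing but
  its effect on the set \<open>S\<close>.\<close>

lemma CI_group_auto:
  assumes CI: "CI_group G" and S: "inverse_closed G S" and T: "inverse_closed G T"
    and f: "bij_betw f (carrier G) (carrier G)"
      "\<And>u v. \<lbrakk>u \<in> carrier G; v \<in> carrier G\<rbrakk> \<Longrightarrow>
        v \<otimes>\<^bsub>G\<^esub> inv\<^bsub>G\<^esub> u \<in> S \<longleftrightarrow> f v \<otimes>\<^bsub>G\<^esub> inv\<^bsub>G\<^esub> (f u) \<in> T"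
  obtains \<alpha> where "\<alpha> \<in> auto G" "\<alpha> ` S = T"
proof -
  have "graph_iso (cayley_graph G S) (cayley_graph G T)"
    using graph_iso_cayley_iff[OF CI_groupD(1)[OF CI] CI_groupD(1)[OF CI] S T] f by blast
  then show ?thesis
    using CI S T that unfolding CI_group_def CI_set_def by blast
qed

section \<open>Right cosets and the extension of relations from a subgroup to the group\<close>

definition (in group) right_transversal :: "'a set \<Rightarrow> 'a set \<Rightarrow> bool" where
  "right_transversal A T \<longleftrightarrow> T \<subseteq> carrier G \<and> (\<forall>g\<in>carrier G. \<exists>!t. t \<in> T \<and> g \<otimes> inv t \<in> A)"

context group
begin

text \<open>Once the representative t of a coset is known, the factor a = g t^-1 is determined, so
  uniqueness of representatives amounts to unique factorization g = a t.\<close>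

lemma right_transversal_iff:
  assumes A: "subgroup A G"
  shows "right_transversal A T \<longleftrightarrow> T \<subseteq> carrier G \<and> bij_betw (\<lambda>(a, t). a \<otimes> t) (A \<times> T) (carrier G)"
proof -
  interpret A: subgroup A G by fact
  show ?thesis
  proof (cases "T \<subseteq> carrier G")
    case T: True
    have eq: "g \<otimes> inv t \<in> A \<longleftrightarrow> (\<exists>a\<in>A. g = a \<otimes> t)" if "t \<in> T" "g \<in> carrier G" for g t
    proof
      assume "g \<otimes> inv t \<in> A"
      then show "\<exists>a\<in>A. g = a \<otimes> t"
        using that T by (intro bexI[of _ "g \<otimes> inv t"]) (auto simp: m_assoc subset_iff)
    next
      assume "\<exists>a\<in>A. g = a \<otimes> t"
      then show "g \<otimes> inv t \<in> A"
        using that T by (auto simp: m_assoc subset_iff)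
    qed
    show ?thesis
    proof
      assume rt: "right_transversal A T"
      show "T \<subseteq> carrier G \<and> bij_betw (\<lambda>(a, t). a \<otimes> t) (A \<times> T) (carrier G)"
        unfolding bij_betw_def
      proof (intro conjI T)
        show "inj_on (\<lambda>(a, t). a \<otimes> t) (A \<times> T)"
        proof (rule inj_onI, clarify)
          fix a t b s assume *: "a \<in> A" "t \<in> T" "b \<in> A" "s \<in> T" "a \<otimes> t = b \<otimes> s"
          then have c: "a \<in> carrier G" "t \<in> carrier G" "s \<in> carrier G" "b \<in> carrier G"
            using T by auto
          have "\<exists>!r. r \<in> T \<and> a \<otimes> t \<otimes> inv r \<in> A"
            using rt c unfolding right_transversal_def by blast
          moreover have "a \<otimes> t \<otimes> inv t \<in> A" "a \<otimes> t \<otimes> inv s \<in> A"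
          proof -
            show "a \<otimes> t \<otimes> inv t \<in> A"
              using *(1) c by (simp add: m_assoc)
            show "a \<otimes> t \<otimes> inv s \<in> A"
              using *(3) c unfolding *(5) by (simp add: m_assoc)
          qed
          ultimately have "t = s"
            using *(2,4) by blast
          then show "a = b \<and> t = s"
            using * c by simp
        qed
        show "(\<lambda>(a, t). a \<otimes> t) ` (A \<times> T) = carrier G"
        proof (intro equalityI subsetI)
          fix g assume "g \<in> (\<lambda>(a, t). a \<otimes> t) ` (A \<times> T)"
          then show "g \<in> carrier G"
            using T by auto
        next
          fix g assume g: "g \<in> carrier G"
          then obtain t where t: "t \<in> T" "g \<otimes> inv t \<in> A"
            using rt unfolding right_transversal_def by blast
          then obtain a where "a \<in> A" "g = a \<otimes> t"
            using eq[OF t(1) g] by blast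
          with t show "g \<in> (\<lambda>(a, t). a \<otimes> t) ` (A \<times> T)"
            by auto
        qed
      qed
    next
      assume "T \<subseteq> carrier G \<and> bij_betw (\<lambda>(a, t). a \<otimes> t) (A \<times> T) (carrier G)"
      then have inj: "inj_on (\<lambda>(a, t). a \<otimes> t) (A \<times> T)"
        and im: "(\<lambda>(a, t). a \<otimes> t) ` (A \<times> T) = carrier G"
        by (auto simp: bij_betw_def)
      show "right_transversal A T"
        unfolding right_transversal_def
      proof (intro conjI ballI T)
        fix g assume g: "g \<in> carrier G"
        then have "g \<in> (\<lambda>(a, t). a \<otimes> t) ` (A \<times> T)"
          using im by simp
        then obtain a t where at: "a \<in> A" "t \<in> T" "g = a \<otimes> t"
          by auto
        have uniq: "s = t" if "s \<in> T" "b \<in> A" "g = b \<otimes> s" for s b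
          using inj_onD[OF inj, of "(b, s)" "(a, t)"] that at by auto
        show "\<exists>!t. t \<in> T \<and> g \<otimes> inv t \<in> A"
        proof (rule ex1I[of _ t])
          show "t \<in> T \<and> g \<otimes> inv t \<in> A"
            using at eq[OF at(2) g] by blast
          show "s = t" if "s \<in> T \<and> g \<otimes> inv s \<in> A" for s
            using that eq[OF _ g, of s] uniq by blast
        qed
      qed
    qed
  qed (auto simp: right_transversal_def)
qed

lemma ex_right_transversal:
  assumes A: "subgroup A G"
  obtains T where "right_transversal A T"
proof -
  interpret A: subgroup A G by fact
  define c where "c C = (SOME t. t \<in> C)" for C :: "'a set"
  define T where "T = c ` (rcosets A)"
  have c: "c (A #> g) \<in> A #> g" if "g \<in> carrier G" for g
    using rcos_self[OF that A] unfolding c_def by (rule someI)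
  have mem: "g \<otimes> inv t \<in> A \<longleftrightarrow> A #> g = A #> t" if "g \<in> carrier G" "t \<in> carrier G" for g t
  proof
    assume "g \<otimes> inv t \<in> A"
    then show "A #> g = A #> t"
      using A.rcos_module[OF is_group that(2,1)] repr_independence[OF _ that(2) A] by metis
  next
    assume "A #> g = A #> t"
    then have "g \<in> A #> t"
      using rcos_self[OF that(1) A] by simp
    then show "g \<otimes> inv t \<in> A"
      using A.rcos_module[OF is_group that(2,1)] by simp
  qed
  have cc: "c (A #> g) \<in> carrier G" "A #> c (A #> g) = A #> g" if "g \<in> carrier G" for g
  proof -
    show "c (A #> g) \<in> carrier G"
      using c[OF that] r_coset_subset_G[OF A.subset that] by blast
    show "A #> c (A #> g) = A #> g"
      using repr_independence[OF c[OF that] that A] by simp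
  qed
  have "right_transversal A T"
    unfolding right_transversal_def
  proof (intro conjI ballI)
    show "T \<subseteq> carrier G"
      using cc unfolding T_def RCOSETS_def by auto
    fix g assume g: "g \<in> carrier G"
    show "\<exists>!t. t \<in> T \<and> g \<otimes> inv t \<in> A"
    proof (rule ex1I[of _ "c (A #> g)"])
      show "c (A #> g) \<in> T \<and> g \<otimes> inv c (A #> g) \<in> A"
        using g cc[OF g] mem unfolding T_def RCOSETS_def by auto
      fix t assume t: "t \<in> T \<and> g \<otimes> inv t \<in> A"
      then obtain h where h: "h \<in> carrier G" "t = c (A #> h)"
        unfolding T_def RCOSETS_def by auto
      then show "t = c (A #> g)"
        using t mem[of g t] cc[OF h(1)] g by simp
    qed
  qed
  then show ?thesis by (rule that)
qed

text \<open>A relation between quotients of elements of a subgroup is lifted to the whole group by acting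
  on the \<open>A\<close>-parts of the right cosets of \<open>A\<close>; the sets \<open>RA\<close>, \<open>RB\<close> only see the coset.\<close>

lemma coset_extension:
  assumes A: "subgroup A G" and B: "subgroup B G"
    and TA: "right_transversal A TA" and TB: "right_transversal B TB"
    and \<sigma>: "bij_betw \<sigma> A B" and \<tau>: "bij_betw \<tau> TA TB"
    and SA: "SA \<subseteq> A" and SB: "SB \<subseteq> B"
    and S: "\<And>u v. \<lbrakk>u \<in> A; v \<in> A\<rbrakk> \<Longrightarrow> v \<otimes> inv u \<in> SA \<longleftrightarrow> \<sigma> v \<otimes> inv (\<sigma> u) \<in> SB"
    and RA: "RA \<inter> A = {}" "RA \<subseteq> carrier G" "\<And>a b r. \<lbrakk>a \<in> A; b \<in> A; r \<in> RA\<rbrakk> \<Longrightarrow> a \<otimes> r \<otimes> b \<in> RA"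
    and RB: "RB \<inter> B = {}" "RB \<subseteq> carrier G" "\<And>a b r. \<lbrakk>a \<in> B; b \<in> B; r \<in> RB\<rbrakk> \<Longrightarrow> a \<otimes> r \<otimes> b \<in> RB"
    and R: "\<And>s t. \<lbrakk>s \<in> TA; t \<in> TA\<rbrakk> \<Longrightarrow> t \<otimes> inv s \<in> RA \<longleftrightarrow> \<tau> t \<otimes> inv (\<tau> s) \<in> RB"
  obtains f where "bij_betw f (carrier G) (carrier G)"
    "\<And>u v. \<lbrakk>u \<in> carrier G; v \<in> carrier G\<rbrakk> \<Longrightarrow>
      v \<otimes> inv u \<in> RA \<union> SA \<longleftrightarrow> f v \<otimes> inv (f u) \<in> RB \<union> SB"
proof -
  interpret A: subgroup A G by fact
  interpret B: subgroup B G by fact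
  have TAc: "TA \<subseteq> carrier G" and bA: "bij_betw (\<lambda>(a, t). a \<otimes> t) (A \<times> TA) (carrier G)"
    using TA right_transversal_iff[OF A] by auto
  have TBc: "TB \<subseteq> carrier G" and bB: "bij_betw (\<lambda>(a, t). a \<otimes> t) (B \<times> TB) (carrier G)"
    using TB right_transversal_iff[OF B] by auto
  \<comment> \<open>\<open>f\<close> will read off the factorization g = a t, apply \<sigma> to a
    and \<tau> to t, and multiply again.\<close>
  define i where "i = the_inv_into (A \<times> TA) (\<lambda>(a, t). a \<otimes> t)"
  have i: "i (a \<otimes> t) = (a, t)" if "a \<in> A" "t \<in> TA" for a t
    unfolding i_def using the_inv_into_f_f[of "\<lambda>(a, t). a \<otimes> t" "A \<times> TA" "(a, t)"] bA that
    by (auto simp: bij_betw_def)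
  define f where "f = (\<lambda>(a, t). a \<otimes> t) \<circ> map_prod \<sigma> \<tau> \<circ> i"
  have "bij_betw i (carrier G) (A \<times> TA)"
    unfolding i_def by (rule bij_betw_the_inv_into[OF bA])
  moreover have "bij_betw (map_prod \<sigma> \<tau>) (A \<times> TA) (B \<times> TB)"
    using \<sigma> \<tau> by (auto simp: bij_betw_def inj_on_def)
  ultimately have f: "bij_betw f (carrier G) (carrier G)"
    unfolding f_def using bB by (meson bij_betw_trans)
  \<comment> \<open>The quotient of a t and b s is t s^-1 multiplied from both sides by elements of
    \<open>A\<close>. This is why \<open>RA\<close> has to absorb multiplication by \<open>A\<close>
    on both sides.\<close>
  have quot: "a \<otimes> t \<otimes> inv (b \<otimes> s) = a \<otimes> (t \<otimes> inv s) \<otimes> inv b"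
    if "a \<in> carrier G" "b \<in> carrier G" "s \<in> carrier G" "t \<in> carrier G" for a b s t
    using that by (simp add: inv_mult_group m_assoc)
  have RAiff: "a \<otimes> r \<otimes> b \<in> RA \<longleftrightarrow> r \<in> RA" if "a \<in> A" "b \<in> A" "r \<in> carrier G" for a b r
  proof
    assume "a \<otimes> r \<otimes> b \<in> RA"
    then have "inv a \<otimes> (a \<otimes> r \<otimes> b) \<otimes> inv b \<in> RA"
      using that by (intro RA(3)[of "inv a" "inv b"]) auto
    then show "r \<in> RA"
      using that by (simp add: m_assoc)
  qed (use that RA in auto)
  have RBiff: "a \<otimes> r \<otimes> b \<in> RB \<longleftrightarrow> r \<in> RB" if "a \<in> B" "b \<in> B" "r \<in> carrier G" for a b r
  proof
    assume "a \<otimes> r \<otimes> b \<in> RB"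
    then have "inv a \<otimes> (a \<otimes> r \<otimes> b) \<otimes> inv b \<in> RB"
      using that by (intro RB(3)[of "inv a" "inv b"]) auto
    then show "r \<in> RB"
      using that by (simp add: m_assoc)
  qed (use that RB in auto)
  \<comment> \<open>Whether the quotient lies in the subgroup is decided by the representatives
    alone: equal ones involve only \<open>SA\<close>, distinct ones only \<open>RA\<close>.\<close>
  have sep: "a \<otimes> (t \<otimes> inv s) \<otimes> inv b \<in> C \<longleftrightarrow> s = t"
    if "subgroup C G" "right_transversal C T" "a \<in> C" "b \<in> C" "s \<in> T" "t \<in> T" for a b s t C T
  proof -
    interpret C: subgroup C G by fact
    have st: "s \<in> carrier G" "t \<in> carrier G" and ab: "a \<in> carrier G" "b \<in> carrier G"
      using that C.mem_carrier unfolding right_transversal_def by auto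
    have "t \<otimes> inv s \<in> C" if "a \<otimes> (t \<otimes> inv s) \<otimes> inv b \<in> C"
    proof -
      have "inv a \<otimes> (a \<otimes> (t \<otimes> inv s) \<otimes> inv b) \<otimes> b \<in> C"
        using \<open>a \<in> C\<close> \<open>b \<in> C\<close> that by auto
      then show ?thesis
        using st ab by (simp add: m_assoc)
    qed
    moreover have "t \<otimes> inv s \<in> C \<longrightarrow> s = t"
      using that st unfolding right_transversal_def by (metis C.one_closed r_inv)
    moreover have "a \<otimes> (t \<otimes> inv s) \<otimes> inv b \<in> C" if "s = t"
      using that st \<open>a \<in> C\<close> \<open>b \<in> C\<close> ab by simp
    ultimately show ?thesis by blast
  qed
  have "v \<otimes> inv u \<in> RA \<union> SA \<longleftrightarrow> f v \<otimes> inv (f u) \<in> RB \<union> SB"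
    if uv: "u \<in> carrier G" "v \<in> carrier G" for u v
  proof -
    have "u \<in> (\<lambda>(a, t). a \<otimes> t) ` (A \<times> TA)" "v \<in> (\<lambda>(a, t). a \<otimes> t) ` (A \<times> TA)"
      using bA uv unfolding bij_betw_def by simp_all
    then obtain b s a t where bs: "b \<in> A" "s \<in> TA" "u = b \<otimes> s"
      and at: "a \<in> A" "t \<in> TA" "v = a \<otimes> t"
      by auto
    have fu: "f u = \<sigma> b \<otimes> \<tau> s" and fv: "f v = \<sigma> a \<otimes> \<tau> t"
      using i bs at by (auto simp: f_def)
    have c: "s \<in> carrier G" "t \<in> carrier G" "\<tau> s \<in> carrier G" "\<tau> t \<in> carrier G"
      "\<sigma> a \<in> B" "\<sigma> b \<in> B" "\<tau> s \<in> TB" "\<tau> t \<in> TB"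
      using bs at TAc TBc bij_betwE[OF \<tau>] bij_betwE[OF \<sigma>] by auto
    have q1: "v \<otimes> inv u = a \<otimes> (t \<otimes> inv s) \<otimes> inv b"
      unfolding bs(3) at(3) using c bs(1) at(1) by (intro quot) auto
    have q2: "f v \<otimes> inv (f u) = \<sigma> a \<otimes> (\<tau> t \<otimes> inv (\<tau> s)) \<otimes> inv (\<sigma> b)"
      unfolding fu fv using c by (intro quot) auto
    note q = q1 q2
    have inj: "\<tau> s = \<tau> t \<longleftrightarrow> s = t"
      using bs at \<tau> by (meson bij_betw_def inj_on_contraD)
    show ?thesis
    proof (cases "s = t")
      case True
      have "v \<otimes> inv u = a \<otimes> inv b" "f v \<otimes> inv (f u) = \<sigma> a \<otimes> inv (\<sigma> b)"
        using q True c at(1) bs(1) by auto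
      moreover have "a \<otimes> inv b \<in> A" "\<sigma> a \<otimes> inv (\<sigma> b) \<in> B"
        using at bs c by auto
      ultimately show ?thesis
        using S[OF bs(1) at(1)] RA(1) RB(1) by auto
    next
      case False
      then have "v \<otimes> inv u \<notin> A" "f v \<otimes> inv (f u) \<notin> B"
        using q sep[OF A TA at(1) bs(1) bs(2) at(2)] sep[OF B TB c(5-8)] inj by auto
      moreover have "v \<otimes> inv u \<in> RA \<longleftrightarrow> t \<otimes> inv s \<in> RA"
        unfolding q using at bs c by (intro RAiff) auto
      moreover have "f v \<otimes> inv (f u) \<in> RB \<longleftrightarrow> \<tau> t \<otimes> inv (\<tau> s) \<in> RB"
        unfolding q using c by (intro RBiff) auto
      ultimately show ?thesis
        using SA SB R[OF bs(2) at(2)] by auto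
    qed
  qed
  then show ?thesis
    using f that by blast
qed

end

section \<open>Adjoining an element of prime order to a subgroup\<close>

text \<open>With natural exponents this is all of A<x> as soon as x has finite order; it is a
  subgroup if, in addition, x normalizes \<open>A\<close>.\<close>

definition (in group) adjoin :: "'a set \<Rightarrow> 'a \<Rightarrow> 'a set" where
  "adjoin A x = {a \<otimes> x [^] (i::nat) | a i. a \<in> A}"

context group
begin

lemma adjoinI: "a \<in> A \<Longrightarrow> a \<otimes> x [^] (i::nat) \<in> adjoin A x"
  by (auto simp: adjoin_def)

lemma adjoinE:
  assumes "z \<in> adjoin A x"
  obtains a i where "a \<in> A" "z = a \<otimes> x [^] (i::nat)"
  using assms by (auto simp: adjoin_def)

lemma subset_adjoin: "A \<subseteq> carrier G \<Longrightarrow> A \<subseteq> adjoin A x"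
proof
  fix a assume "A \<subseteq> carrier G" "a \<in> A"
  then show "a \<in> adjoin A x"
    using adjoinI[of a A x 0] by auto
qed

lemma mem_adjoin: "subgroup A G \<Longrightarrow> x \<in> carrier G \<Longrightarrow> x \<in> adjoin A x"
  using adjoinI[of \<one> A x 1] by (simp add: subgroup.one_closed)

lemma subgroup_nat_pow:
  assumes "subgroup A G" "a \<in> A"
  shows "a [^] (n::nat) \<in> A"
proof (induction n)
  case (Suc n)
  then show ?case
    using assms by (simp add: subgroup.m_closed)
qed (use assms in \<open>simp add: subgroup.one_closed\<close>)

lemma subgroup_int_pow:
  assumes "subgroup A G" "a \<in> A"
  shows "a [^] (n::int) \<in> A"
proof -
  have "a \<in> carrier G"
    using assms by (simp add: subgroup.mem_carrier)
  then show ?thesis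
    using subgroup_nat_pow[OF assms] subgroup.m_inv_closed[OF assms(1)]
    by (cases n rule: int_cases2) (auto simp: int_pow_int int_pow_neg)
qed

lemma conj_pow_mem:
  assumes A: "A \<subseteq> carrier G" "x \<in> carrier G" "\<And>a. a \<in> A \<Longrightarrow> x \<otimes> a \<otimes> inv x \<in> A" "a \<in> A"
  shows "x [^] (n::nat) \<otimes> a \<otimes> inv (x [^] n) \<in> A"
proof (induction n)
  case 0
  then show ?case using assms by auto
next
  case (Suc n)
  have "x \<otimes> (x [^] n \<otimes> a \<otimes> inv (x [^] n)) \<otimes> inv x \<in> A"
    using Suc assms(3) by blast
  moreover have "x \<otimes> (x [^] n \<otimes> a \<otimes> inv (x [^] n)) \<otimes> inv x = (x \<otimes> x [^] n) \<otimes> a \<otimes> inv (x \<otimes> x [^] n)"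
    using A by (simp add: inv_mult_group m_assoc subset_iff)
  ultimately show ?case
    using nat_pow_Suc2[OF assms(2), of n] by simp
qed

text \<open>By Bezout, if p does not divide m then x is a product of powers of x^p = 1 and of x^m,
  so x^m in \<open>A\<close> would put x into \<open>A\<close>.\<close>

lemma pow_prime_mem_iff:
  assumes A: "subgroup A G" and x: "x \<in> carrier G" "x [^] p = \<one>" "x \<notin> A" and p: "Factorial_Ring.prime (p::nat)"
  shows "x [^] (m::int) \<in> A \<longleftrightarrow> int p dvd m"
proof
  assume m: "x [^] m \<in> A"
  show "int p dvd m"
  proof (rule ccontr)
    assume "\<not> int p dvd m"
    then have "coprime (int p) m"
      using p by (simp add: prime_imp_coprime)
    then obtain u v where uv: "u * int p + v * m = 1"
      using bezout_int[of "int p" m] by auto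
    have "x = x [^] (u * int p + v * m)"
      using uv x by simp
    also have "\<dots> = (x [^] int p) [^] u \<otimes> (x [^] m) [^] v"
      using x by (simp add: int_pow_mult int_pow_pow mult.commute)
    also have "\<dots> = (x [^] m) [^] v"
      using x by (simp add: int_pow_int)
    finally show False
      using subgroup_int_pow[OF A m, of v] x by simp
  qed
next
  assume "int p dvd m"
  then have "x [^] m = \<one>"
    using x by (metis dvdE int_pow_int int_pow_one int_pow_pow)
  then show "x [^] m \<in> A"
    using A by (simp add: subgroup.one_closed)
qed

lemma nat_pow_eq_iff_mod:
  assumes x: "x \<in> carrier G" "x [^] p = \<one>" "x \<noteq> \<one>" and p: "Factorial_Ring.prime (p::nat)"
  shows "x [^] (i::nat) = x [^] (j::nat) \<longleftrightarrow> int p dvd int j - int i"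
proof -
  have "ord x = p"
    using x p ord_eq_1 pow_eq_id by (metis prime_nat_iff)
  then show ?thesis
    using int_pow_eq[OF x(1), of "int i" "int j"] by (simp add: int_pow_int)
qed

text \<open>Equal products put a power of x into \<open>A\<close>, and
  \<open>pow_prime_mem_iff\<close> then makes p divide the difference of the exponents.\<close>

lemma adjoin_unique:
  assumes A: "subgroup A G" and x: "x \<in> carrier G" "x [^] p = \<one>" "x \<notin> A" and p: "Factorial_Ring.prime (p::nat)"
    and ab: "a \<in> A" "b \<in> A" and eq: "a \<otimes> x [^] (i::nat) = b \<otimes> x [^] (j::nat)"
  shows "a = b" "int p dvd int j - int i" "x [^] i = x [^] j"
proof -
  have c: "a \<in> carrier G" "b \<in> carrier G"
    using A ab by (auto simp: subgroup.mem_carrier)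
  have "inv b \<otimes> a = inv b \<otimes> (a \<otimes> x [^] i) \<otimes> inv (x [^] i)"
    using c x by (simp add: m_assoc)
  also have "\<dots> = x [^] j \<otimes> inv (x [^] i)"
    unfolding eq using c x by (simp add: m_assoc)
  also have "\<dots> = x [^] (int j - int i)"
    using x by (simp add: int_pow_diff int_pow_int)
  finally have e: "inv b \<otimes> a = x [^] (int j - int i)" .
  moreover have "inv b \<otimes> a \<in> A"
    using A ab by (simp add: subgroup.m_closed subgroup.m_inv_closed)
  ultimately show d: "int p dvd int j - int i"
    using pow_prime_mem_iff[OF A x p] by simp
  have "x \<noteq> \<one>"
    using x A by (auto simp: subgroup.one_closed)
  then show xx: "x [^] i = x [^] j"
    using nat_pow_eq_iff_mod[OF x(1,2) _ p] d by blast
  then show "a = b"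
    using eq c x by simp
qed

lemma adjoin_mult:
  assumes A: "subgroup A G" and x: "x \<in> carrier G" and ab: "a \<in> A" "b \<in> A"
  shows "a \<otimes> x [^] (i::nat) \<otimes> (b \<otimes> x [^] (j::nat)) = a \<otimes> (x [^] i \<otimes> b \<otimes> inv (x [^] i)) \<otimes> x [^] (i + j)"
  using subgroup.mem_carrier[OF A] x ab by (simp add: m_assoc flip: nat_pow_mult)

lemma adjoin_subgroup:
  assumes A: "subgroup A G" and x: "x \<in> carrier G" "x [^] p = \<one>" and p: "p > (0::nat)"
    and norm: "\<And>a. a \<in> A \<Longrightarrow> x \<otimes> a \<otimes> inv x \<in> A"
  shows "subgroup (adjoin A x) G"
proof -
  interpret A: subgroup A G by fact
  have m: "u \<otimes> v \<in> adjoin A x" if uv: "u \<in> adjoin A x" "v \<in> adjoin A x" for u v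
  proof -
    obtain a i b j where ab: "a \<in> A" "b \<in> A" "u = a \<otimes> x [^] (i::nat)" "v = b \<otimes> x [^] (j::nat)"
      using adjoinE[OF uv(1)] adjoinE[OF uv(2)] by metis
    then show ?thesis
      using adjoin_mult[OF A x(1) ab(1,2), of i j] conj_pow_mem[OF A.subset x(1) norm ab(2), of i]
      by (auto intro!: adjoinI)
  qed
  \<comment> \<open>Inverses have to be written with natural exponents; i (p - 1) + i = p i.\<close>
  have xinv: "inv (x [^] (i::nat)) = x [^] (i * (p - 1))" for i
  proof (rule inv_equality)
    have "i * (p - 1) + i = p * i"
      using p by (cases p) auto
    then have "x [^] (i * (p - 1)) \<otimes> x [^] i = (x [^] p) [^] i"
      using x(1) by (simp add: nat_pow_mult nat_pow_pow)
    also have "\<dots> = \<one>"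
      using x by simp
    finally show "x [^] (i * (p - 1)) \<otimes> x [^] i = \<one>" .
  qed (use x in auto)
  show ?thesis
  proof (rule subgroupI)
    show "adjoin A x \<subseteq> carrier G"
      using x by (auto simp: adjoin_def)
    show "adjoin A x \<noteq> {}"
      using mem_adjoin[OF A x(1)] by auto
    fix u assume "u \<in> adjoin A x"
    then obtain a i where ai: "a \<in> A" "u = a \<otimes> x [^] (i::nat)"
      by (rule adjoinE)
    have "\<one> \<otimes> x [^] (i * (p - 1)) \<in> adjoin A x" "inv a \<otimes> x [^] (0::nat) \<in> adjoin A x"
      by (rule adjoinI, simp) (rule adjoinI, use ai in simp)
    then have "x [^] (i * (p - 1)) \<otimes> inv a \<in> adjoin A x"
      using m[of "\<one> \<otimes> x [^] (i * (p - 1))" "inv a \<otimes> x [^] (0::nat)"] ai x by simp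
    then show "inv u \<in> adjoin A x"
      using ai x xinv by (simp add: inv_mult_group)
  qed (use m in auto)
qed

lemma adjoin_eq_image:
  assumes A: "subgroup A G" and x: "x \<in> carrier G" "x [^] p = \<one>" and p: "Factorial_Ring.prime (p::nat)"
  shows "adjoin A x = (\<lambda>(a, i). a \<otimes> x [^] i) ` (A \<times> {..<p})"
proof
  show "adjoin A x \<subseteq> (\<lambda>(a, i). a \<otimes> x [^] i) ` (A \<times> {..<p})"
  proof
    fix z assume "z \<in> adjoin A x"
    then obtain a i where ai: "a \<in> A" "z = a \<otimes> x [^] (i::nat)"
      by (rule adjoinE)
    have "x [^] (p * (i div p)) = \<one>"
      using x nat_pow_pow[of x p "i div p"] by simp
    then have "x [^] i = x [^] (i mod p)"
      using x(1) nat_pow_mult[of x "p * (i div p)" "i mod p"] by simp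
    then show "z \<in> (\<lambda>(a, i). a \<otimes> x [^] i) ` (A \<times> {..<p})"
      using ai p prime_gt_0_nat[of p] by (intro image_eqI[of _ _ "(a, i mod p)"]) auto
  qed
qed (auto simp: adjoin_def)

lemma card_adjoin:
  assumes A: "subgroup A G" and x: "x \<in> carrier G" "x [^] p = \<one>" "x \<notin> A" and p: "Factorial_Ring.prime (p::nat)"
  shows "card (adjoin A x) = card A * p"
proof -
  have "inj_on (\<lambda>(a, i). a \<otimes> x [^] i) (A \<times> {..<p})"
  proof (rule inj_onI)
    fix q r assume q: "q \<in> A \<times> {..<p}" and r: "r \<in> A \<times> {..<p}"
      and e: "(\<lambda>(a, i). a \<otimes> x [^] i) q = (\<lambda>(a, i). a \<otimes> x [^] i) r"
    obtain a i b j where qr: "q = (a, i)" "r = (b, j)"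
      by fastforce
    then have *: "a \<in> A" "b \<in> A" "i < p" "j < p" "a \<otimes> x [^] i = b \<otimes> x [^] j"
      using q r e by auto
    have "int p dvd int j - int i"
      using adjoin_unique(2)[OF A x p *(1,2,5)] .
    then have "int j mod int p = int i mod int p"
      by (simp add: mod_eq_dvd_iff)
    then have "i = j"
      using *(3,4) by simp
    then show "q = r"
      unfolding qr using adjoin_unique(1)[OF A x p *(1,2,5)] by blast
  qed
  then show ?thesis
    unfolding adjoin_eq_image[OF A x(1,2) p] by (simp add: card_image card_cartesian_product)
qed

end

text \<open>The extension is a x^i |-> f(a) y^i. It is well defined and injective because on both
  sides the exponent counts only modulo p and the factor in the subgroup is determined; it is
  multiplicative because x and y centralize \<open>A\<close> and its image.\<close>

lemma ext_hom_adjoin: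
  assumes G: "group G" and H: "group H" and A: "subgroup A G" and p: "Factorial_Ring.prime (p::nat)"
    and f: "f \<in> hom (G\<lparr>carrier := A\<rparr>) H" "inj_on f A"
    and x: "x \<in> carrier G" "x [^]\<^bsub>G\<^esub> p = \<one>\<^bsub>G\<^esub>" "x \<notin> A" "\<And>a. a \<in> A \<Longrightarrow> a \<otimes>\<^bsub>G\<^esub> x = x \<otimes>\<^bsub>G\<^esub> a"
    and y: "y \<in> carrier H" "y [^]\<^bsub>H\<^esub> p = \<one>\<^bsub>H\<^esub>" "y \<notin> f ` A" "\<And>a. a \<in> A \<Longrightarrow> f a \<otimes>\<^bsub>H\<^esub> y = y \<otimes>\<^bsub>H\<^esub> f a"
  obtains F where "F \<in> hom (G\<lparr>carrier := group.adjoin G A x\<rparr>) H" "inj_on F (group.adjoin G A x)"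
    "\<And>a. a \<in> A \<Longrightarrow> F a = f a" "F x = y"
proof -
  interpret G: group G by fact
  interpret H: group H by fact
  interpret A: subgroup A G by fact
  interpret f: group_hom "G\<lparr>carrier := A\<rparr>" H f
    using f(1) A.subgroup_is_group[OF G] H by (auto simp: group_hom_def group_hom_axioms_def)
  have B: "subgroup (f ` A) H"
    using f.img_is_subgroup by simp
  have fc: "f a \<in> carrier H" if "a \<in> A" for a
    using f.hom_closed that by simp
  have fm: "f (a \<otimes>\<^bsub>G\<^esub> b) = f a \<otimes>\<^bsub>H\<^esub> f b" if "a \<in> A" "b \<in> A" for a b
    using f.hom_mult that by simp
  have f1: "f \<one>\<^bsub>G\<^esub> = \<one>\<^bsub>H\<^esub>"
    using f.hom_one by simp
  \<comment> \<open>Some representation a x^i is picked by choice; the fact \<open>F\<close> below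
    says that every representation gives the same value.\<close>
  define F where "F z = (let q = (SOME q. fst q \<in> A \<and> z = fst q \<otimes>\<^bsub>G\<^esub> x [^]\<^bsub>G\<^esub> (snd q :: nat))
    in f (fst q) \<otimes>\<^bsub>H\<^esub> y [^]\<^bsub>H\<^esub> snd q)" for z
  have y1: "y \<noteq> \<one>\<^bsub>H\<^esub>"
    using y(3) imageI[OF A.one_closed, of f] f1 by auto
  have F: "F (a \<otimes>\<^bsub>G\<^esub> x [^]\<^bsub>G\<^esub> i) = f a \<otimes>\<^bsub>H\<^esub> y [^]\<^bsub>H\<^esub> i" if "a \<in> A" for a and i :: nat
  proof -
    define q where "q = (SOME q. fst q \<in> A \<and> a \<otimes>\<^bsub>G\<^esub> x [^]\<^bsub>G\<^esub> i = fst q \<otimes>\<^bsub>G\<^esub> x [^]\<^bsub>G\<^esub> (snd q :: nat))"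
    have "fst q \<in> A \<and> a \<otimes>\<^bsub>G\<^esub> x [^]\<^bsub>G\<^esub> i = fst q \<otimes>\<^bsub>G\<^esub> x [^]\<^bsub>G\<^esub> snd q"
      unfolding q_def by (rule someI[of _ "(a, i)"]) (use that in auto)
    then have q: "fst q \<in> A" "a \<otimes>\<^bsub>G\<^esub> x [^]\<^bsub>G\<^esub> i = fst q \<otimes>\<^bsub>G\<^esub> x [^]\<^bsub>G\<^esub> snd q"
      by auto
    have "a = fst q" "int p dvd int (snd q) - int i"
      using G.adjoin_unique[OF A x(1-3) p that q] by auto
    moreover from this(2) have "y [^]\<^bsub>H\<^esub> i = y [^]\<^bsub>H\<^esub> snd q"
      using H.nat_pow_eq_iff_mod[OF y(1,2) y1 p] by blast
    ultimately show ?thesis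
      unfolding F_def Let_def q_def[symmetric] by simp
  qed
  have xi: "x [^]\<^bsub>G\<^esub> i \<otimes>\<^bsub>G\<^esub> b = b \<otimes>\<^bsub>G\<^esub> x [^]\<^bsub>G\<^esub> i" if "b \<in> A" for b and i :: nat
    using G.group_commutes_pow[of x b i] x that by simp
  have yi: "y [^]\<^bsub>H\<^esub> i \<otimes>\<^bsub>H\<^esub> f b = f b \<otimes>\<^bsub>H\<^esub> y [^]\<^bsub>H\<^esub> i" if "b \<in> A" for b and i :: nat
    using H.group_commutes_pow[of y "f b" i] y that fc by simp
  have hom: "F \<in> hom (G\<lparr>carrier := G.adjoin A x\<rparr>) H"
  proof (rule homI)
    fix u assume "u \<in> carrier (G\<lparr>carrier := G.adjoin A x\<rparr>)"
    then show "F u \<in> carrier H"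
      using F fc y(1) by (auto elim!: G.adjoinE)
  next
    fix u v
    assume uv: "u \<in> carrier (G\<lparr>carrier := G.adjoin A x\<rparr>)" "v \<in> carrier (G\<lparr>carrier := G.adjoin A x\<rparr>)"
    then obtain a b i j where ab: "a \<in> A" "b \<in> A"
      and u: "u = a \<otimes>\<^bsub>G\<^esub> x [^]\<^bsub>G\<^esub> (i::nat)" and v: "v = b \<otimes>\<^bsub>G\<^esub> x [^]\<^bsub>G\<^esub> (j::nat)"
      by (auto elim!: G.adjoinE)
    have "u \<otimes>\<^bsub>G\<^esub> v = (a \<otimes>\<^bsub>G\<^esub> b) \<otimes>\<^bsub>G\<^esub> x [^]\<^bsub>G\<^esub> (i + j)"
      unfolding u v G.adjoin_mult[OF A x(1) ab] xi[OF ab(2)] using ab x by (simp add: G.m_assoc)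
    then have "F (u \<otimes>\<^bsub>G\<^esub> v) = f (a \<otimes>\<^bsub>G\<^esub> b) \<otimes>\<^bsub>H\<^esub> y [^]\<^bsub>H\<^esub> (i + j)"
      using F[of "a \<otimes>\<^bsub>G\<^esub> b" "i + j"] ab by simp
    also have "\<dots> = f a \<otimes>\<^bsub>H\<^esub> (y [^]\<^bsub>H\<^esub> i \<otimes>\<^bsub>H\<^esub> f b \<otimes>\<^bsub>H\<^esub> inv\<^bsub>H\<^esub> (y [^]\<^bsub>H\<^esub> i)) \<otimes>\<^bsub>H\<^esub> y [^]\<^bsub>H\<^esub> (i + j)"
      unfolding yi[OF ab(2)] using fm[OF ab] fc ab y by (simp add: H.m_assoc)
    also have "\<dots> = f a \<otimes>\<^bsub>H\<^esub> y [^]\<^bsub>H\<^esub> i \<otimes>\<^bsub>H\<^esub> (f b \<otimes>\<^bsub>H\<^esub> y [^]\<^bsub>H\<^esub> j)"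
      using H.adjoin_mult[OF B y(1), of "f a" "f b" i j] ab by simp
    also have "\<dots> = F u \<otimes>\<^bsub>H\<^esub> F v"
      unfolding u v using F ab by simp
    finally show "F (u \<otimes>\<^bsub>G\<lparr>carrier := G.adjoin A x\<rparr>\<^esub> v) = F u \<otimes>\<^bsub>H\<^esub> F v"
      by simp
  qed
  have inj: "inj_on F (G.adjoin A x)"
  proof (rule inj_onI)
    fix u v assume uv: "u \<in> G.adjoin A x" "v \<in> G.adjoin A x" and e: "F u = F v"
    then obtain a b i j where ab: "a \<in> A" "b \<in> A"
      and u: "u = a \<otimes>\<^bsub>G\<^esub> x [^]\<^bsub>G\<^esub> (i::nat)" and v: "v = b \<otimes>\<^bsub>G\<^esub> x [^]\<^bsub>G\<^esub> (j::nat)"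
      by (auto elim!: G.adjoinE)
    have e': "f a \<otimes>\<^bsub>H\<^esub> y [^]\<^bsub>H\<^esub> i = f b \<otimes>\<^bsub>H\<^esub> y [^]\<^bsub>H\<^esub> j"
      using e F ab unfolding u v by simp
    have "f a = f b" "int p dvd int j - int i"
      using H.adjoin_unique[OF B y(1-3) p _ _ e'] ab by auto
    moreover have "x \<noteq> \<one>\<^bsub>G\<^esub>"
      using x(3) A.one_closed by auto
    ultimately have "a = b" "x [^]\<^bsub>G\<^esub> i = x [^]\<^bsub>G\<^esub> j"
      using inj_onD[OF f(2) _ ab] G.nat_pow_eq_iff_mod[OF x(1,2) _ p] by blast+
    then show "u = v"
      unfolding u v by simp
  qed
  have "F a = f a" if "a \<in> A" for a
    using F[OF that, of 0] that fc by simp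
  moreover have "F x = y"
    using F[OF A.one_closed, of 1] x y f1 by simp
  ultimately show ?thesis
    using hom inj that by blast
qed

text \<open>Completion to a basis over the field with p elements, in group terms: as long as
  \<open>A\<close> is proper, the equal cardinalities leave an element of \<open>H\<close> outside
  f(A) to serve as the image of a new x.\<close>

lemma ext_iso_elementary:
  assumes G: "comm_group G" and H: "comm_group H" and p: "Factorial_Ring.prime (p::nat)"
    and Gp: "\<And>x. x \<in> carrier G \<Longrightarrow> x [^]\<^bsub>G\<^esub> p = \<one>\<^bsub>G\<^esub>"
    and Hp: "\<And>x. x \<in> carrier H \<Longrightarrow> x [^]\<^bsub>H\<^esub> p = \<one>\<^bsub>H\<^esub>"
    and fin: "finite (carrier G)" "finite (carrier H)" and card: "card (carrier G) = card (carrier H)"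
  shows "\<lbrakk>subgroup A G; f \<in> hom (G\<lparr>carrier := A\<rparr>) H; inj_on f A\<rbrakk> \<Longrightarrow>
    \<exists>F\<in>iso G H. \<forall>a\<in>A. F a = f a"
proof (induction "card (carrier G) - card A" arbitrary: A f rule: less_induct)
  case less
  interpret G: comm_group G by fact
  interpret H: comm_group H by fact
  interpret A: subgroup A G by fact
  have fA: "f ` A \<subseteq> carrier H"
    using less.prems(2) by (auto simp: hom_def)
  have finA: "finite A"
    using fin A.subset finite_subset by blast
  show ?case
  proof (cases "A = carrier G")
    case True
    then have "f ` A = carrier H"
      using card_subset_eq[OF fin(2) fA] card_image[OF less.prems(3)] card by simp
    then have "f \<in> iso G H"
      using less.prems True by (auto simp: iso_def bij_betw_def hom_def)
    then show ?thesis by blast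
  next
    case False
    then obtain x where x: "x \<in> carrier G" "x \<notin> A"
      using A.subset by blast
    have lt: "card A < card (carrier G)"
      using False fin A.subset by (simp add: psubset_card_mono psubset_eq)
    then have "f ` A \<noteq> carrier H"
      using card_image[OF less.prems(3)] card by auto
    then obtain y where y: "y \<in> carrier H" "y \<notin> f ` A"
      using fA by blast
    have comm: "a \<otimes>\<^bsub>G\<^esub> x = x \<otimes>\<^bsub>G\<^esub> a" "f a \<otimes>\<^bsub>H\<^esub> y = y \<otimes>\<^bsub>H\<^esub> f a" if "a \<in> A" for a
    proof -
      show "a \<otimes>\<^bsub>G\<^esub> x = x \<otimes>\<^bsub>G\<^esub> a"
        using that x(1) by (intro G.m_comm) simp_all
      have "f a \<in> carrier H"
        using that fA by blast
      then show "f a \<otimes>\<^bsub>H\<^esub> y = y \<otimes>\<^bsub>H\<^esub> f a"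
        using y(1) by (rule H.m_comm)
    qed
    obtain F where F: "F \<in> hom (G\<lparr>carrier := G.adjoin A x\<rparr>) H" "inj_on F (G.adjoin A x)"
      "\<And>a. a \<in> A \<Longrightarrow> F a = f a"
      using ext_hom_adjoin[OF G.is_group H.is_group less.prems(1) p less.prems(2,3)
          x(1) Gp[OF x(1)] x(2) comm(1) y(1) Hp[OF y(1)] y(2) comm(2)]
      by blast
    have sg: "subgroup (G.adjoin A x) G"
    proof (rule G.adjoin_subgroup[OF less.prems(1) x(1) Gp])
      show "p > 0" using p by (simp add: prime_gt_0_nat)
      show "x \<otimes>\<^bsub>G\<^esub> a \<otimes>\<^bsub>G\<^esub> inv\<^bsub>G\<^esub> x \<in> A" if "a \<in> A" for a
        using x that by (simp add: G.m_comm[of x a] G.m_assoc)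
    qed (use x in auto)
    have "card (G.adjoin A x) = card A * p"
      by (rule G.card_adjoin[OF less.prems(1) x(1) Gp x(2) p]) (rule x)
    moreover have "A \<noteq> {}"
      using A.one_closed by blast
    then have "card A > 0"
      using finA by (simp add: card_gt_0_iff)
    then have "card A < card A * p"
      using prime_gt_1_nat[OF p] by simp
    ultimately have "card (carrier G) - card (G.adjoin A x) < card (carrier G) - card A"
      using lt by (simp add: diff_less_mono2)
    from less.hyps[OF this sg F(1,2)] obtain F' where F': "F' \<in> iso G H" "\<forall>a\<in>G.adjoin A x. F' a = F a"
      by blast
    then show ?thesis
      using F(3) G.subset_adjoin[OF A.subset, of x] by (intro bexI[of _ F']) auto
  qed
qed

section \<open>Consequences of the CI property\<close>

lemma graph_iso_sym:
  assumes "graph_iso \<Gamma> Y"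
  shows "graph_iso Y \<Gamma>"
proof -
  obtain f where f: "bij_betw f (fst \<Gamma>) (fst Y)"
    and e: "\<And>u v. u \<in> fst \<Gamma> \<Longrightarrow> v \<in> fst \<Gamma> \<Longrightarrow> {u, v} \<in> snd \<Gamma> \<longleftrightarrow> {f u, f v} \<in> snd Y"
    using assms unfolding graph_iso_def by blast
  let ?g = "inv_into (fst \<Gamma>) f"
  have g: "bij_betw ?g (fst Y) (fst \<Gamma>)"
    using f by (rule bij_betw_inv_into)
  have "{u, v} \<in> snd Y \<longleftrightarrow> {?g u, ?g v} \<in> snd \<Gamma>" if "u \<in> fst Y" "v \<in> fst Y" for u v
    using e[of "?g u" "?g v"] that bij_betwE[OF g] bij_betw_inv_into_right[OF f] by auto
  then show ?thesis
    unfolding graph_iso_def using g by blast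
qed

lemma even_card_fixpoint_free_involution:
  assumes "finite \<Gamma>" "\<And>x. x \<in> \<Gamma> \<Longrightarrow> f x \<in> \<Gamma>" "\<And>x. x \<in> \<Gamma> \<Longrightarrow> f (f x) = x" "\<And>x. x \<in> \<Gamma> \<Longrightarrow> f x \<noteq> x"
  shows "even (card \<Gamma>)"
  using assms
proof (induction "card \<Gamma>" arbitrary: \<Gamma> rule: less_induct)
  case less
  show ?case
  proof (cases "\<Gamma> = {}")
    case False
    then obtain x where x: "x \<in> \<Gamma>" by blast
    let ?Y = "\<Gamma> - {x, f x}"
    have c: "card \<Gamma> = card ?Y + 2"
    proof -
      have "{x, f x} \<subseteq> \<Gamma>" "card {x, f x} = 2"
        using less.prems(2,4) x by (auto simp: card_2_iff)
      then show ?thesis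
        using less.prems(1) card_Diff_subset[of "{x, f x}" \<Gamma>] card_mono[of \<Gamma> "{x, f x}"] by auto
    qed
    have "even (card ?Y)"
    proof (rule less.hyps)
      show "f y \<in> ?Y" if "y \<in> ?Y" for y
        using that less.prems x by (metis Diff_iff empty_iff insert_iff)
    qed (use c less.prems in auto)
    then show ?thesis using c by simp
  qed simp
qed

lemma (in group) sub_homD:
  assumes A: "subgroup A G" and H: "group H" and f: "f \<in> hom (G\<lparr>carrier := A\<rparr>) H"
  shows "a \<in> A \<Longrightarrow> f a \<in> carrier H" "f \<one> = \<one>\<^bsub>H\<^esub>"
    "\<lbrakk>a \<in> A; b \<in> A\<rbrakk> \<Longrightarrow> f (a \<otimes> b) = f a \<otimes>\<^bsub>H\<^esub> f b" "a \<in> A \<Longrightarrow> f (inv a) = inv\<^bsub>H\<^esub> (f a)"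
    "subgroup (f ` A) H"
proof -
  interpret A: subgroup A G by fact
  interpret f: group_hom "G\<lparr>carrier := A\<rparr>" H f
    using f A.subgroup_is_group[OF is_group] H by (auto simp: group_hom_def group_hom_axioms_def)
  show "a \<in> A \<Longrightarrow> f a \<in> carrier H" "f \<one> = \<one>\<^bsub>H\<^esub>"
    "\<lbrakk>a \<in> A; b \<in> A\<rbrakk> \<Longrightarrow> f (a \<otimes> b) = f a \<otimes>\<^bsub>H\<^esub> f b"
    using f.hom_closed f.hom_one f.hom_mult by simp_all
  show "a \<in> A \<Longrightarrow> f (inv a) = inv\<^bsub>H\<^esub> (f a)"
    using f.hom_inv[of a] m_inv_consistent[OF A] by simp
  show "subgroup (f ` A) H"
    using f.img_is_subgroup by simp
qed

section \<open>Automorphisms obtained by comparing connection sets inside subgroups\<close>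

context group
begin

lemma autoD_group:
  assumes \<alpha>: "\<alpha> \<in> auto G"
  shows "a \<in> carrier G \<Longrightarrow> \<alpha> a \<in> carrier G" "\<alpha> \<one> = \<one>"
    "\<lbrakk>a \<in> carrier G; b \<in> carrier G\<rbrakk> \<Longrightarrow> \<alpha> (a \<otimes> b) = \<alpha> a \<otimes> \<alpha> b"
    "a \<in> carrier G \<Longrightarrow> \<alpha> (inv a) = inv (\<alpha> a)"
    "a \<in> carrier G \<Longrightarrow> \<alpha> (a [^] (n::nat)) = \<alpha> a [^] n"
    "inj_on \<alpha> (carrier G)" "\<alpha> ` carrier G = carrier G"
    "A \<subseteq> carrier G \<Longrightarrow> card (\<alpha> ` A) = card A"
proof -
  interpret \<alpha>: group_hom G G \<alpha>
    using autoD[OF \<alpha>] by (auto simp: group_hom_def group_hom_axioms_def)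
  show "a \<in> carrier G \<Longrightarrow> \<alpha> a \<in> carrier G" "\<alpha> \<one> = \<one>"
    "\<lbrakk>a \<in> carrier G; b \<in> carrier G\<rbrakk> \<Longrightarrow> \<alpha> (a \<otimes> b) = \<alpha> a \<otimes> \<alpha> b"
    "a \<in> carrier G \<Longrightarrow> \<alpha> (inv a) = inv (\<alpha> a)"
    "a \<in> carrier G \<Longrightarrow> \<alpha> (a [^] (n::nat)) = \<alpha> a [^] n"
    by (simp_all add: \<alpha>.hom_nat_pow)
  show inj: "inj_on \<alpha> (carrier G)" "\<alpha> ` carrier G = carrier G"
    using autoD(2)[OF \<alpha>] by (simp_all add: bij_betw_def)
  show "A \<subseteq> carrier G \<Longrightarrow> card (\<alpha> ` A) = card A"
    using inj by (simp add: card_image inj_on_subset)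
qed

lemma auto_eq_iff:
  assumes \<alpha>: "\<alpha> \<in> auto G" and "a \<in> carrier G" "b \<in> carrier G"
  shows "\<alpha> a = \<alpha> b \<longleftrightarrow> a = b"
  using inj_on_eq_iff[OF autoD_group(6)[OF \<alpha>]] assms by blast

lemma auto_one_iff:
  assumes \<alpha>: "\<alpha> \<in> auto G" and "a \<in> carrier G"
  shows "\<alpha> a = \<one> \<longleftrightarrow> a = \<one>"
  using auto_eq_iff[OF assms one_closed] autoD_group(2)[OF \<alpha>] by simp

text \<open>With empty \<open>RA\<close> and \<open>RB\<close> the graph is a disjoint union of
  copies of the graph on the subgroup, one for each coset. Equal cardinalities of \<open>A\<close>
  and \<open>B\<close> give equally many cosets, so any bijection of the transversals will
  do.\<close>

lemma CI_coset_auto: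
  assumes CI: "CI_group G" and A: "subgroup A G" and B: "subgroup B G"
    and \<sigma>: "bij_betw \<sigma> A B"
    and SA: "SA \<subseteq> A" "inverse_closed G SA" and SB: "SB \<subseteq> B" "inverse_closed G SB"
    and S: "\<And>u v. \<lbrakk>u \<in> A; v \<in> A\<rbrakk> \<Longrightarrow> v \<otimes> inv u \<in> SA \<longleftrightarrow> \<sigma> v \<otimes> inv (\<sigma> u) \<in> SB"
  obtains \<alpha> where "\<alpha> \<in> auto G" "\<alpha> ` SA = SB"
proof -
  have fin: "finite (carrier G)"
    using CI by (rule CI_groupD)
  obtain TA where TA: "right_transversal A TA"
    using ex_right_transversal[OF A] by blast
  obtain TB where TB: "right_transversal B TB"
    using ex_right_transversal[OF B] by blast
  have bij: "TA \<subseteq> carrier G" "bij_betw (\<lambda>(a, t). a \<otimes> t) (A \<times> TA) (carrier G)"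
     "TB \<subseteq> carrier G" "bij_betw (\<lambda>(a, t). a \<otimes> t) (B \<times> TB) (carrier G)"
    using TA TB right_transversal_iff A B by auto
  have "card A * card TA = card B * card TB"
    using bij_betw_same_card[OF bij(2)] bij_betw_same_card[OF bij(4)] by (simp add: card_cartesian_product)
  moreover have "card A = card B"
    using bij_betw_same_card[OF \<sigma>] .
  moreover have "card A > 0"
    using subgroup.finite_imp_card_positive[OF A fin] .
  ultimately have "card TA = card TB"
    by simp
  moreover have "finite TA" "finite TB"
    using bij fin finite_subset by auto
  ultimately obtain \<tau> where \<tau>: "bij_betw \<tau> TA TB"
    using finite_same_card_bij by blast
  obtain f where f: "bij_betw f (carrier G) (carrier G)"
    "\<And>u v. \<lbrakk>u \<in> carrier G; v \<in> carrier G\<rbrakk> \<Longrightarrow>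
      v \<otimes> inv u \<in> {} \<union> SA \<longleftrightarrow> f v \<otimes> inv (f u) \<in> {} \<union> SB"
    using coset_extension[OF A B TA TB \<sigma> \<tau> SA(1) SB(1) S, of "{}" "{}"] by auto
  show ?thesis
    using CI_group_auto[OF CI SA(2) SB(2) f(1)] f(2) that by auto
qed

text \<open>For the connection set \<open>A - {\<one>}\<close> the graph is a union of complete
  graphs on the cosets of \<open>A\<close>. Every bijection from \<open>A\<close> to
  \<open>B\<close> preserves completeness, so only the cardinalities are compared.\<close>

lemma CI_conj_subgroups:
  assumes CI: "CI_group G" and A: "subgroup A G" and B: "subgroup B G" and card: "card A = card B"
  obtains \<alpha> where "\<alpha> \<in> auto G" "\<alpha> ` A = B"
proof -
  interpret A: subgroup A G by fact
  interpret B: subgroup B G by fact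
  have "finite A" "finite B"
    using A.subset B.subset CI_groupD(2)[OF CI] finite_subset by auto
  then obtain \<sigma> where \<sigma>: "bij_betw \<sigma> A B"
    using finite_same_card_bij card by blast
  have quot: "v \<otimes> inv u \<in> C - {\<one>} \<longleftrightarrow> v \<noteq> u" if "subgroup C G" "u \<in> C" "v \<in> C" for u v C
  proof -
    have c: "u \<in> carrier G" "v \<in> carrier G"
      using that by (auto simp: subgroup.mem_carrier)
    then have "v \<otimes> inv u = \<one> \<longleftrightarrow> v = u"
      using inv_solve_right'[of \<one> v u] by auto
    then show ?thesis
      using that by (simp add: subgroup.m_closed subgroup.m_inv_closed)
  qed
  obtain \<alpha> where \<alpha>: "\<alpha> \<in> auto G" "\<alpha> ` (A - {\<one>}) = B - {\<one>}"
  proof (rule CI_coset_auto[OF CI A B \<sigma>])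
    show "inverse_closed G (A - {\<one>})" "inverse_closed G (B - {\<one>})"
      by (intro inverse_closedI; auto)+
    fix u v assume uv: "u \<in> A" "v \<in> A"
    then have "\<sigma> u \<in> B" "\<sigma> v \<in> B" "\<sigma> v = \<sigma> u \<longleftrightarrow> v = u"
      using \<sigma> by (auto simp: bij_betw_def inj_on_eq_iff)
    then show "v \<otimes> inv u \<in> A - {\<one>} \<longleftrightarrow> \<sigma> v \<otimes> inv (\<sigma> u) \<in> B - {\<one>}"
      using quot[OF A] quot[OF B] uv by simp
  qed auto
  have "\<alpha> ` A = insert (\<alpha> \<one>) (\<alpha> ` (A - {\<one>}))"
    using A.one_closed by blast
  also have "\<dots> = B"
    using \<alpha>(2) autoD_group(2)[OF \<alpha>(1)] B.one_closed by auto
  finally show ?thesis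
    using \<alpha>(1) that by blast
qed

lemma hom_quot_mem_iff:
  assumes A: "subgroup A G" and f: "f \<in> hom (G\<lparr>carrier := A\<rparr>) G" "inj_on f A"
    and S: "S \<subseteq> A" and uv: "u \<in> A" "v \<in> A"
  shows "v \<otimes> inv u \<in> S \<longleftrightarrow> f v \<otimes> inv (f u) \<in> f ` S"
proof -
  interpret A: subgroup A G by fact
  have "f v \<otimes> inv (f u) = f (v \<otimes> inv u)"
    using sub_homD[OF A is_group f(1)] uv by simp
  then show ?thesis
    using inj_on_image_mem_iff[OF f(2) _ S, of "v \<otimes> inv u"] uv by simp
qed

lemma hom_image_inverse_closed:
  assumes A: "subgroup A G" and f: "f \<in> hom (G\<lparr>carrier := A\<rparr>) G" "inj_on f A"
    and S: "S \<subseteq> A" "inverse_closed G S"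
  shows "inverse_closed G (f ` S)"
proof (rule inverse_closedI)
  interpret A: subgroup A G by fact
  note h = sub_homD[OF A is_group f(1)]
  show "f ` S \<subseteq> carrier G"
    using h(1) S(1) by auto
  show "\<one> \<notin> f ` S"
  proof
    assume "\<one> \<in> f ` S"
    then have "f \<one> \<in> f ` S"
      using h(2) by simp
    then have "\<one> \<in> S"
      using inj_on_image_mem_iff[OF f(2) A.one_closed S(1)] by blast
    then show False
      using inverse_closedD(2)[OF S(2)] by blast
  qed
  show "inv y \<in> f ` S" if y: "y \<in> f ` S" for y
  proof -
    obtain s where s: "s \<in> S" "y = f s"
      using y by blast
    then have "inv y = f (inv s)"
      using h(4) S(1) by auto
    then show ?thesis
      using inverse_closedD(3)[OF S(2) s(1)] by blast
  qed
qed

text \<open>An injective homomorphism preserves quotients, hence the relation defined by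
  \<open>S\<close>. It may fail to extend to \<open>G\<close>, yet some automorphism of
  \<open>G\<close> has the same image of \<open>S\<close>.\<close>

lemma CI_hom_subset:
  assumes CI: "CI_group G" and A: "subgroup A G"
    and f: "f \<in> hom (G\<lparr>carrier := A\<rparr>) G" "inj_on f A"
    and S: "S \<subseteq> A" "inverse_closed G S"
  obtains \<alpha> where "\<alpha> \<in> auto G" "\<alpha> ` S = f ` S"
proof -
  have bij: "bij_betw f A (f ` A)"
    using f by (simp add: bij_betw_def)
  show ?thesis
    using CI_coset_auto[OF CI A sub_homD(5)[OF A is_group f(1)] bij S image_mono[OF S(1)]
        hom_image_inverse_closed[OF A f S] hom_quot_mem_iff[OF A f S(1)]] that
    by blast
qed

text \<open>\<open>R\<close> consists of whole double cosets of \<open>A\<close> outside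
  \<open>A\<close>, so acting by f inside each coset and trivially on the representatives keeps it.
  Such an \<open>R\<close> records what happens outside \<open>A\<close>.\<close>

lemma CI_coset_hom_subset:
  assumes CI: "CI_group G" and A: "subgroup A G"
    and f: "f \<in> hom (G\<lparr>carrier := A\<rparr>) G" "inj_on f A" "f ` A = A"
    and S: "S \<subseteq> A" "inverse_closed G S"
    and R: "R \<inter> A = {}" "inverse_closed G R" "\<And>a b r. \<lbrakk>a \<in> A; b \<in> A; r \<in> R\<rbrakk> \<Longrightarrow> a \<otimes> r \<otimes> b \<in> R"
  obtains \<alpha> where "\<alpha> \<in> auto G" "\<alpha> ` (R \<union> S) = R \<union> f ` S"
proof -
  obtain T where T: "right_transversal A T"
    using ex_right_transversal[OF A] by blast
  have fS: "f ` S \<subseteq> A" "inverse_closed G (f ` S)"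
    using f(3) S hom_image_inverse_closed[OF A f(1,2) S] by auto
  have bij: "bij_betw f A A"
    using f by (simp add: bij_betw_def)
  have id: "t \<otimes> inv s \<in> R \<longleftrightarrow> id t \<otimes> inv (id s) \<in> R" for s t
    by simp
  obtain g where g: "bij_betw g (carrier G) (carrier G)"
    "\<And>u v. \<lbrakk>u \<in> carrier G; v \<in> carrier G\<rbrakk> \<Longrightarrow>
      v \<otimes> inv u \<in> R \<union> S \<longleftrightarrow> g v \<otimes> inv (g u) \<in> R \<union> f ` S"
    using coset_extension[OF A A T T bij bij_betw_id S(1) fS(1) hom_quot_mem_iff[OF A f(1,2) S(1)]
        R(1) inverse_closedD(1)[OF R(2)] R(3) R(1) inverse_closedD(1)[OF R(2)] R(3) id]
    by blast
  have un: "inverse_closed G (R \<union> \<Gamma>)" if "inverse_closed G \<Gamma>" for \<Gamma>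
    using inverse_closedD[OF that] inverse_closedD[OF R(2)] by (intro inverse_closedI) auto
  show ?thesis
    using CI_group_auto[OF CI un[OF S(2)] un[OF fS(2)] g] that by blast
qed

lemma hom_adjoin_prime:
  assumes H: "group H" and p: "Factorial_Ring.prime (p::nat)"
    and x: "x \<in> carrier G" "x [^] p = \<one>" "x \<noteq> \<one>"
    and y: "y \<in> carrier H" "y [^]\<^bsub>H\<^esub> p = \<one>\<^bsub>H\<^esub>" "y \<noteq> \<one>\<^bsub>H\<^esub>"
  obtains F where "F \<in> hom (G\<lparr>carrier := adjoin {\<one>} x\<rparr>) H" "inj_on F (adjoin {\<one>} x)" "F x = y"
proof -
  interpret H: group H by fact
  have "(\<lambda>_. \<one>\<^bsub>H\<^esub>) \<in> hom (G\<lparr>carrier := {\<one>}\<rparr>) H"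
    by (auto simp: hom_def)
  then show ?thesis
    using ext_hom_adjoin[OF is_group H triv_subgroup p _ _ x(1,2) _ _ y(1,2), of "\<lambda>_. \<one>\<^bsub>H\<^esub>"] x y that
    by auto
qed

lemma cyclic_prime_subgroup:
  assumes p: "Factorial_Ring.prime (p::nat)" and x: "x \<in> carrier G" "x [^] p = \<one>" "x \<noteq> \<one>"
  shows "subgroup (adjoin {\<one>} x) G" "card (adjoin {\<one>} x) = p"
  using adjoin_subgroup[OF triv_subgroup x(1,2)] card_adjoin[OF triv_subgroup x(1,2) _ p] x prime_gt_0_nat[OF p]
  by auto

lemma inverse_closed_pair:
  assumes x: "x \<in> carrier G" "x \<noteq> \<one>"
  shows "inverse_closed G {x, inv x}"
proof (rule inverse_closedI)
  show "\<one> \<notin> {x, inv x}"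
    using x inv_eq_1_iff[of x] by (metis empty_iff insert_iff)
qed (use x in auto)

text \<open>The smallest inverse-closed set containing x is {x, x^-1}, so the CI property can match
  x with y only up to inversion.\<close>

lemma CI_conj_prime:
  assumes CI: "CI_group G" and p: "Factorial_Ring.prime (p::nat)"
    and x: "x \<in> carrier G" "x [^] p = \<one>" "x \<noteq> \<one>"
    and y: "y \<in> carrier G" "y [^] p = \<one>" "y \<noteq> \<one>"
  obtains \<alpha> where "\<alpha> \<in> auto G" "\<alpha> x = y \<or> \<alpha> x = inv y"
proof -
  let ?A = "adjoin {\<one>} x"
  have A: "subgroup ?A G"
    by (rule cyclic_prime_subgroup[OF p x])
  obtain F where F: "F \<in> hom (G\<lparr>carrier := ?A\<rparr>) G" "inj_on F ?A" "F x = y"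
    using hom_adjoin_prime[OF is_group p x y] by blast
  have xA: "x \<in> ?A"
    by (rule mem_adjoin[OF triv_subgroup x(1)])
  have ic: "inverse_closed G {x, inv x}"
    by (rule inverse_closed_pair[OF x(1,3)])
  obtain \<alpha> where \<alpha>: "\<alpha> \<in> auto G" "\<alpha> ` {x, inv x} = F ` {x, inv x}"
    using CI_hom_subset[OF CI A F(1,2) _ ic] xA subgroup.m_inv_closed[OF A xA] by auto
  moreover have "F (inv x) = inv y"
    using sub_homD(4)[OF A is_group F(1) xA] F(3) by simp
  ultimately show ?thesis
    using that F(3) by auto
qed

section \<open>Subgroups of CI-groups\<close>

lemma inverse_closed_subgroup_iff:
  assumes A: "subgroup A G"
  shows "inverse_closed (G\<lparr>carrier := A\<rparr>) S \<longleftrightarrow> inverse_closed G S \<and> S \<subseteq> A"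
proof -
  have "m_inv (G\<lparr>carrier := A\<rparr>) ` S = m_inv G ` S" if "S \<subseteq> A"
    using m_inv_consistent[OF A] that by (intro image_cong) auto
  then show ?thesis
    using subgroup.subset[OF A] unfolding inverse_closed_def by (cases "S \<subseteq> A") auto
qed

text \<open>An automorphism of \<open>G\<close> that carries \<open>S\<close> to \<open>T\<close> is
  sure to preserve \<open>A\<close> if \<open>S\<close> generates \<open>A\<close>. If
  \<open>S\<close> does not, its complement in \<open>A - {\<one>}\<close> does, and a graph
  isomorphism remains one after complementing both sets.\<close>

lemma CI_subgroup:
  assumes CI: "CI_group G" and A: "subgroup A G"
  shows "CI_group (G\<lparr>carrier := A\<rparr>)"
proof -
  interpret A: subgroup A G by fact
  let ?K = "G\<lparr>carrier := A\<rparr>"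
  interpret K: group ?K
    by (rule A.subgroup_is_group[OF is_group])
  have finA: "finite A"
    using A.subset CI_groupD(2)[OF CI] finite_subset by auto
  have "\<exists>\<beta>\<in>auto ?K. T = \<beta> ` S"
    if S: "inverse_closed ?K S" and T: "inverse_closed ?K T"
      and iso: "graph_iso (cayley_graph ?K S) (cayley_graph ?K T)" for S T
  proof -
    obtain f where f: "bij_betw f A A"
      "\<And>u v. \<lbrakk>u \<in> A; v \<in> A\<rbrakk> \<Longrightarrow> v \<otimes> inv u \<in> S \<longleftrightarrow> f v \<otimes> inv (f u) \<in> T"
    proof -
      obtain f where f: "bij_betw f A A"
        "\<And>u v. \<lbrakk>u \<in> A; v \<in> A\<rbrakk> \<Longrightarrow> v \<otimes> inv\<^bsub>?K\<^esub> u \<in> S \<longleftrightarrow> f v \<otimes> inv\<^bsub>?K\<^esub> (f u) \<in> T"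
        using iso unfolding graph_iso_cayley_iff[OF K.is_group K.is_group S T] by auto
      then show ?thesis
        using that[OF f(1)] m_inv_consistent[OF A] bij_betwE[OF f(1)] by simp
    qed
    have ST: "inverse_closed G S" "S \<subseteq> A" "inverse_closed G T" "T \<subseteq> A"
      using S T inverse_closed_subgroup_iff[OF A] by auto
    have compl: "A - {\<one>} - \<Gamma> \<subseteq> A" "inverse_closed G (A - {\<one>} - \<Gamma>)" if "inverse_closed G \<Gamma>" for \<Gamma>
      using inv_mem_iff[OF that] by (auto intro!: inverse_closedI)
    have quot1: "v \<otimes> inv u = \<one> \<longleftrightarrow> v = u" if "u \<in> A" "v \<in> A" for u v
      using that inv_solve_right'[of \<one> v u] by auto
    have fc: "v \<otimes> inv u \<in> A - {\<one>} - S \<longleftrightarrow> f v \<otimes> inv (f u) \<in> A - {\<one>} - T" if "u \<in> A" "v \<in> A" for u v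
    proof -
      have "f u \<in> A" "f v \<in> A" "f v = f u \<longleftrightarrow> v = u"
        using f(1) that by (auto simp: bij_betw_def inj_on_eq_iff)
      then show ?thesis
        using f(2)[OF that] that quot1 by simp
    qed
    obtain \<alpha> where \<alpha>: "\<alpha> \<in> auto G" "\<alpha> ` A = A" "\<alpha> ` S = T"
    proof -
      have key: "\<exists>\<alpha>\<in>auto G. \<alpha> ` A = A \<and> \<alpha> ` \<Gamma> = Y"
        if \<Gamma>: "\<Gamma> \<subseteq> A" "inverse_closed G \<Gamma>" and Y: "Y \<subseteq> A" "inverse_closed G Y"
          and XY: "\<And>u v. \<lbrakk>u \<in> A; v \<in> A\<rbrakk> \<Longrightarrow> v \<otimes> inv u \<in> \<Gamma> \<longleftrightarrow> f v \<otimes> inv (f u) \<in> Y"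
          and gen: "generate G \<Gamma> = A" for \<Gamma> Y
      proof -
        obtain \<alpha> where \<alpha>: "\<alpha> \<in> auto G" "\<alpha> ` \<Gamma> = Y"
          using CI_coset_auto[OF CI A A f(1) \<Gamma> Y XY] by blast
        interpret \<alpha>: group_hom G G \<alpha>
          using autoD[OF \<alpha>(1)] by (auto simp: group_hom_def group_hom_axioms_def)
        have "\<alpha> ` A = generate G Y"
          using \<alpha>.generate_img[of \<Gamma>] \<Gamma> A.subset gen \<alpha>(2) by auto
        also have "\<dots> \<subseteq> A"
          using generate_subgroup_incl[OF Y(1) A] .
        finally have "\<alpha> ` A = A"
          using card_subset_eq[OF finA] autoD_group(8)[OF \<alpha>(1) A.subset] by blast
        then show ?thesis
          using \<alpha> by blast
      qed
      show ?thesis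
      proof (cases "generate G S = A")
        case True
        then show ?thesis
          using key[OF ST(2,1,4,3) f(2)] that by blast
      next
        case False
        let ?S = "A - {\<one>} - S"
        \<comment> \<open>A group is not the union of two proper subgroups: with a outside the first
          and b outside the second, a b lies in neither.\<close>
        have "generate G ?S = A"
        proof (rule ccontr)
          assume ne: "generate G ?S \<noteq> A"
          have sub: "generate G S \<subseteq> A" "generate G ?S \<subseteq> A"
            by (intro generate_subgroup_incl[OF _ A]; use ST in blast)+
          obtain a b where ab: "a \<in> A" "a \<notin> generate G S" "b \<in> A" "b \<notin> generate G ?S"
            using ne False sub by blast
          have sg: "subgroup (generate G S) G" "subgroup (generate G ?S) G"
            using ST(2) A.subset by (intro generate_is_subgroup; blast)+
          have "A \<subseteq> generate G S \<union> generate G ?S"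
            using generate.incl[of _ S G] generate.incl[of _ ?S G] generate.one[of G S] by blast
          then have ab': "a \<in> generate G ?S" "b \<in> generate G S" "a \<otimes> b \<in> generate G S \<or> a \<otimes> b \<in> generate G ?S"
            using ab A.m_closed[OF ab(1,3)] by auto
          have "a \<otimes> b \<otimes> inv b = a" "inv a \<otimes> (a \<otimes> b) = b"
            using ab by (simp_all add: m_assoc)
          then show False
            using ab' ab subgroup.m_closed subgroup.m_inv_closed sg by metis
        qed
        then obtain \<alpha> where \<alpha>: "\<alpha> \<in> auto G" "\<alpha> ` A = A" "\<alpha> ` ?S = A - {\<one>} - T"
          using key[OF compl[OF ST(1)] compl[OF ST(3)] fc] by blast
        have inj: "inj_on \<alpha> A"
          using autoD_group(6)[OF \<alpha>(1)] A.subset inj_on_subset by blast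
        have "S = A - {\<one>} - ?S" "T = A - {\<one>} - (A - {\<one>} - T)"
          using ST inverse_closedD(2) by blast+
        moreover have "\<alpha> ` (A - {\<one>} - ?S) = \<alpha> ` A - \<alpha> ` {\<one>} - \<alpha> ` ?S"
          using inj by (subst inj_on_image_set_diff[OF inj])
            (auto simp: inj_on_image_set_diff[OF inj])
        ultimately have "\<alpha> ` S = T"
          using \<alpha> autoD_group(2)[OF \<alpha>(1)] by simp
        then show ?thesis
          using \<alpha> that by blast
      qed
    qed
    have "\<alpha> \<in> iso ?K ?K"
      using \<alpha> autoD_group(3,6)[OF \<alpha>(1)] A.subset inj_on_subset
      by (auto simp: iso_def hom_def bij_betw_def)
    then have "restrict \<alpha> A \<in> auto ?K"
      using K.isoD_auto by simp
    moreover have "restrict \<alpha> A ` S = \<alpha> ` S"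
      using ST(2) by (intro image_cong) auto
    then have "T = restrict \<alpha> A ` S"
      using \<alpha>(3) by simp
    ultimately show ?thesis
      by blast
  qed
  then show ?thesis
    using K.is_group finA unfolding CI_group_def CI_set_def by auto
qed

end

section \<open>Counting with the k-if property\<close>

context group
begin

lemma auto_restrict_iso:
  assumes \<alpha>: "\<alpha> \<in> auto G" and A: "subgroup A G" "\<alpha> ` A = A"
  shows "\<alpha> \<in> iso (G\<lparr>carrier := A\<rparr>) (G\<lparr>carrier := A\<rparr>)"
proof -
  have AG: "A \<subseteq> carrier G"
    by (rule subgroup.subset[OF A(1)])
  have "inj_on \<alpha> A"
    using autoD_group(6)[OF \<alpha>] AG by (rule inj_on_subset)
  moreover have "\<alpha> (a \<otimes> b) = \<alpha> a \<otimes> \<alpha> b" if "a \<in> A" "b \<in> A" for a b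
    using autoD_group(3)[OF \<alpha>] that AG by blast
  ultimately show ?thesis
    using A(2) by (auto simp: iso_def hom_def bij_betw_def)
qed

lemma auto_graph_iso:
  assumes S: "inverse_closed G S" and h: "h \<in> iso G G"
  shows "inverse_closed G (h ` S)" "graph_iso (cayley_graph G S) (cayley_graph G (h ` S))"
proof -
  have h': "h \<in> hom G G" "bij_betw h (carrier G) (carrier G)"
    using h by (auto simp: iso_def)
  have hom: "h \<in> hom (G\<lparr>carrier := carrier G\<rparr>) G" "inj_on h (carrier G)"
    using h' by (auto simp: bij_betw_def)
  have S': "S \<subseteq> carrier G"
    by (rule inverse_closedD(1)[OF S])
  show ic: "inverse_closed G (h ` S)"
    by (rule hom_image_inverse_closed[OF subgroup_self hom S' S])
  have "v \<otimes> inv u \<in> S \<longleftrightarrow> h v \<otimes> inv (h u) \<in> h ` S" if "u \<in> carrier G" "v \<in> carrier G" for u v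
    by (rule hom_quot_mem_iff[OF subgroup_self hom S' that])
  then show "graph_iso (cayley_graph G S) (cayley_graph G (h ` S))"
    unfolding graph_iso_cayley_iff[OF is_group is_group S ic] using h'(2) by blast
qed

lemma k_if_autos:
  assumes CI: "CI_group G" and k: "k_if_property k G"
  obtains P S where "partition_on (carrier G - {\<one>}) P" "card P = k" "S \<in> P"
    "\<And>T. T \<in> P \<Longrightarrow> inverse_closed G T" "\<And>T. T \<in> P \<Longrightarrow> \<exists>\<alpha>\<in>auto G. \<alpha> ` S = T"
proof -
  obtain P S where P: "partition_on (carrier G - {\<one>}) P" "card P = k" "S \<in> P"
    and T: "\<And>T. T \<in> P \<Longrightarrow> inverse_closed G T \<and> graph_iso (cayley_graph G T) (cayley_graph G S)"
    using k unfolding k_if_property_def k_if_cayley_graph_def by blast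
  have "\<exists>\<alpha>\<in>auto G. \<alpha> ` S = T" if "T \<in> P" for T
  proof -
    have "CI_set G S"
      using CI T[OF P(3)] unfolding CI_group_def by blast
    then show ?thesis
      using T[OF that] graph_iso_sym unfolding CI_set_def by metis
  qed
  then show ?thesis
    using P T that by blast
qed

text \<open>All parts meet the invariant set \<open>U\<close> in equally many elements. For the
  factor 2, inversion pairs off the elements of \<open>U \<inter> S\<close> without fixed
  points.\<close>

lemma k_if_dvd_card:
  assumes CI: "CI_group G" and k: "k_if_property k G"
    and U: "U \<subseteq> carrier G - {\<one>}" "\<And>\<alpha>. \<alpha> \<in> auto G \<Longrightarrow> \<alpha> ` U = U"
  shows "k dvd card U" "(\<And>x. x \<in> U \<Longrightarrow> inv x \<in> U \<and> inv x \<noteq> x) \<Longrightarrow> 2 * k dvd card U"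
proof -
  obtain P S where P: "partition_on (carrier G - {\<one>}) P" "card P = k" "S \<in> P"
    and ic: "\<And>T. T \<in> P \<Longrightarrow> inverse_closed G T" and T: "\<And>T. T \<in> P \<Longrightarrow> \<exists>\<alpha>\<in>auto G. \<alpha> ` S = T"
    using k_if_autos[OF CI k] by blast
  have fin: "finite (carrier G)"
    using CI by (rule CI_groupD)
  have finX: "finite U"
    using U fin finite_subset by blast
  have finP: "finite P"
    using finite_elements[OF _ P(1)] fin by simp
  have card: "card (U \<inter> T) = card (U \<inter> S)" if TP: "T \<in> P" for T
  proof -
    obtain \<alpha> where \<alpha>: "\<alpha> \<in> auto G" "\<alpha> ` S = T"
      using T[OF TP] by blast
    have "\<alpha> ` (U \<inter> S) = \<alpha> ` U \<inter> \<alpha> ` S"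
      using autoD_group(6)[OF \<alpha>(1)] U(1) inverse_closedD(1)[OF ic[OF P(3)]]
      by (intro inj_on_image_Int) auto
    then have "\<alpha> ` (U \<inter> S) = U \<inter> T"
      using U(2)[OF \<alpha>(1)] \<alpha>(2) by simp
    then show ?thesis
      using autoD_group(8)[OF \<alpha>(1), of "U \<inter> S"] U(1) by auto
  qed
  have "U = (\<Union>T\<in>P. U \<inter> T)"
    using U(1) partition_onD1[OF P(1)] by blast
  moreover have "card (\<Union>T\<in>P. U \<inter> T) = (\<Sum>T\<in>P. card (U \<inter> T))"
    using finP finX partition_onD2[OF P(1)] by (intro card_UN_disjoint) (auto simp: disjoint_def pairwise_def disjnt_def)
  ultimately have sum: "card U = k * card (U \<inter> S)"
    using card P(2) by simp
  then show "k dvd card U"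
    by simp
  assume inv: "\<And>x. x \<in> U \<Longrightarrow> inv x \<in> U \<and> inv x \<noteq> x"
  have "even (card (U \<inter> S))"
  proof (rule even_card_fixpoint_free_involution)
    show "inv x \<in> U \<inter> S" if "x \<in> U \<inter> S" for x
      using that inv inverse_closedD(3)[OF ic[OF P(3)]] by auto
    show "inv (inv x) = x" if "x \<in> U \<inter> S" for x
      using that U(1) by (intro inv_inv) auto
    show "inv x \<noteq> x" if "x \<in> U \<inter> S" for x
      using that inv by auto
  qed (use finX in auto)
  then show "2 * k dvd card U"
    using sum by (simp add: mult.commute mult_dvd_mono)
qed

text \<open>\<open>carrier G - {\<one>}\<close> is itself characteristic, so k divides |G| -
  1.\<close>

lemma k_if_coprime_order:
  assumes CI: "CI_group G" and k: "k_if_property k G"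
  shows "coprime k (order G)"
proof -
  have fin: "finite (carrier G)"
    using CI by (rule CI_groupD)
  have "\<alpha> ` (carrier G - {\<one>}) = carrier G - {\<one>}" if "\<alpha> \<in> auto G" for \<alpha>
    using autoD_group(2,6,7)[OF that] inj_on_image_set_diff[OF autoD_group(6)[OF that], of "carrier G" "{\<one>}"] by simp
  then have "k dvd card (carrier G - {\<one>})"
    using k_if_dvd_card(1)[OF CI k, of "carrier G - {\<one>}"] by blast
  then have k1: "k dvd order G - 1"
    using fin by (simp add: order_def)
  have pos: "order G > 0"
    using fin order_gt_0_iff_finite by blast
  show ?thesis
  proof (rule coprimeI)
    fix c assume c: "c dvd k" "c dvd order G"
    then have "c dvd order G - 1"
      using k1 dvd_trans by blast
    then have "c dvd order G - (order G - 1)"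
      using c(2) by (simp add: dvd_diff_nat)
    then show "is_unit c"
      using pos by simp
  qed
qed

lemma k_if_characteristic_subgroup:
  assumes CI: "CI_group G" and k: "k_if_property k G"
    and A: "subgroup A G" "A \<noteq> {\<one>}" "\<And>\<alpha>. \<alpha> \<in> auto G \<Longrightarrow> \<alpha> ` A = A"
  shows "k_if_property k (G\<lparr>carrier := A\<rparr>)"
proof -
  interpret A: subgroup A G by fact
  let ?K = "G\<lparr>carrier := A\<rparr>"
  interpret K: group ?K
    by (rule A.subgroup_is_group[OF is_group])
  obtain P S where P: "partition_on (carrier G - {\<one>}) P" "card P = k" "S \<in> P"
    and ic: "\<And>T. T \<in> P \<Longrightarrow> inverse_closed G T" and T: "\<And>T. T \<in> P \<Longrightarrow> \<exists>\<alpha>\<in>auto G. \<alpha> ` S = T"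
    using k_if_autos[OF CI k] by blast
  have icA: "inverse_closed ?K (A \<inter> T)" if "T \<in> P" for T
    unfolding inverse_closed_subgroup_iff[OF A(1)]
    using inverse_closedD[OF ic[OF that]] by (intro conjI inverse_closedI) auto
  have isoA: "\<exists>h\<in>iso ?K ?K. h ` (A \<inter> S) = A \<inter> T" if TP: "T \<in> P" for T
  proof -
    obtain \<alpha> where \<alpha>: "\<alpha> \<in> auto G" "\<alpha> ` S = T"
      using T[OF TP] by blast
    have "\<alpha> ` (A \<inter> S) = \<alpha> ` A \<inter> \<alpha> ` S"
      using autoD_group(6)[OF \<alpha>(1)] A.subset inverse_closedD(1)[OF ic[OF P(3)]]
      by (intro inj_on_image_Int) auto
    then have "\<alpha> ` (A \<inter> S) = A \<inter> T"
      using A(3)[OF \<alpha>(1)] \<alpha>(2) by simp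
    then show ?thesis
      using auto_restrict_iso[OF \<alpha>(1) A(1) A(3)[OF \<alpha>(1)]] by (intro bexI[of _ \<alpha>])
  qed
  \<comment> \<open>The parts are automorphic images of one another, so as soon as one meets
    \<open>A\<close>, all do. This keeps the number of parts equal to k after intersecting with
    \<open>A\<close>.\<close>
  have ne: "A \<inter> T \<noteq> {}" if TP: "T \<in> P" for T
  proof -
    obtain a where "a \<in> A" "a \<noteq> \<one>"
      using A(2) A.one_closed by blast
    then obtain U where U: "U \<in> P" "a \<in> A \<inter> U"
      using partition_onD1[OF P(1)] A.subset by blast
    obtain h where "h ` (A \<inter> S) = A \<inter> U"
      using isoA[OF U(1)] by auto
    then have "A \<inter> S \<noteq> {}"
      using U(2) by auto
    moreover obtain h where "h ` (A \<inter> S) = A \<inter> T"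
      using isoA[OF TP] by auto
    ultimately show ?thesis
      by auto
  qed
  define Q where "Q = (\<inter>) A ` P"
  have "{} \<notin> Q"
    using ne unfolding Q_def by blast
  then have "partition_on (A \<inter> (carrier G - {\<one>})) Q"
    using partition_on_restrict[OF P(1), of A] unfolding Q_def by simp
  moreover have "A \<inter> (carrier G - {\<one>}) = A - {\<one>}"
    using A.subset by blast
  ultimately have Q: "partition_on (A - {\<one>}) Q"
    by simp
  have "inj_on ((\<inter>) A) P"
  proof (rule inj_onI)
    fix T U assume TU: "T \<in> P" "U \<in> P" "A \<inter> T = A \<inter> U"
    then have "T \<inter> U \<noteq> {}"
      using ne[OF TU(1)] by blast
    then show "T = U"
      using TU partition_onD2[OF P(1)] by (auto simp: disjoint_def)
  qed
  then have cQ: "card Q = k"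
    unfolding Q_def using P(2) by (simp add: card_image)
  have "inverse_closed ?K T \<and> graph_iso (cayley_graph ?K T) (cayley_graph ?K (A \<inter> S))" if "T \<in> Q" for T
  proof -
    obtain U where U: "U \<in> P" "T = A \<inter> U"
      using \<open>T \<in> Q\<close> unfolding Q_def by blast
    obtain h where h: "h \<in> iso ?K ?K" "h ` (A \<inter> S) = T"
      using isoA[OF U(1)] U(2) by auto
    have "graph_iso (cayley_graph ?K (A \<inter> S)) (cayley_graph ?K T)"
      using K.auto_graph_iso(2)[OF icA[OF P(3)] h(1)] h(2) by simp
    then show ?thesis
      using graph_iso_sym icA[OF U(1)] U(2) by simp
  qed
  then show ?thesis
    unfolding k_if_property_def k_if_cayley_graph_def
    using Q cQ P(3) icA[OF P(3)] by (intro exI[of _ "A \<inter> S"] conjI exI[of _ Q]) (simp_all add: Q_def)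
qed

end

section \<open>Semidirect products that are CI-groups\<close>

lemma (in group) adjoin_one_eq: "x \<in> carrier G \<Longrightarrow> adjoin {\<one>} x = range (\<lambda>i::nat. x [^] i)"
  by (auto simp: adjoin_def)

text \<open>Both x, u and x, w are linearly independent pairs in a vector space over the field with
  q elements: fix x, send u to w, and complete to an automorphism.\<close>

lemma elementary_pair_transitive:
  assumes K: "comm_group K" "finite (carrier K)" and q: "Factorial_Ring.prime (q::nat)"
    and Kq: "\<And>a. a \<in> carrier K \<Longrightarrow> a [^]\<^bsub>K\<^esub> q = \<one>\<^bsub>K\<^esub>"
    and x: "x \<in> carrier K" "x \<noteq> \<one>\<^bsub>K\<^esub>"
    and u: "u \<in> carrier K" "u \<notin> range (\<lambda>i::nat. x [^]\<^bsub>K\<^esub> i)"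
    and w: "w \<in> carrier K" "w \<notin> range (\<lambda>i::nat. x [^]\<^bsub>K\<^esub> i)"
  obtains F where "F \<in> iso K K" "F x = x" "F u = w"
proof -
  interpret K: comm_group K by fact
  let ?A = "K.adjoin {\<one>\<^bsub>K\<^esub>} x"
  have A: "subgroup ?A K"
    by (rule K.cyclic_prime_subgroup[OF q x(1) Kq[OF x(1)] x(2)])
  interpret A: subgroup ?A K by fact
  have xA: "x \<in> ?A"
    by (rule K.mem_adjoin[OF K.triv_subgroup x(1)])
  have A_eq: "?A = range (\<lambda>i::nat. x [^]\<^bsub>K\<^esub> i)"
    by (rule K.adjoin_one_eq[OF x(1)])
  have id: "id \<in> hom (K\<lparr>carrier := ?A\<rparr>) K" "inj_on id ?A"
    using A.subset by (auto simp: hom_def)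
  have cu: "a \<otimes>\<^bsub>K\<^esub> u = u \<otimes>\<^bsub>K\<^esub> a" if "a \<in> ?A" for a
    using K.m_comm[OF A.mem_carrier[OF that] u(1)] .
  have cw: "id a \<otimes>\<^bsub>K\<^esub> w = w \<otimes>\<^bsub>K\<^esub> id a" if "a \<in> ?A" for a
    using K.m_comm[OF A.mem_carrier[OF that] w(1)] by simp
  have uA: "u \<notin> ?A" and wA: "w \<notin> id ` ?A"
    using u(2) w(2) A_eq by auto
  obtain f where f: "f \<in> hom (K\<lparr>carrier := K.adjoin ?A u\<rparr>) K" "inj_on f (K.adjoin ?A u)"
    "\<And>a. a \<in> ?A \<Longrightarrow> f a = id a" "f u = w"
    using ext_hom_adjoin[OF K.is_group K.is_group A q id u(1) Kq[OF u(1)] uA cu w(1) Kq[OF w(1)] wA cw]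
    by blast
  have sg: "subgroup (K.adjoin ?A u) K"
  proof (rule K.adjoin_subgroup[OF A u(1) Kq[OF u(1)]])
    show "q > 0" using q by (simp add: prime_gt_0_nat)
    show "u \<otimes>\<^bsub>K\<^esub> a \<otimes>\<^bsub>K\<^esub> inv\<^bsub>K\<^esub> u \<in> ?A" if "a \<in> ?A" for a
      using that u(1) cu[OF that, symmetric] A.mem_carrier[OF that] by (simp add: K.m_assoc)
  qed
  have "\<exists>F\<in>iso K K. \<forall>a\<in>K.adjoin ?A u. F a = f a"
    by (rule ext_iso_elementary[OF K(1) K(1) q Kq Kq K(2) K(2) refl sg f(1,2)])
  then obtain F where F: "F \<in> iso K K" "\<forall>a\<in>K.adjoin ?A u. F a = f a"
    by (elim bexE)
  have "x \<in> K.adjoin ?A u" "u \<in> K.adjoin ?A u"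
    using K.subset_adjoin[OF A.subset, of u] xA K.mem_adjoin[OF A u(1)] by auto
  then have "F x = x" "F u = w"
    using F(2) f(3)[OF xA] f(4) by simp_all
  then show ?thesis
    using F(1) that by blast
qed

context group
begin

text \<open>Adding the cosets \<open>Q y\<close> and \<open>Q y\<^sup>-\<^sup>1\<close> to a connection set inside \<open>Q\<close> forces the automorphism
  provided by the CI property to fix \<open>y\<close> up to inversion modulo \<open>Q\<close>.\<close>

lemma CI_characteristic_coset:
  assumes CI: "CI_group G" and Q: "subgroup Q G" "\<And>\<alpha>. \<alpha> \<in> auto G \<Longrightarrow> \<alpha> ` Q = Q"
    and y: "y \<in> carrier G" "y \<notin> Q"
      "\<And>a. a \<in> Q \<Longrightarrow> y \<otimes> a \<otimes> inv y \<in> Q" "\<And>a. a \<in> Q \<Longrightarrow> inv y \<otimes> a \<otimes> y \<in> Q"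
    and f: "f \<in> hom (G\<lparr>carrier := Q\<rparr>) G" "inj_on f Q" "f ` Q = Q"
    and S: "S \<subseteq> Q" "inverse_closed G S"
  obtains \<alpha> c where "\<alpha> \<in> auto G" "\<alpha> ` S = f ` S" "c \<in> Q" "\<alpha> y = c \<otimes> y \<or> \<alpha> y = c \<otimes> inv y"
proof -
  interpret Q: subgroup Q G by fact
  define R where "R = (\<lambda>a. a \<otimes> y) ` Q \<union> (\<lambda>a. a \<otimes> inv y) ` Q"
  have RQ: "r \<notin> Q" if rR: "r \<in> R" for r
  proof
    assume r: "r \<in> Q"
    obtain a where a: "a \<in> Q" "r = a \<otimes> y \<or> r = a \<otimes> inv y"
      using rR unfolding R_def by blast
    have ac: "a \<in> carrier G"
      using a(1) by simp
    have "inv a \<otimes> r \<in> Q"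
      by (rule Q.m_closed[OF Q.m_inv_closed[OF a(1)] r])
    moreover have "inv a \<otimes> (a \<otimes> y) = y" "inv a \<otimes> (a \<otimes> inv y) = inv y"
      using ac y(1) by simp_all
    ultimately have "y \<in> Q \<or> inv y \<in> Q"
      using a(2) by metis
    then show False
      using y(1,2) Q.m_inv_closed[of "inv y"] by (metis inv_inv)
  qed
  have Rc: "R \<subseteq> carrier G"
    using y(1) unfolding R_def by auto
  have Rinv: "inv r \<in> R" if rR: "r \<in> R" for r
  proof -
    obtain a where a: "a \<in> Q" "r = a \<otimes> y \<or> r = a \<otimes> inv y"
      using rR unfolding R_def by blast
    have "inv (a \<otimes> y) = (inv y \<otimes> inv a \<otimes> y) \<otimes> inv y" "inv (a \<otimes> inv y) = (y \<otimes> inv a \<otimes> inv y) \<otimes> y"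
      using a(1) y(1) by (simp_all add: inv_mult_group m_assoc)
    moreover have "inv y \<otimes> inv a \<otimes> y \<in> Q" "y \<otimes> inv a \<otimes> inv y \<in> Q"
      using y(3,4) a(1) by simp_all
    ultimately show ?thesis
      using a(2) unfolding R_def by blast
  qed
  have R1: "\<one> \<notin> R"
    using RQ Q.one_closed by blast
  have R2: "a \<otimes> r \<otimes> b \<in> R" if "a \<in> Q" "b \<in> Q" "r \<in> R" for a b r
  proof -
    obtain c where c: "c \<in> Q" "r = c \<otimes> y \<or> r = c \<otimes> inv y"
      using \<open>r \<in> R\<close> unfolding R_def by blast
    have "a \<otimes> (c \<otimes> y) \<otimes> b = (a \<otimes> c \<otimes> (y \<otimes> b \<otimes> inv y)) \<otimes> y"
      "a \<otimes> (c \<otimes> inv y) \<otimes> b = (a \<otimes> c \<otimes> (inv y \<otimes> b \<otimes> y)) \<otimes> inv y"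
      using c(1) y(1) that(1,2) by (simp_all add: m_assoc)
    moreover have "a \<otimes> c \<otimes> (y \<otimes> b \<otimes> inv y) \<in> Q" "a \<otimes> c \<otimes> (inv y \<otimes> b \<otimes> y) \<in> Q"
      using y(3,4) that(1,2) c(1) by simp_all
    ultimately show ?thesis
      using c(2) unfolding R_def by blast
  qed
  obtain \<alpha> where \<alpha>: "\<alpha> \<in> auto G" "\<alpha> ` (R \<union> S) = R \<union> f ` S"
  proof (rule CI_coset_hom_subset[OF CI Q(1) f S])
    show "R \<inter> Q = {}"
      using RQ by blast
    show "inverse_closed G R"
      by (rule inverse_closedI[OF Rc R1 Rinv])
  qed (use R2 in auto)
  \<comment> \<open>\<open>Q\<close> is characteristic and contains \<open>S\<close> and its image,
    while \<open>R\<close> avoids \<open>Q\<close>; so \<alpha> cannot mix the two kinds of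
    elements.\<close>
  have \<alpha>Q: "\<alpha> g \<in> Q \<longleftrightarrow> g \<in> Q" if "g \<in> carrier G" for g
    using inj_on_image_mem_iff[OF autoD_group(6)[OF \<alpha>(1)] that Q.subset] Q(2)[OF \<alpha>(1)] by simp
  have "\<one> \<otimes> y \<in> R"
    unfolding R_def using Q.one_closed by blast
  then have "y \<in> R"
    using y(1) by simp
  then have "\<alpha> y \<in> R \<union> f ` S"
    using \<alpha>(2) by blast
  moreover have "\<alpha> y \<notin> f ` S"
    using \<alpha>Q[OF y(1)] y(2) S(1) f(3) by blast
  ultimately have "\<alpha> y \<in> R"
    by blast
  then obtain c where c: "c \<in> Q" "\<alpha> y = c \<otimes> y \<or> \<alpha> y = c \<otimes> inv y"
    unfolding R_def by blast
  have "\<alpha> ` S = f ` S"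
  proof
    show "\<alpha> ` S \<subseteq> f ` S"
    proof (rule image_subsetI)
      fix s assume s: "s \<in> S"
      then have "\<alpha> s \<in> Q" "\<alpha> s \<in> R \<union> f ` S"
        using \<alpha>Q S(1) Q.subset \<alpha>(2) by blast+
      then show "\<alpha> s \<in> f ` S"
        using RQ by blast
    qed
    show "f ` S \<subseteq> \<alpha> ` S"
    proof
      fix t assume t: "t \<in> f ` S"
      then obtain s where s: "s \<in> R \<union> S" "t = \<alpha> s"
        using \<alpha>(2) by blast
      have "t \<in> Q"
        using t S(1) f(3) by blast
      then have "s \<in> Q"
        using \<alpha>Q s Rc S(1) Q.subset by blast
      then show "t \<in> \<alpha> ` S"
        using s RQ by blast
    qed
  qed
  then show ?thesis
    using \<alpha>(1) c that by blast
qed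

text \<open>Let z = c^p. An automorphism that sends c to c or c^-1 modulo the subgroup
  \<open>Q\<close> of order p sends z to z or z^-1, since p-th powers kill \<open>Q\<close>. If it
  also carries {z, z^-1} to {z^2, z^-2}, then 2 = 1 or 2 = -1 modulo p.\<close>

lemma CI_cyclic_prime_square_le:
  assumes CI: "CI_group G" and p: "Factorial_Ring.prime (p::nat)"
    and c: "c \<in> carrier G" "ord c = p ^ 2" and G: "carrier G = range (\<lambda>i::nat. c [^] i)"
  shows "p \<le> 3"
proof (rule ccontr)
  assume "\<not> p \<le> 3"
  then have p4: "p > 3" by simp
  have comm: "a \<otimes> b = b \<otimes> a" if "a \<in> carrier G" "b \<in> carrier G" for a b
    using that c(1) by (auto simp: G nat_pow_mult add.commute)
  interpret comm_group G
    by (rule group_comm_groupI) (rule comm)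
  define z where "z = c [^] p"
  have z: "z \<in> carrier G" "ord z = p"
    using c prime_gt_0_nat[OF p] by (simp_all add: z_def ord_pow power2_eq_square)
  have z1: "z [^] p = \<one>" "z \<noteq> \<one>"
    using z pow_ord_eq_1[OF z(1)] ord_eq_1[OF z(1)] prime_gt_1_nat[OF p] by auto
  define Q where "Q = adjoin {\<one>} z"
  have Q: "subgroup Q G" "card Q = p"
    unfolding Q_def by (rule cyclic_prime_subgroup[OF p z(1) z1])+
  interpret Q: subgroup Q G by (rule Q)
  have Q_eq: "Q = {g \<in> carrier G. g [^] p = \<one>}"
  proof (intro equalityI subsetI)
    fix g assume "g \<in> Q"
    then obtain i where i: "g = z [^] (i::nat)"
      unfolding Q_def adjoin_one_eq[OF z(1)] by blast
    have "g [^] p = (z [^] p) [^] i"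
      unfolding i using z(1) by (simp add: nat_pow_pow mult.commute)
    then show "g \<in> {g \<in> carrier G. g [^] p = \<one>}"
      using i z(1) z1 by simp
  next
    fix g assume g: "g \<in> {g \<in> carrier G. g [^] p = \<one>}"
    then obtain i where i: "g = c [^] (i::nat)"
      unfolding G by blast
    have "c [^] (i * p) = \<one>"
      using g c(1) unfolding i by (simp add: nat_pow_pow)
    then have "p ^ 2 dvd i * p"
      using pow_eq_id[OF c(1)] c(2) by metis
    then have "p dvd i"
      using prime_gt_0_nat[OF p] by (simp add: power2_eq_square)
    then obtain j where "i = p * j" by blast
    then have "g = z [^] j"
      unfolding i z_def using c(1) by (simp add: nat_pow_pow)
    then show "g \<in> Q"
      unfolding Q_def adjoin_one_eq[OF z(1)] by blast
  qed
  have Qchar: "\<alpha> ` Q = Q" if \<alpha>: "\<alpha> \<in> auto G" for \<alpha>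
  proof (rule card_subset_eq)
    show "finite Q"
      using CI_groupD(2)[OF CI] Q.subset finite_subset by blast
    show "\<alpha> ` Q \<subseteq> Q"
    proof (rule image_subsetI)
      fix g assume "g \<in> Q"
      then have g: "g \<in> carrier G" "g [^] p = \<one>"
        using Q_eq by blast+
      then have "\<alpha> g [^] p = \<one>"
        using autoD_group(5)[OF \<alpha> g(1), of p] autoD_group(2)[OF \<alpha>] by simp
      then show "\<alpha> g \<in> Q"
        using Q_eq autoD_group(1)[OF \<alpha> g(1)] by blast
    qed
    show "card (\<alpha> ` Q) = card Q"
      by (rule autoD_group(8)[OF \<alpha> Q.subset])
  qed
  have cQ: "c \<notin> Q"
  proof
    assume "c \<in> Q"
    then have "z = \<one>"
      using Q_eq unfolding z_def by blast
    then show False using z1 by blast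
  qed
  have conj: "c \<otimes> a \<otimes> inv c = a" "inv c \<otimes> a \<otimes> c = a" if "a \<in> Q" for a
  proof -
    have e: "c \<otimes> a = a \<otimes> c"
      using c(1) that by (intro m_comm) auto
    show "c \<otimes> a \<otimes> inv c = a"
      unfolding e using c(1) that by (simp add: m_assoc)
    show "inv c \<otimes> a \<otimes> c = a"
      using c(1) that by (simp add: m_assoc flip: e)
  qed
  have zQ: "z \<in> Q"
    using Q_eq z(1) z1 by blast
  have z2: "z [^] (2::nat) \<in> carrier G" "(z [^] (2::nat)) [^] p = \<one>" "z [^] (2::nat) \<noteq> \<one>"
  proof -
    show "z [^] (2::nat) \<in> carrier G" using z(1) by simp
    show "(z [^] (2::nat)) [^] p = \<one>"
      using z(1) z1(1) by (metis nat_pow_one nat_pow_pow mult.commute)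
    show "z [^] (2::nat) \<noteq> \<one>"
      using pow_eq_id[OF z(1), of 2] z(2) p4 by (auto dest: dvd_imp_le)
  qed
  obtain F where F: "F \<in> hom (G\<lparr>carrier := Q\<rparr>) G" "inj_on F Q" "F z = z [^] (2::nat)"
    using hom_adjoin_prime[OF is_group p z(1) z1 z2] unfolding Q_def by blast
  have FQ: "F ` Q = Q"
  proof (rule card_subset_eq)
    show "finite Q"
      using CI_groupD(2)[OF CI] Q.subset finite_subset by blast
    show "F ` Q \<subseteq> Q"
    proof (rule image_subsetI)
      fix g assume g: "g \<in> Q"
      interpret F: group_hom "G\<lparr>carrier := Q\<rparr>" G F
        using F(1) Q.subgroup_is_group[OF is_group] by (auto simp: group_hom_def group_hom_axioms_def)
      have "F (g [^] p) = F g [^] p"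
        using F.hom_nat_pow[of g p] g by (simp flip: nat_pow_consistent)
      moreover have "g [^] p = \<one>"
        using g Q_eq by blast
      moreover have "F \<one> = \<one>" "F g \<in> carrier G"
        using F.hom_one F.hom_closed[of g] g by simp_all
      ultimately have "F g [^] p = \<one>"
        by simp
      then show "F g \<in> Q"
        unfolding Q_eq using \<open>F g \<in> carrier G\<close> by blast
    qed
    show "card (F ` Q) = card Q"
      using F(2) by (rule card_image)
  qed
  have S: "{z, inv z} \<subseteq> Q" "inverse_closed G {z, inv z}"
    using zQ inverse_closed_pair[OF z(1) z1(2)] by auto
  obtain \<alpha> b where \<alpha>: "\<alpha> \<in> auto G" "\<alpha> ` {z, inv z} = F ` {z, inv z}" "b \<in> Q"
    "\<alpha> c = b \<otimes> c \<or> \<alpha> c = b \<otimes> inv c"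
    using CI_characteristic_coset[OF CI Q(1) Qchar c(1) cQ _ _ F(1,2) FQ S] conj by metis
  have bp: "b [^] p = \<one>" "b \<in> carrier G"
    using \<alpha>(3) Q_eq by blast+
  have "\<alpha> z = \<alpha> c [^] p"
    unfolding z_def by (rule autoD_group(5)[OF \<alpha>(1) c(1)])
  moreover have "(b \<otimes> c) [^] p = z" "(b \<otimes> inv c) [^] p = inv z"
    using bp c(1) by (simp_all add: nat_pow_distrib z_def nat_pow_inv)
  ultimately have az: "\<alpha> z = z \<or> \<alpha> z = inv z"
    using \<alpha>(4) by auto
  have "F (inv z) = inv (z [^] (2::nat))"
    using sub_homD(4)[OF Q(1) is_group F(1) zQ] F(3) by simp
  then have "\<alpha> z = z [^] (2::nat) \<or> \<alpha> z = inv (z [^] (2::nat))"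
    using \<alpha>(2) F(3) by auto
  \<comment> \<open>The four cases compare 2 or -2 with 1 or -1; up to sign the differences are 1
    and 3.\<close>
  then have "z [^] (2::int) = z [^] (1::int) \<or> z [^] (2::int) = z [^] (-1::int) \<or>
    z [^] (-2::int) = z [^] (1::int) \<or> z [^] (-2::int) = z [^] (-1::int)"
    using az z(1) int_pow_int[of G z 2] int_pow_neg[OF z(1), of 1] int_pow_neg[OF z(1), of 2] by auto
  then have "int p dvd 1 \<or> int p dvd 3"
    unfolding int_pow_eq[OF z(1)] z(2) by auto
  then show False
    using p4 zdvd_imp_le[of "int p" 1] zdvd_imp_le[of "int p" 3] by auto
qed

text \<open>Passage to the cyclic subgroup generated by c, which is CI as well. The primes 2 and 3
  are left to the counting with the k-if property.\<close>

lemma CI_no_prime_square: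
  assumes CI: "CI_group G" and p: "Factorial_Ring.prime (p::nat)"
    and c: "c \<in> carrier G" "ord c = p ^ 2"
  shows "p \<le> 3"
proof -
  let ?C = "generate G {c}"
  let ?K = "G\<lparr>carrier := ?C\<rparr>"
  have C: "subgroup ?C G"
    using c(1) by (intro generate_is_subgroup) auto
  have C_eq: "?C = range (\<lambda>i::nat. c [^] i)"
    using generate_pow_on_finite_carrier[OF CI_groupD(2)[OF CI] c(1)] by auto
  have pw: "c [^]\<^bsub>?K\<^esub> (n::nat) = c [^] n" for n
    by (rule nat_pow_consistent[symmetric])
  have CK: "CI_group ?K"
    by (rule CI_subgroup[OF CI C])
  interpret K: group ?K
    by (rule CI_groupD[OF CK])
  have cK: "c \<in> carrier ?K"
    using generate.incl[of c "{c}" G] by simp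
  have "K.ord c = p ^ 2"
    using K.ord_unique[OF cK, of "p ^ 2"] pw pow_eq_id[OF c(1)] c(2) by simp
  then show ?thesis
    using K.CI_cyclic_prime_square_le[OF CK p cK] C_eq pw by simp
qed

end

section \<open>Coprime action of an element of prime order\<close>

lemma (in group) centralizer_subgroup:
  assumes "v \<in> carrier G"
  shows "subgroup {g \<in> carrier G. g \<otimes> v = v \<otimes> g} G"
proof (rule subgroupI)
  fix a assume "a \<in> {g \<in> carrier G. g \<otimes> v = v \<otimes> g}"
  then have a: "a \<in> carrier G" "a \<otimes> v = v \<otimes> a" by auto
  have "inv a \<otimes> v = inv a \<otimes> (v \<otimes> a) \<otimes> inv a"
    using a(1) assms by (simp add: m_assoc)
  also have "\<dots> = v \<otimes> inv a"
    unfolding a(2)[symmetric] using a(1) assms by (simp add: m_assoc)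
  finally show "inv a \<in> {g \<in> carrier G. g \<otimes> v = v \<otimes> g}"
    using a by simp
next
  fix a b assume "a \<in> {g \<in> carrier G. g \<otimes> v = v \<otimes> g}" "b \<in> {g \<in> carrier G. g \<otimes> v = v \<otimes> g}"
  then have a: "a \<in> carrier G" "a \<otimes> v = v \<otimes> a" and b: "b \<in> carrier G" "b \<otimes> v = v \<otimes> b" by auto
  have "a \<otimes> b \<otimes> v = a \<otimes> (b \<otimes> v)"
    using a(1) b(1) assms by (simp add: m_assoc)
  also have "\<dots> = a \<otimes> v \<otimes> b"
    unfolding b(2) using a(1) b(1) assms by (simp add: m_assoc)
  also have "\<dots> = v \<otimes> (a \<otimes> b)"
    unfolding a(2) using a(1) b(1) assms by (simp add: m_assoc)
  finally show "a \<otimes> b \<in> {g \<in> carrier G. g \<otimes> v = v \<otimes> g}"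
    using a b by simp
qed (use assms in auto)

lemma (in group) conj_eq_iff_commute:
  assumes "y \<in> carrier G" "a \<in> carrier G" "b \<in> carrier G"
  shows "y \<otimes> a \<otimes> inv y = b \<longleftrightarrow> y \<otimes> a = b \<otimes> y"
  using assms inv_solve_right'[of b "y \<otimes> a" y] by auto

text \<open>\<open>Q\<close> is a vector space over the field with q elements, and conjugation by y
  is a linear map of order 1 or p. \<open>G\<close> may be larger than Q<y>.\<close>

locale prime_action = group G for G (structure) +
  fixes Q :: "'a set" and y :: 'a and p q :: nat
  assumes Q: "subgroup Q G"
    and p: "Factorial_Ring.prime p" and q: "Factorial_Ring.prime q" and pq: "p \<noteq> q"
    and Q_comm: "\<And>a b. \<lbrakk>a \<in> Q; b \<in> Q\<rbrakk> \<Longrightarrow> a \<otimes> b = b \<otimes> a"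
    and Q_exp: "\<And>a. a \<in> Q \<Longrightarrow> a [^] q = \<one>"
    and y: "y \<in> carrier G" "y [^] p = \<one>" "y \<noteq> \<one>"
    and normalizes: "\<And>a. a \<in> Q \<Longrightarrow> y \<otimes> a \<otimes> inv y \<in> Q"
begin

sublocale Q: subgroup Q G by (rule Q)

lemma y_notin: "y \<notin> Q"
proof
  assume "y \<in> Q"
  then have "ord y dvd q" "ord y dvd p"
    using Q_exp y pow_eq_id by auto
  then have "ord y dvd 1"
    using primes_coprime[OF p q pq] by (metis coprime_common_divisor_nat coprime_def)
  then show False
    using y ord_eq_1 by simp
qed

lemma normalizes_inv: "a \<in> Q \<Longrightarrow> inv y \<otimes> a \<otimes> y \<in> Q"
proof -
  assume a: "a \<in> Q"
  have "y [^] (p - 1) \<otimes> y = \<one>"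
    using y(2) prime_gt_0_nat[OF p] nat_pow_Suc[of y "p - 1"] by simp
  then have "inv y = y [^] (p - 1)"
    using y(1) by (intro inv_equality) auto
  then have "inv (y [^] (p - 1)) = y"
    using y(1) by (metis inv_inv)
  then show "inv y \<otimes> a \<otimes> y \<in> Q"
    using conj_pow_mem[OF Q.subset y(1) normalizes a, of "p - 1"] \<open>inv y = y [^] (p - 1)\<close> by simp
qed

lemma conj_hom:
  "\<lbrakk>a \<in> carrier G; b \<in> carrier G\<rbrakk> \<Longrightarrow> y \<otimes> (a \<otimes> b) \<otimes> inv y = (y \<otimes> a \<otimes> inv y) \<otimes> (y \<otimes> b \<otimes> inv y)"
  "a \<in> carrier G \<Longrightarrow> y \<otimes> inv a \<otimes> inv y = inv (y \<otimes> a \<otimes> inv y)"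
  "a \<in> carrier G \<Longrightarrow> inv y \<otimes> inv a \<otimes> y = inv (inv y \<otimes> a \<otimes> y)"
  using y(1) by (simp_all add: m_assoc inv_mult_group)

text \<open>The factor b lies in the abelian group \<open>Q\<close> and acts trivially on it, so
  \<alpha> y acts on \<open>Q\<close> like y or y^-1.\<close>

lemma auto_conj:
  assumes \<alpha>: "\<alpha> \<in> auto G" and b: "b \<in> Q" and u: "u \<in> carrier G" "\<alpha> u \<in> Q"
  shows "\<alpha> y = b \<otimes> y \<Longrightarrow> \<alpha> (y \<otimes> u \<otimes> inv y) = y \<otimes> \<alpha> u \<otimes> inv y"
    "\<alpha> y = b \<otimes> inv y \<Longrightarrow> \<alpha> (y \<otimes> u \<otimes> inv y) = inv y \<otimes> \<alpha> u \<otimes> y"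
proof -
  have e: "\<alpha> (y \<otimes> u \<otimes> inv y) = \<alpha> y \<otimes> \<alpha> u \<otimes> inv (\<alpha> y)"
    using autoD_group[OF \<alpha>] y(1) u(1) by simp
  have *: "b \<otimes> w \<otimes> inv b = w" if "w \<in> Q" for w
    using Q_comm[OF b that] b that by (simp add: m_assoc)
  have "\<alpha> y \<otimes> \<alpha> u \<otimes> inv (\<alpha> y) = b \<otimes> (y \<otimes> \<alpha> u \<otimes> inv y) \<otimes> inv b" if "\<alpha> y = b \<otimes> y"
    unfolding that using y(1) b u(2) by (simp add: m_assoc inv_mult_group)
  then show "\<alpha> y = b \<otimes> y \<Longrightarrow> \<alpha> (y \<otimes> u \<otimes> inv y) = y \<otimes> \<alpha> u \<otimes> inv y"
    using e *[OF normalizes[OF u(2)]] by simp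
  have "\<alpha> y \<otimes> \<alpha> u \<otimes> inv (\<alpha> y) = b \<otimes> (inv y \<otimes> \<alpha> u \<otimes> y) \<otimes> inv b" if "\<alpha> y = b \<otimes> inv y"
    unfolding that using y(1) b u(2) by (simp add: m_assoc inv_mult_group)
  then show "\<alpha> y = b \<otimes> inv y \<Longrightarrow> \<alpha> (y \<otimes> u \<otimes> inv y) = inv y \<otimes> \<alpha> u \<otimes> y"
    using e *[OF normalizes_inv[OF u(2)]] by simp
qed

text \<open>\<open>Q\<close> is recognized by its exponent: if (b y^i)^q = 1, then p divides q i,
  hence i, and y^i = 1.\<close>

lemma characteristic:
  assumes G: "carrier G = adjoin Q y" and fin: "finite (carrier G)" and \<alpha>: "\<alpha> \<in> auto G"
  shows "\<alpha> ` Q = Q"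
proof (rule card_subset_eq)
  show "finite Q"
    using fin Q.subset finite_subset by blast
  show "card (\<alpha> ` Q) = card Q"
    by (rule autoD_group(8)[OF \<alpha> Q.subset])
  show "\<alpha> ` Q \<subseteq> Q"
  proof (rule image_subsetI)
    fix a assume a: "a \<in> Q"
    have "\<alpha> a [^] q = \<alpha> (a [^] q)"
      using autoD_group(5)[OF \<alpha>, of a q] a by simp
    then have e: "\<alpha> a [^] q = \<one>"
      using Q_exp[OF a] autoD_group(2)[OF \<alpha>] by simp
    have "\<alpha> a \<in> adjoin Q y"
      using autoD_group(1)[OF \<alpha> Q.mem_carrier[OF a]] unfolding G .
    then obtain b i where b: "b \<in> Q" "\<alpha> a = b \<otimes> y [^] (i::nat)"
      by (rule adjoinE)
    have "\<exists>d\<in>Q. \<alpha> a [^] n = d \<otimes> y [^] (n * i)" for n :: nat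
    proof (induction n)
      case 0
      then show ?case by auto
    next
      case (Suc n)
      then obtain d where d: "d \<in> Q" "\<alpha> a [^] n = d \<otimes> y [^] (n * i)"
        by blast
      have "\<alpha> a [^] Suc n = d \<otimes> (y [^] (n * i) \<otimes> b \<otimes> inv (y [^] (n * i))) \<otimes> y [^] (n * i + i)"
        unfolding nat_pow_Suc d(2) unfolding b(2) by (rule adjoin_mult[OF Q y(1) d(1) b(1)])
      moreover have "d \<otimes> (y [^] (n * i) \<otimes> b \<otimes> inv (y [^] (n * i))) \<in> Q"
        using d(1) conj_pow_mem[OF Q.subset y(1) normalizes b(1)] by simp
      ultimately show ?case
        by (auto simp: add.commute)
    qed
    then obtain d where d: "d \<in> Q" "\<alpha> a [^] q = d \<otimes> y [^] (q * i)"
      by blast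
    then have "d \<otimes> y [^] (q * i) = \<one>"
      using e by metis
    then have "\<one> \<otimes> y [^] (0::nat) = d \<otimes> y [^] (q * i)"
      by simp
    then have "int p dvd int (q * i) - int 0"
      by (rule adjoin_unique(2)[OF Q y(1,2) y_notin p Q.one_closed d(1)])
    then have "p dvd q * i"
      by (metis int_dvd_int_iff of_nat_0 diff_zero)
    then have "p dvd i"
      using p q pq by (metis prime_dvd_mult_iff primes_dvd_imp_eq)
    then have "y [^] i = \<one>"
      using y(1,2) by (metis dvdE nat_pow_one nat_pow_pow)
    then show "\<alpha> a \<in> Q"
      using b by simp
  qed
qed

text \<open>The vectors x and u = y x y^-1 are independent. If w is any vector outside <x>, some
  linear map fixes x and sends u to w, and the CI property forces w to be u or v = y^-1 x y up to
  inversion. So at most four elements lie outside <x>, while \<open>Q\<close> has at least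
  q^2.\<close>

lemma CI_nonscalar:
  assumes CI: "CI_group G" and G: "carrier G = adjoin Q y"
    and x: "x \<in> Q" and ns: "y \<otimes> x \<otimes> inv y \<notin> range (\<lambda>i::nat. x [^] i)"
  shows "q = 2" "card Q = 4"
proof -
  let ?K = "G\<lparr>carrier := Q\<rparr>"
  have fin: "finite (carrier G)" by (rule CI_groupD[OF CI])
  have finQ: "finite Q" using fin Q.subset finite_subset by blast
  interpret K: comm_group ?K
    by (rule group.group_comm_groupI[OF Q.subgroup_is_group[OF is_group]]) (simp add: Q_comm)
  have pw: "a [^]\<^bsub>?K\<^esub> (n::nat) = a [^] n" for a n
    by (rule nat_pow_consistent[symmetric])
  have Kq: "a [^]\<^bsub>?K\<^esub> q = \<one>\<^bsub>?K\<^esub>" if "a \<in> carrier ?K" for a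
    using Q_exp that pw by simp
  define u where "u = y \<otimes> x \<otimes> inv y"
  have u: "u \<in> Q" "u \<notin> range (\<lambda>i::nat. x [^] i)"
    using normalizes[OF x] ns by (simp_all add: u_def)
  have "y \<otimes> \<one> \<otimes> inv y = \<one>"
    using y(1) by simp
  then have x1: "x \<noteq> \<one>"
    using u(2) rangeI[of "\<lambda>i::nat. x [^] i" 0] unfolding u_def by auto
  have xc: "x \<in> carrier G" and uc: "u \<in> carrier G"
    using x u by auto
  have qpos: "q > 0" using prime_gt_0_nat[OF q] .
  have invx: "inv x \<in> range (\<lambda>i::nat. x [^] i)"
  proof -
    have "x [^] (q - 1) \<otimes> x = \<one>"
      using Q_exp[OF x] qpos nat_pow_Suc[of x "q - 1"] by simp
    then have "inv x = x [^] (q - 1)"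
      using xc by (intro inv_equality) auto
    then show ?thesis by blast
  qed
  have x_range: "x \<in> range (\<lambda>i::nat. x [^] i)"
    using rangeI[of "\<lambda>i::nat. x [^] i" 1] xc by simp
  define v where "v = inv y \<otimes> x \<otimes> y"
  have v: "v \<in> Q" "y \<otimes> v \<otimes> inv y = x"
    using normalizes_inv[OF x] xc y(1) by (simp_all add: v_def m_assoc)
  have conj_inj: "a = b" if "y \<otimes> a \<otimes> inv y = y \<otimes> b \<otimes> inv y" "a \<in> carrier G" "b \<in> carrier G" for a b
    using that y(1) by simp
  have conj_inj': "a = b" if "inv y \<otimes> a \<otimes> y = inv y \<otimes> b \<otimes> y" "a \<in> carrier G" "b \<in> carrier G" for a b
    using that y(1) by simp
  have S: "{x, inv x, u, inv u} \<subseteq> Q" "inverse_closed G {x, inv x, u, inv u}"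
  proof -
    have "u \<noteq> \<one>"
      using u(2) rangeI[of "\<lambda>i::nat. x [^] i" 0] by auto
    then show "inverse_closed G {x, inv x, u, inv u}"
      using inverse_closedD[OF inverse_closed_pair[OF xc x1]]
        inverse_closedD[OF inverse_closed_pair[OF uc]] by (intro inverse_closedI) auto
    show "{x, inv x, u, inv u} \<subseteq> Q"
      using x u by simp
  qed
  have key: "w \<in> {u, inv u, v, inv v}" if w: "w \<in> Q" "w \<notin> range (\<lambda>i::nat. x [^] i)" for w
  proof -
    have xK: "x \<in> carrier ?K" "x \<noteq> \<one>\<^bsub>?K\<^esub>" and uK: "u \<in> carrier ?K" "u \<notin> range (\<lambda>i::nat. x [^]\<^bsub>?K\<^esub> i)"
      and wK: "w \<in> carrier ?K" "w \<notin> range (\<lambda>i::nat. x [^]\<^bsub>?K\<^esub> i)"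
      using x x1 u w pw by simp_all
    have finK: "finite (carrier ?K)"
      using finQ by simp
    obtain F where F: "F \<in> iso ?K ?K" "F x = x" "F u = w"
      using elementary_pair_transitive[OF K.comm_group_axioms finK q Kq xK uK wK] by blast
    have F': "F \<in> hom ?K G" "inj_on F Q" "F ` Q = Q"
      using F(1) by (auto simp: iso_def bij_betw_def hom_def Pi_iff)
    note h = sub_homD[OF Q is_group F'(1)]
    obtain \<alpha> b where \<alpha>: "\<alpha> \<in> auto G" "\<alpha> ` {x, inv x, u, inv u} = F ` {x, inv x, u, inv u}"
      "b \<in> Q" "\<alpha> y = b \<otimes> y \<or> \<alpha> y = b \<otimes> inv y"
      using CI_characteristic_coset[OF CI Q characteristic[OF G fin] y(1) y_notin normalizes normalizes_inv F' S]
      by blast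
    have Fim: "F ` {x, inv x, u, inv u} = {x, inv x, w, inv w}"
      using h(4)[OF x] h(4)[OF u(1)] F(2,3) by simp
    have wc: "w \<in> carrier G" using w(1) by simp
    have ax: "\<alpha> x \<in> {x, inv x, w, inv w}" and au: "\<alpha> u \<in> {x, inv x, w, inv w}"
      using \<alpha>(2) unfolding Fim by blast+
    have aQ: "\<alpha> x \<in> Q"
      using ax x w(1) by auto
    have ne: "\<alpha> u \<noteq> \<alpha> x" "\<alpha> u \<noteq> inv (\<alpha> x)"
      using auto_eq_iff[OF \<alpha>(1) uc xc] auto_eq_iff[OF \<alpha>(1) uc inv_closed[OF xc]] autoD_group(4)[OF \<alpha>(1) xc]
        u(2) invx x_range by auto
    have conj: "\<alpha> u = y \<otimes> \<alpha> x \<otimes> inv y \<or> \<alpha> u = inv y \<otimes> \<alpha> x \<otimes> y"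
      using auto_conj[OF \<alpha>(1,3) xc aQ] \<alpha>(4) unfolding u_def by blast
    have ix: "inv (inv x) = x" "inv (inv w) = w"
      using xc wc by simp_all
    have cx: "y \<otimes> inv x \<otimes> inv y = inv u" "inv y \<otimes> inv x \<otimes> y = inv v"
      using conj_hom[OF xc] by (simp_all add: u_def v_def)
    consider "\<alpha> x = x \<or> \<alpha> x = inv x" | "\<alpha> x = w \<or> \<alpha> x = inv w"
      using ax by blast
    then show ?thesis
    proof cases
      case 1
      then have "\<alpha> u = w \<or> \<alpha> u = inv w"
        using au ne ix by auto
      moreover have "\<alpha> u \<in> {u, inv u, v, inv v}"
        using conj 1 cx by (auto simp: u_def v_def)
      moreover have "inv (inv u) = u" "inv (inv v) = v"
        using uc v(1) by simp_all
      ultimately show ?thesis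
        using ix by (metis insert_iff singletonD)
    next
      \<comment> \<open>The automorphism may also interchange the two inverse pairs; then the
        conjugation relation is read backwards, which exchanges y and y^-1.\<close>
      case 2
      then have "\<alpha> u = x \<or> \<alpha> u = inv x"
        using au ne ix by auto
      moreover have "\<alpha> x \<in> carrier G" "\<alpha> u \<in> carrier G"
        using autoD_group(1)[OF \<alpha>(1)] xc uc by auto
      then have "\<alpha> x = inv y \<otimes> \<alpha> u \<otimes> y \<or> \<alpha> x = y \<otimes> \<alpha> u \<otimes> inv y"
        using conj y(1) by (auto simp: m_assoc)
      ultimately have "\<alpha> x \<in> {u, inv u, v, inv v}"
        using cx by (auto simp: u_def v_def)
      moreover have "inv (inv u) = u" "inv (inv v) = v"
        using uc v(1) by simp_all
      ultimately show ?thesis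
        using 2 ix by (metis insert_iff singletonD)
    qed
  qed
  have cyc: "range (\<lambda>i::nat. x [^] i) = adjoin {\<one>} x"
    using adjoin_one_eq[OF xc] by simp
  have cycQ: "subgroup (adjoin {\<one>} x) G" "card (adjoin {\<one>} x) = q"
    by (rule cyclic_prime_subgroup[OF q xc Q_exp[OF x] x1])+
  have sub: "adjoin {\<one>} x \<subseteq> Q"
    using x subgroup_nat_pow[OF Q x] unfolding cyc[symmetric] by blast
  have "adjoin (adjoin {\<one>} x) u \<subseteq> Q"
  proof
    fix z assume "z \<in> adjoin (adjoin {\<one>} x) u"
    then obtain a i where "a \<in> adjoin {\<one>} x" "z = a \<otimes> u [^] (i::nat)"
      by (rule adjoinE)
    then show "z \<in> Q"
      using sub subgroup_nat_pow[OF Q u(1)] by auto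
  qed
  then have "card (adjoin (adjoin {\<one>} x) u) \<le> card Q"
    using finQ card_mono by blast
  moreover have "card (adjoin (adjoin {\<one>} x) u) = q * q"
    using card_adjoin[OF cycQ(1) uc Q_exp[OF u(1)] _ q] u(2) cycQ(2) unfolding cyc by simp
  ultimately have ge: "q * q \<le> card Q" by simp
  have "card Q = card (adjoin {\<one>} x) + card (Q - adjoin {\<one>} x)"
    using card_Diff_subset[OF finite_subset[OF sub finQ] sub] card_mono[OF finQ sub] by simp
  then have cQ: "card Q = q + card (Q - adjoin {\<one>} x)"
    using cycQ(2) by simp
  have "Q - adjoin {\<one>} x \<subseteq> {u, inv u, v, inv v}"
    using key unfolding cyc by blast
  then have le: "card (Q - adjoin {\<one>} x) \<le> card {u, inv u, v, inv v}"
    by (intro card_mono) auto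
  also have "\<dots> \<le> 4"
    using card_length[of "[u, inv u, v, inv v]"] by simp
  \<comment> \<open>Among the primes only q = 2 satisfies this.\<close>
  finally have "q * q \<le> q + 4"
    using ge cQ by simp
  moreover have "q * 3 \<le> q * q" if "q \<ge> 3"
    using that by simp
  ultimately have "\<not> q \<ge> 3"
    by linarith
  then show q2: "q = 2"
    using prime_ge_2_nat[OF q] by simp
  \<comment> \<open>For q = 2 every element is its own inverse, so the four candidates collapse to
    two and \<open>Q\<close> has at most 2 + 2 elements.\<close>
  have "inv a = a" if "a \<in> Q" for a
  proof (rule inv_equality)
    show "a \<otimes> a = \<one>"
      using Q_exp[OF that] that q2 by (simp add: numeral_2_eq_2)
  qed (use that in auto)
  then have "{u, inv u, v, inv v} = {u, v}"
    using u(1) v(1) by auto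
  moreover have "card {u, v} \<le> 2"
    by (simp add: card_insert_if)
  ultimately have "card (Q - adjoin {\<one>} x) \<le> 2"
    using le by simp
  then show "card Q = 4"
    using ge cQ q2 by simp
qed

text \<open>Let y act on the cyclic group \<open>Q\<close> as the power map with exponent s. An
  automorphism \<alpha> with \<alpha> y = y^2 or y^-2 preserves \<open>Q\<close> and commutes with
  power maps, so \<alpha> y acts on v = \<alpha> x as y does. Then y or y^3 centralizes v, and for p
  > 3 either means that y does; pulling back, y commutes with x.\<close>

lemma CI_scalar:
  assumes CI: "CI_group G" and G: "carrier G = adjoin Q y"
    and x: "x \<in> Q" "Q \<subseteq> range (\<lambda>i::nat. x [^] i)" and nt: "y \<otimes> x \<otimes> inv y \<noteq> x"
  shows "p \<le> 3"
proof (rule ccontr)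
  assume "\<not> p \<le> 3"
  then have p4: "p > 3" by simp
  have fin: "finite (carrier G)" by (rule CI_groupD[OF CI])
  have xc: "x \<in> carrier G" using x by simp
  obtain s where s: "y \<otimes> x \<otimes> inv y = x [^] (s::nat)"
    using normalizes[OF x(1)] x(2) by blast
  have cpow: "y \<otimes> a [^] (n::nat) \<otimes> inv y = (y \<otimes> a \<otimes> inv y) [^] n" if "a \<in> carrier G" for a n
  proof (induction n)
    case (Suc n)
    then show ?case
      using conj_hom(1)[of "a [^] n" a] that by simp
  qed (use y(1) in simp)
  have scal: "y \<otimes> v \<otimes> inv y = v [^] s" if v: "v \<in> Q" for v
  proof -
    obtain m where m: "v = x [^] (m::nat)"
      using x(2) v by blast
    show ?thesis
      unfolding m cpow[OF xc] s using xc by (simp add: nat_pow_pow mult.commute)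
  qed
  define z where "z = y [^] (2::nat)"
  have "ord y = p"
    using y p pow_eq_id[OF y(1)] ord_eq_1[OF y(1)] by (metis prime_nat_iff)
  then have z: "z \<in> carrier G" "z [^] p = \<one>" "z \<noteq> \<one>"
  proof -
    show "z \<in> carrier G" using y(1) by (simp add: z_def)
    show "z [^] p = \<one>"
      using y(1,2) unfolding z_def by (metis nat_pow_one nat_pow_pow mult.commute)
    assume "ord y = p"
    then show "z \<noteq> \<one>"
      unfolding z_def using pow_eq_id[OF y(1), of 2] p4 by (auto dest: dvd_imp_le)
  qed
  obtain \<alpha> where \<alpha>: "\<alpha> \<in> auto G" "\<alpha> y = z \<or> \<alpha> y = inv z"
    using CI_conj_prime[OF CI p y z] by blast
  define v where "v = \<alpha> x"
  have "v \<in> \<alpha> ` Q"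
    using x(1) by (simp add: v_def)
  then have v: "v \<in> Q" "v \<in> carrier G"
    unfolding characteristic[OF G fin \<alpha>(1)] by auto
  have "\<alpha> (y \<otimes> x \<otimes> inv y) = \<alpha> y \<otimes> v \<otimes> inv (\<alpha> y)"
    using autoD_group[OF \<alpha>(1)] y(1) xc by (simp add: v_def)
  moreover have ax: "\<alpha> (y \<otimes> x \<otimes> inv y) = y \<otimes> v \<otimes> inv y"
    unfolding scal[OF v(1)] s unfolding v_def by (rule autoD_group(5)[OF \<alpha>(1) xc])
  ultimately have e: "y \<otimes> v \<otimes> inv y = \<alpha> y \<otimes> v \<otimes> inv (\<alpha> y)"
    by simp
  have z_eq: "z = y \<otimes> y"
    using y(1) by (simp add: z_def numeral_2_eq_2)
  let ?C = "{g \<in> carrier G. g \<otimes> v = v \<otimes> g}"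
  have C: "subgroup ?C G"
    by (rule centralizer_subgroup[OF v(2)])
  have "y \<in> ?C"
    using \<alpha>(2)
  proof
    assume "\<alpha> y = z"
    then have "\<alpha> y \<otimes> v \<otimes> inv (\<alpha> y) = y \<otimes> (y \<otimes> v \<otimes> inv y) \<otimes> inv y"
      using y(1) v(2) by (simp add: z_eq m_assoc inv_mult_group)
    with e have "y \<otimes> v \<otimes> inv y = y \<otimes> (y \<otimes> v \<otimes> inv y) \<otimes> inv y"
      by (rule trans)
    then have "v = y \<otimes> v \<otimes> inv y"
      using y(1) v(2) by simp
    then show ?thesis
      using conj_eq_iff_commute[OF y(1) v(2) v(2)] y(1) by simp
  next
    assume "\<alpha> y = inv z"
    then have "y \<otimes> v \<otimes> inv y = inv z \<otimes> v \<otimes> z"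
      using e z(1) by simp
    then have "z \<otimes> (y \<otimes> v \<otimes> inv y) = v \<otimes> z"
      using y(1) v(2) z(1) by (simp add: m_assoc)
    then have "z \<otimes> (y \<otimes> v \<otimes> inv y) \<otimes> y = v \<otimes> z \<otimes> y"
      by simp
    then have "(z \<otimes> y) \<otimes> v = v \<otimes> (z \<otimes> y)"
      using y(1) v(2) z(1) by (simp add: m_assoc)
    moreover have "z \<otimes> y = y [^] (3::nat)"
      using y(1) by (simp add: z_def numeral_3_eq_3 numeral_2_eq_2)
    ultimately have "y [^] (3::nat) \<in> ?C"
      using y(1) by simp
    then have "y [^] (int 3) \<in> ?C"
      unfolding int_pow_int .
    then have "y \<notin> ?C \<longrightarrow> int p dvd int 3"
      using pow_prime_mem_iff[OF C y(1,2) _ p] by blast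
    moreover have "\<not> int p dvd int 3"
      using p4 by (auto dest: zdvd_imp_le)
    ultimately show ?thesis by blast
  qed
  then have "y \<otimes> v \<otimes> inv y = v"
    using conj_eq_iff_commute[OF y(1) v(2) v(2)] by simp
  then have "\<alpha> (y \<otimes> x \<otimes> inv y) = \<alpha> x"
    unfolding ax by (simp add: v_def)
  then show False
    using nt auto_eq_iff[OF \<alpha>(1) _ xc] y(1) xc by simp
qed

text \<open>Lets the results that assume \<open>carrier G = adjoin Q y\<close> be applied inside
  Q<y>, which inherits the CI property as a subgroup.\<close>

lemma adjoin_prime_action:
  shows "subgroup (adjoin Q y) G" "prime_action (G\<lparr>carrier := adjoin Q y\<rparr>) Q y p q"
    "carrier (G\<lparr>carrier := adjoin Q y\<rparr>) = group.adjoin (G\<lparr>carrier := adjoin Q y\<rparr>) Q y"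
proof -
  let ?A = "adjoin Q y"
  let ?H = "G\<lparr>carrier := ?A\<rparr>"
  show A: "subgroup ?A G"
    by (rule adjoin_subgroup[OF Q y(1,2) prime_gt_0_nat[OF p] normalizes])
  interpret H: group ?H
    by (rule subgroup.subgroup_is_group[OF A is_group])
  have pw: "a [^]\<^bsub>?H\<^esub> (n::nat) = a [^] n" for a n
    by (rule nat_pow_consistent[symmetric])
  have yA: "y \<in> ?A"
    by (rule mem_adjoin[OF Q y(1)])
  have iy: "inv\<^bsub>?H\<^esub> y = inv y"
    by (rule m_inv_consistent[OF A yA])
  show "carrier ?H = H.adjoin Q y"
    unfolding H.adjoin_def pw by (simp add: adjoin_def)
  show "prime_action ?H Q y p q"
  proof (intro prime_action.intro prime_action_axioms.intro)
    show "subgroup Q ?H"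
      by (rule subgroup_incl[OF Q A subset_adjoin[OF Q.subset]])
    show "a \<otimes>\<^bsub>?H\<^esub> b = b \<otimes>\<^bsub>?H\<^esub> a" if "a \<in> Q" "b \<in> Q" for a b
      using Q_comm[OF that] by simp
    show "a [^]\<^bsub>?H\<^esub> q = \<one>\<^bsub>?H\<^esub>" if "a \<in> Q" for a
      using Q_exp[OF that] pw by simp
    show "y \<otimes>\<^bsub>?H\<^esub> a \<otimes>\<^bsub>?H\<^esub> inv\<^bsub>?H\<^esub> y \<in> Q" if "a \<in> Q" for a
      using normalizes[OF that] iy by simp
    show "y [^]\<^bsub>?H\<^esub> p = \<one>\<^bsub>?H\<^esub>"
      using y(2) pw by simp
  qed (use p q pq y yA in simp_all)
qed

text \<open>If every element of \<open>Q\<close> goes to a power of itself and some x is moved, then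
  <x> is normalized by y, and the bound on p comes from the group <x><y>.\<close>

lemma CI_trichotomy:
  assumes CI: "CI_group G"
  obtains (central) "\<And>a. a \<in> Q \<Longrightarrow> y \<otimes> a = a \<otimes> y"
    | (scalar) "p \<le> 3" "\<And>a. a \<in> Q \<Longrightarrow> y \<otimes> a \<otimes> inv y \<in> range (\<lambda>i::nat. a [^] i)"
    | (four) "q = 2" "card Q = 4"
proof (cases "\<exists>x\<in>Q. y \<otimes> x \<otimes> inv y \<notin> range (\<lambda>i::nat. x [^] i)")
  case True
  let ?H = "G\<lparr>carrier := adjoin Q y\<rparr>"
  interpret H: prime_action ?H Q y p q
    by (rule adjoin_prime_action)
  have pw: "a [^]\<^bsub>?H\<^esub> (n::nat) = a [^] n" for a n
    by (rule nat_pow_consistent[symmetric])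
  have iy: "inv\<^bsub>?H\<^esub> y = inv y"
    by (rule m_inv_consistent[OF adjoin_prime_action(1) mem_adjoin[OF Q y(1)]])
  obtain x where x: "x \<in> Q" "y \<otimes> x \<otimes> inv y \<notin> range (\<lambda>i::nat. x [^] i)"
    using True by blast
  have "y \<otimes>\<^bsub>?H\<^esub> x \<otimes>\<^bsub>?H\<^esub> inv\<^bsub>?H\<^esub> y \<notin> range (\<lambda>i::nat. x [^]\<^bsub>?H\<^esub> i)"
    using x(2) iy pw by simp
  then show ?thesis
    using H.CI_nonscalar[OF CI_subgroup[OF CI adjoin_prime_action(1)] adjoin_prime_action(3) x(1)] four
    by blast
next
  case False
  then have sc: "y \<otimes> a \<otimes> inv y \<in> range (\<lambda>i::nat. a [^] i)" if "a \<in> Q" for a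
    using that by blast
  show ?thesis
  proof (cases "\<exists>x\<in>Q. y \<otimes> x \<noteq> x \<otimes> y")
    case True
    then obtain x where x: "x \<in> Q" "y \<otimes> x \<noteq> x \<otimes> y" by blast
    then have xc: "x \<in> carrier G" and x1: "x \<noteq> \<one>"
      using y(1) by auto
    let ?Q = "adjoin {\<one>} x"
    have Q_eq: "?Q = range (\<lambda>i::nat. x [^] i)"
      by (rule adjoin_one_eq[OF xc])
    have sub: "?Q \<subseteq> Q"
      using subgroup_nat_pow[OF Q x(1)] unfolding Q_eq by blast
    interpret C: prime_action G ?Q y p q
    proof (intro prime_action.intro prime_action_axioms.intro)
      show "subgroup ?Q G"
        by (rule cyclic_prime_subgroup(1)[OF q xc Q_exp[OF x(1)] x1])
      show "a \<otimes> b = b \<otimes> a" if "a \<in> ?Q" "b \<in> ?Q" for a b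
        using that sub Q_comm by blast
      show "a [^] q = \<one>" if "a \<in> ?Q" for a
        using that sub Q_exp by blast
      show "y \<otimes> a \<otimes> inv y \<in> ?Q" if a: "a \<in> ?Q" for a
      proof -
        have aQ: "a \<in> Q" using a sub by blast
        have "range (\<lambda>i::nat. a [^] i) \<subseteq> ?Q"
          using subgroup_nat_pow[OF cyclic_prime_subgroup(1)[OF q xc Q_exp[OF x(1)] x1] a] by blast
        then show ?thesis
          using sc[OF aQ] by blast
      qed
    qed (use p q pq y in simp_all)
    let ?H = "G\<lparr>carrier := adjoin ?Q y\<rparr>"
    interpret H: prime_action ?H ?Q y p q
      by (rule C.adjoin_prime_action)
    have pw: "a [^]\<^bsub>?H\<^esub> (n::nat) = a [^] n" for a n
      by (rule nat_pow_consistent[symmetric])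
    have iy: "inv\<^bsub>?H\<^esub> y = inv y"
      by (rule m_inv_consistent[OF C.adjoin_prime_action(1) mem_adjoin[OF C.Q y(1)]])
    have xQ: "x \<in> ?Q" "?Q \<subseteq> range (\<lambda>i::nat. x [^]\<^bsub>?H\<^esub> i)"
      using mem_adjoin[OF triv_subgroup xc] Q_eq pw by simp_all
    have "y \<otimes>\<^bsub>?H\<^esub> x \<otimes>\<^bsub>?H\<^esub> inv\<^bsub>?H\<^esub> y \<noteq> x"
      using x(2) iy conj_eq_iff_commute[OF y(1) xc xc] by simp
    then have "p \<le> 3"
      using H.CI_scalar[OF CI_subgroup[OF CI C.adjoin_prime_action(1)] C.adjoin_prime_action(3) xQ] by blast
    then show ?thesis
      using sc scalar by blast
  next
    case False
    then show ?thesis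
      using central by blast
  qed
qed

end

section \<open>Sylow conjugacy, fusion and transfer\<close>

text \<open>\<open>BijGroup E\<close> consists of extensional maps, whence the
  \<open>restrict\<close>; bijectivity follows from the action of the inverse.\<close>

lemma group_actionI:
  assumes G: "group G"
    and "\<And>g x. \<lbrakk>g \<in> carrier G; x \<in> E\<rbrakk> \<Longrightarrow> f g x \<in> E"
    and "\<And>x. x \<in> E \<Longrightarrow> f \<one>\<^bsub>G\<^esub> x = x"
    and "\<And>g h x. \<lbrakk>g \<in> carrier G; h \<in> carrier G; x \<in> E\<rbrakk> \<Longrightarrow> f (g \<otimes>\<^bsub>G\<^esub> h) x = f g (f h x)"
  shows "group_action G E (\<lambda>g. restrict (f g) E)"
proof -
  interpret G: group G by fact
  have inv: "f (inv\<^bsub>G\<^esub> g) (f g x) = x" "f g (f (inv\<^bsub>G\<^esub> g) x) = x" if "g \<in> carrier G" "x \<in> E" for g x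
    using assms(3,4)[symmetric] that by simp_all
  have bij: "restrict (f g) E \<in> Bij E" if "g \<in> carrier G" for g
  proof -
    have "bij_betw (f g) E E"
      by (rule bij_betw_byWitness[where f' = "f (inv\<^bsub>G\<^esub> g)"]) (use inv assms(2) that in auto)
    then show ?thesis
      by (simp add: Bij_def)
  qed
  have "(\<lambda>g. restrict (f g) E) \<in> hom G (BijGroup E)"
  proof (rule homI)
    show "restrict (f g) E \<in> carrier (BijGroup E)" if "g \<in> carrier G" for g
      using bij[OF that] by (simp add: BijGroup_def)
    show "restrict (f (g \<otimes>\<^bsub>G\<^esub> h)) E = restrict (f g) E \<otimes>\<^bsub>BijGroup E\<^esub> restrict (f h) E"
      if "g \<in> carrier G" "h \<in> carrier G" for g h
      using bij[OF that(1)] bij[OF that(2)] assms(2,4) that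
      by (auto simp: BijGroup_def compose_def restrict_def)
  qed
  then show ?thesis
    using G group_BijGroup by (auto simp: group_action_def group_hom_def group_hom_axioms_def)
qed

text \<open>Orbit lengths are powers of p. They add up to a number not divisible by p, so one of
  them is 1.\<close>

lemma (in group_action) pgroup_fixed_point:
  assumes p: "Factorial_Ring.prime (p::nat)" and G: "order G = p ^ b" and E: "finite E" "\<not> p dvd card E"
  obtains x where "x \<in> E" "\<And>g. g \<in> carrier G \<Longrightarrow> \<phi> g x = x"
proof -
  have "(\<Sum>orb\<in>orbits G E \<phi>. \<Sum>x\<in>orb. 1) = (\<Sum>x\<in>E. 1::nat)"
    by (rule disjoint_sum[OF E(1)])
  then have "(\<Sum>orb\<in>orbits G E \<phi>. card orb) = card E"
    by simp
  then have "\<not> (\<forall>orb\<in>orbits G E \<phi>. p dvd card orb)"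
    using dvd_sum[of "orbits G E \<phi>" p card] E(2) by auto
  then obtain x where x: "x \<in> E" "\<not> p dvd card (orbit G \<phi> x)"
    unfolding orbits_def by blast
  have "card (orbit G \<phi> x) dvd p ^ b"
    using orbit_stabilizer_theorem[OF x(1)] G by (metis dvd_triv_left)
  then obtain i where "card (orbit G \<phi> x) = p ^ i"
    using divides_primepow_nat[OF p] by blast
  then have "card (orbit G \<phi> x) = 1"
    using x(2) by (cases i) auto
  then obtain z where "orbit G \<phi> x = {z}"
    by (meson card_1_singletonE)
  then have "orbit G \<phi> x = {x}"
    using orbit_refl[OF x(1)] by simp
  then show ?thesis
    using that[OF x(1)] unfolding orbit_def by blast
qed

context group
begin

text \<open>\<open>U\<close> acts on the right cosets of \<open>P\<close>, whose number is prime to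
  p. A fixed coset P c means that c U c^-1 lies in \<open>P\<close>.\<close>

lemma sylow_conj_subset:
  assumes fin: "finite (carrier G)" and p: "Factorial_Ring.prime (p::nat)"
    and P: "subgroup P G" "\<not> p dvd order G div card P" and U: "subgroup U G" "card U = p ^ b"
  obtains c where "c \<in> carrier G" "\<And>u. u \<in> U \<Longrightarrow> c \<otimes> u \<otimes> inv c \<in> P"
proof -
  interpret P: subgroup P G by fact
  interpret U: subgroup U G by fact
  let ?U = "G\<lparr>carrier := U\<rparr>"
  let ?E = "rcosets P"
  have sub: "C \<subseteq> carrier G" if "C \<in> ?E" for C
    by (rule P.rcosets_carrier[OF is_group that])
  \<comment> \<open>Right multiplication by the inverse makes this a left action.\<close>
  have act: "group_action ?U ?E (\<lambda>g. restrict ((\<lambda>g C. C #> inv g) g) ?E)"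
  proof (rule group_actionI)
    show "group ?U"
      by (rule U.subgroup_is_group[OF is_group])
    show "C #> inv g \<in> ?E" if "g \<in> carrier ?U" "C \<in> ?E" for g C
    proof -
      obtain x where x: "x \<in> carrier G" "C = P #> x"
        using \<open>C \<in> ?E\<close> unfolding RCOSETS_def by blast
      then have "C #> inv g = P #> (x \<otimes> inv g)"
        using \<open>g \<in> carrier ?U\<close> P.subset by (simp add: coset_mult_assoc)
      then show ?thesis
        using x(1) \<open>g \<in> carrier ?U\<close> P.subset by (simp add: rcosetsI)
    qed
    show "C #> inv \<one>\<^bsub>?U\<^esub> = C" if "C \<in> ?E" for C
      using sub[OF that] by simp
    show "C #> inv (g \<otimes>\<^bsub>?U\<^esub> h) = C #> inv h #> inv g"
      if "g \<in> carrier ?U" "h \<in> carrier ?U" "C \<in> ?E" for g h C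
      using sub[OF that(3)] that(1,2) by (simp add: coset_mult_assoc inv_mult_group)
  qed
  have "finite ?E"
    using fin by (metis finite_subset[OF rcosets_subset_PowG[OF P(1)]] finite_Pow_iff)
  moreover have "card ?E = order G div card P"
    using lagrange[OF P(1)] P.finite_imp_card_positive[OF fin] by (metis nonzero_mult_div_cancel_right less_numeral_extra(3))
  ultimately obtain C where C: "C \<in> ?E" "\<And>g. g \<in> carrier ?U \<Longrightarrow> restrict (\<lambda>C. C #> inv g) ?E C = C"
    using group_action.pgroup_fixed_point[OF act p, of b] U(2) P(2) by (auto simp: order_def)
  obtain c where c: "c \<in> carrier G" "C = P #> c"
    using C(1) unfolding RCOSETS_def by blast
  have "c \<otimes> u \<otimes> inv c \<in> P" if u: "u \<in> U" for u
  proof -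
    have "P #> c #> inv (inv u) = P #> c"
      using C(2)[of "inv u"] C(1) u c(2) by simp
    then have "P #> (c \<otimes> u) = P #> c"
      using u c(1) P.subset by (simp add: coset_mult_assoc)
    moreover have cu: "c \<otimes> u \<in> carrier G"
      using u c(1) by simp
    ultimately have "c \<otimes> u \<in> P #> c"
      using rcos_self[OF cu P(1)] by simp
    then show ?thesis
      using P.rcos_module[OF is_group c(1) cu] by blast
  qed
  then show ?thesis
    using c(1) that by blast
qed

text \<open>If \<open>z\<close> and \<open>z' = x z x\<^sup>-\<^sup>1\<close> lie in the abelian Sylow subgroup \<open>P\<close>, then \<open>P\<close> and \<open>x P x\<^sup>-\<^sup>1\<close> are
  conjugate in the centralizer of \<open>z'\<close>.\<close>

lemma burnside_fusion:
  assumes fin: "finite (carrier G)" and p: "Factorial_Ring.prime (p::nat)"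
    and P: "subgroup P G" "card P = p ^ a" "\<not> p dvd order G div card P"
    and comm: "\<And>u v. \<lbrakk>u \<in> P; v \<in> P\<rbrakk> \<Longrightarrow> u \<otimes> v = v \<otimes> u"
    and NC: "\<And>g z. \<lbrakk>g \<in> carrier G; \<And>u. u \<in> P \<Longrightarrow> g \<otimes> u \<otimes> inv g \<in> P; z \<in> P\<rbrakk> \<Longrightarrow> g \<otimes> z = z \<otimes> g"
    and x: "x \<in> carrier G" and z: "z \<in> P" "x \<otimes> z \<otimes> inv x \<in> P"
  shows "x \<otimes> z \<otimes> inv x = z"
proof -
  interpret P: subgroup P G by fact
  define w where "w = x \<otimes> z \<otimes> inv x"
  have wc: "w \<in> carrier G" and wP: "w \<in> P"
    using x z by (simp_all add: w_def)
  let ?C = "{g \<in> carrier G. g \<otimes> w = w \<otimes> g}"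
  have C: "subgroup ?C G"
    by (rule centralizer_subgroup[OF wc])
  let ?K = "G\<lparr>carrier := ?C\<rparr>"
  interpret K: group ?K
    by (rule subgroup.subgroup_is_group[OF C is_group])
  have PC: "P \<subseteq> ?C"
    using comm wP by auto
  define U where "U = (\<lambda>u. x \<otimes> u \<otimes> inv x) ` P"
  have UC: "U \<subseteq> ?C"
  proof
    fix g assume "g \<in> U"
    then obtain u where u: "u \<in> P" "g = x \<otimes> u \<otimes> inv x"
      unfolding U_def by blast
    have "g \<otimes> w = x \<otimes> (u \<otimes> z) \<otimes> inv x" "w \<otimes> g = x \<otimes> (z \<otimes> u) \<otimes> inv x"
      using u z(1) x by (simp_all add: w_def m_assoc)
    then show "g \<in> ?C"
      using comm[OF u(1) z(1)] u x by simp
  qed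
  have Usub: "subgroup U G"
  proof (rule subgroupI)
    show "U \<subseteq> carrier G"
      using x unfolding U_def by auto
    show "U \<noteq> {}"
      using P.one_closed unfolding U_def by blast
    fix g h assume "g \<in> U"
    then obtain u where u: "u \<in> P" "g = x \<otimes> u \<otimes> inv x"
      unfolding U_def by blast
    have "inv g = x \<otimes> inv u \<otimes> inv x"
      using u x by (simp add: inv_mult_group m_assoc)
    then show "inv g \<in> U"
      using u(1) unfolding U_def by blast
    assume "h \<in> U"
    then obtain v where v: "v \<in> P" "h = x \<otimes> v \<otimes> inv x"
      unfolding U_def by blast
    have "g \<otimes> h = x \<otimes> (u \<otimes> v) \<otimes> inv x"
      using u v x by (simp add: m_assoc)
    then show "g \<otimes> h \<in> U"
      using u(1) v(1) unfolding U_def by blast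
  qed
  have "inj_on (\<lambda>u. x \<otimes> u \<otimes> inv x) P"
    using x by (auto simp: inj_on_def)
  then have cU: "card U = p ^ a"
    unfolding U_def using P(2) by (simp add: card_image)
  have PK: "subgroup P ?K" and UK: "subgroup U ?K"
    by (rule subgroup_incl[OF P(1) C PC]) (rule subgroup_incl[OF Usub C UC])
  have finK: "finite (carrier ?K)"
    using fin by simp
  \<comment> \<open>The index of \<open>P\<close> in the centralizer divides its index in
    \<open>G\<close>, so \<open>P\<close> remains a Sylow subgroup there.\<close>
  have "\<not> p dvd order ?K div card P"
  proof
    assume dv: "p dvd order ?K div card P"
    have "order ?K = card (rcosets\<^bsub>?K\<^esub> P) * card P"
      using K.lagrange[OF PK] by simp
    moreover have "order G = card (rcosets ?C) * order ?K"
      using lagrange[OF C] by (simp add: order_def)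
    moreover have "card P > 0"
      using P.finite_imp_card_positive[OF fin] .
    ultimately have "order G div card P = card (rcosets ?C) * card (rcosets\<^bsub>?K\<^esub> P)"
      "order ?K div card P = card (rcosets\<^bsub>?K\<^esub> P)"
      by simp_all
    then show False
      using dv P(3) by simp
  qed
  then obtain c where c: "c \<in> carrier ?K" "\<And>u. u \<in> U \<Longrightarrow> c \<otimes>\<^bsub>?K\<^esub> u \<otimes>\<^bsub>?K\<^esub> inv\<^bsub>?K\<^esub> c \<in> P"
    using K.sylow_conj_subset[OF finK p PK _ UK cU] by blast
  have cC: "c \<in> ?C"
    using c(1) by simp
  then have cG: "c \<in> carrier G" "c \<otimes> w = w \<otimes> c"
    by simp_all
  have cU': "c \<otimes> u \<otimes> inv c \<in> P" if "u \<in> U" for u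
    using c(2)[OF that] m_inv_consistent[OF C cC] by simp
  \<comment> \<open>Conjugation by c brings x P x^-1 back into \<open>P\<close>, so c x normalizes
    \<open>P\<close> and by \<open>NC\<close> commutes with z; since c commutes with w, this gives w
    = z.\<close>
  have "(c \<otimes> x) \<otimes> u \<otimes> inv (c \<otimes> x) \<in> P" if u: "u \<in> P" for u
  proof -
    have "(c \<otimes> x) \<otimes> u \<otimes> inv (c \<otimes> x) = c \<otimes> (x \<otimes> u \<otimes> inv x) \<otimes> inv c"
      using cG(1) x u by (simp add: m_assoc inv_mult_group)
    then show ?thesis
      using cU' u unfolding U_def by simp
  qed
  then have "(c \<otimes> x) \<otimes> z = z \<otimes> (c \<otimes> x)"
    using NC[OF _ _ z(1), of "c \<otimes> x"] cG(1) x by blast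
  then have "(c \<otimes> x) \<otimes> z \<otimes> inv (c \<otimes> x) = z"
    using conj_eq_iff_commute[of "c \<otimes> x" z z] cG(1) x z(1) by simp
  moreover have "(c \<otimes> x) \<otimes> z \<otimes> inv (c \<otimes> x) = c \<otimes> w \<otimes> inv c"
    using cG(1) x z(1) by (simp add: w_def m_assoc inv_mult_group)
  moreover have "c \<otimes> w \<otimes> inv c = w"
    using conj_eq_iff_commute[OF cG(1) wc wc] cG(2) by simp
  ultimately show ?thesis
    by (simp add: w_def)
qed

end

section \<open>Orbits of prime length and the transfer homomorphism\<close>

lemma funpow_prime_orbit_inj:
  assumes p: "Factorial_Ring.prime (p::nat)" and sp: "(s ^^ p) t = t" and t: "s t \<noteq> t"
  shows "inj_on (\<lambda>i. (s ^^ i) t) {..<p}"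
proof -
  have multiple: "(s ^^ (n * m)) t = t" if "(s ^^ m) t = t" for n m
    by (induction n) (simp_all add: funpow_add that)
  \<comment> \<open>A period d < p would be coprime to p, and Bezout turns the periods d and p into
    the period 1.\<close>
  have key: "(s ^^ d) t \<noteq> t" if dp: "0 < d" "d < p" for d
  proof
    assume d: "(s ^^ d) t = t"
    have "coprime d p"
      using p dp by (meson coprime_commute nat_dvd_not_less prime_imp_coprime)
    then obtain a b where "a * d = b * p + 1"
      using bezout_nat[of d p] dp by (auto simp: mult.commute)
    then have "(s ^^ (a * d)) t = s ((s ^^ (b * p)) t)"
      by simp
    then show False
      using multiple[OF d] multiple[OF sp] t by simp
  qed
  have lt: "(s ^^ i) t \<noteq> (s ^^ j) t" if ij: "i < j" "j < p" for i j
  proof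
    assume e: "(s ^^ i) t = (s ^^ j) t"
    have "(s ^^ (p - j)) ((s ^^ i) t) = (s ^^ (p - j)) ((s ^^ j) t)"
      using e by simp
    then have "(s ^^ (p - j + i)) t = (s ^^ (p - j + j)) t"
      by (simp only: funpow_add comp_apply)
    then have "(s ^^ (p - j + i)) t = t"
      using ij sp by simp
    moreover have "0 < p - j + i" "p - j + i < p"
      using ij by linarith+
    ultimately show False
      using key[of "p - j + i"] by simp
  qed
  show ?thesis
  proof (rule inj_onI)
    fix i j assume "i \<in> {..<p}" "j \<in> {..<p}" "(s ^^ i) t = (s ^^ j) t"
    then have "\<not> i < j" "\<not> j < i"
      using lt[of i j] lt[of j i] by auto
    then show "i = j"
      by simp
  qed
qed

lemma (in comm_monoid) finprod_prime_orbits: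
  assumes "finite E" and p: "Factorial_Ring.prime (p::nat)"
    and "\<And>t. t \<in> E \<Longrightarrow> s t \<in> E" "\<And>t. t \<in> E \<Longrightarrow> s t \<noteq> t" "\<And>t. t \<in> E \<Longrightarrow> (s ^^ p) t = t"
    and "F \<in> E \<rightarrow> carrier G" "\<And>t. t \<in> E \<Longrightarrow> finprod G (\<lambda>i. F ((s ^^ i) t)) {..<p} = \<one>"
  shows "p dvd card E \<and> finprod G F E = \<one>"
  using assms(1,3-)
proof (induction "card E" arbitrary: E rule: less_induct)
  case less
  show ?case
  proof (cases "E = {}")
    case False
    then obtain t where t: "t \<in> E" by blast
    let ?O = "(\<lambda>i. (s ^^ i) t) ` {..<p}"
    have pow: "(s ^^ i) u \<in> E" if "u \<in> E" for i u
      by (induction i) (use that less.prems(2) in auto)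
    have O: "?O \<subseteq> E"
      using pow t by blast
    have inj: "inj_on (\<lambda>i. (s ^^ i) t) {..<p}"
      by (rule funpow_prime_orbit_inj[OF p less.prems(4)[OF t] less.prems(3)[OF t]])
    then have cO: "card ?O = p"
      by (simp add: card_image)
    have FO: "F \<in> ?O \<rightarrow> carrier G" "F \<in> E - ?O \<rightarrow> carrier G"
      using less.prems(5) O by auto
    have prodO: "finprod G F ?O = \<one>"
      using finprod_reindex[OF FO(1) inj] less.prems(6)[OF t] by simp
    have cE: "card E = p + card (E - ?O)"
      using card_Diff_subset[OF finite_subset[OF O less.prems(1)] O] card_mono[OF less.prems(1) O] cO by simp
    \<comment> \<open>Removing an orbit leaves an invariant set: u is recovered from s u by p - 1
      further steps.\<close>
    have st: "s u \<in> E - ?O" if u: "u \<in> E - ?O" for u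
    proof -
      have "u \<in> ?O" if su: "s u \<in> ?O"
      proof -
        obtain i where i: "s u = (s ^^ i) t"
          using su by blast
        have "u = (s ^^ p) u"
          using less.prems(4) u by simp
        also have "\<dots> = (s ^^ (p - 1)) (s u)"
          using prime_gt_0_nat[OF p] by (metis Suc_diff_1 comp_apply funpow_Suc_right)
        also have "\<dots> = (s ^^ (p - 1 + i)) t"
          unfolding i by (simp add: funpow_add)
        also have "\<dots> = (s ^^ ((p - 1 + i) mod p)) t"
          using less.prems(4)[OF t] by (rule funpow_mod_eq[symmetric])
        finally show ?thesis
          using prime_gt_0_nat[OF p] by (metis imageI lessThan_iff mod_less_divisor)
      qed
      then show ?thesis
        using u less.prems(2) by blast
    qed
    have IH: "p dvd card (E - ?O) \<and> finprod G F (E - ?O) = \<one>"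
      by (rule less.hyps) (use cE prime_gt_0_nat[OF p] less.prems st FO(2) in auto)
    have "E = ?O \<union> (E - ?O)"
      using O by blast
    then have "finprod G F E = finprod G F ?O \<otimes> finprod G F (E - ?O)"
      using finprod_Un_disjoint[OF _ _ _ FO] less.prems(1) by (metis Diff_disjoint finite_Diff finite_imageI finite_lessThan)
    then show ?thesis
      using IH prodO cE by simp
  qed simp
qed

context group
begin

text \<open>\<open>V\<close> is the transfer: multiplication by g permutes the coset representatives
  up to factors in \<open>P\<close>, and V g is the product of these factors. For z in
  \<open>P\<close> an orbit on the representatives has length 1 or p. One of length p contributes 1
  because z^p = 1; a fixed representative t contributes t z t^-1, which is z by fusion. Hence V z =
  z^m with m congruent to |G : P| modulo p, so m is prime to p and V z = 1 only for z = 1.\<close>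

lemma burnside_transfer:
  assumes fin: "finite (carrier G)" and p: "Factorial_Ring.prime (p::nat)"
    and P: "subgroup P G" "card P = p ^ a" "\<not> p dvd order G div card P"
    and comm: "\<And>u v. \<lbrakk>u \<in> P; v \<in> P\<rbrakk> \<Longrightarrow> u \<otimes> v = v \<otimes> u"
    and exp: "\<And>u. u \<in> P \<Longrightarrow> u [^] p = \<one>"
    and NC: "\<And>g z. \<lbrakk>g \<in> carrier G; \<And>u. u \<in> P \<Longrightarrow> g \<otimes> u \<otimes> inv g \<in> P; z \<in> P\<rbrakk> \<Longrightarrow> g \<otimes> z = z \<otimes> g"
  obtains V where "V \<in> hom G (G\<lparr>carrier := P\<rparr>)" "inj_on V P"
proof -
  interpret P: subgroup P G by fact
  let ?K = "G\<lparr>carrier := P\<rparr>"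
  interpret K: comm_group ?K
    by (rule group.group_comm_groupI[OF P.subgroup_is_group[OF is_group]]) (simp add: comm)
  obtain T where T: "right_transversal P T"
    using ex_right_transversal[OF P(1)] by blast
  have Tc: "T \<subseteq> carrier G" and bij: "bij_betw (\<lambda>(a, t). a \<otimes> t) (P \<times> T) (carrier G)"
    using T right_transversal_iff[OF P(1)] by auto
  have finT: "finite T"
    using Tc fin finite_subset by blast
  \<comment> \<open>Every x is \<open>\<pi> x \<otimes> \<rho> x\<close> with \<open>\<pi> x\<close>
    in \<open>P\<close> and \<open>\<rho> x\<close> among the representatives.\<close>
  define \<iota> where "\<iota> = the_inv_into (P \<times> T) (\<lambda>(a, t). a \<otimes> t)"
  define \<pi> where "\<pi> x = fst (\<iota> x)" for x
  define \<rho> where "\<rho> x = snd (\<iota> x)" for x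
  have \<iota>: "\<iota> (a \<otimes> t) = (a, t)" if "a \<in> P" "t \<in> T" for a t
    unfolding \<iota>_def using the_inv_into_f_f[of "\<lambda>(a, t). a \<otimes> t" "P \<times> T" "(a, t)"] bij that
    by (auto simp: bij_betw_def)
  have dec: "\<pi> x \<in> P" "\<rho> x \<in> T" "x = \<pi> x \<otimes> \<rho> x" if "x \<in> carrier G" for x
  proof -
    have "x \<in> (\<lambda>(a, t). a \<otimes> t) ` (P \<times> T)"
      using bij that by (simp add: bij_betw_def)
    then obtain a t where "a \<in> P" "t \<in> T" "x = a \<otimes> t"
      by auto
    then show "\<pi> x \<in> P" "\<rho> x \<in> T" "x = \<pi> x \<otimes> \<rho> x"
      using \<iota> by (simp_all add: \<pi>_def \<rho>_def)
  qed
  have \<rho>c: "\<rho> x \<in> carrier G" if "x \<in> carrier G" for x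
    using dec(2)[OF that] Tc by blast
  have left: "\<pi> (a \<otimes> x) = a \<otimes> \<pi> x" "\<rho> (a \<otimes> x) = \<rho> x" if "a \<in> P" "x \<in> carrier G" for a x
  proof -
    have "a \<otimes> x = (a \<otimes> \<pi> x) \<otimes> \<rho> x"
      using dec[OF that(2)] \<rho>c[OF that(2)] that(1) P.mem_carrier by (metis m_assoc)
    then have "\<iota> (a \<otimes> x) = (a \<otimes> \<pi> x, \<rho> x)"
      using \<iota>[of "a \<otimes> \<pi> x" "\<rho> x"] dec[OF that(2)] that(1) by simp
    then show "\<pi> (a \<otimes> x) = a \<otimes> \<pi> x" "\<rho> (a \<otimes> x) = \<rho> x"
      by (simp_all add: \<pi>_def \<rho>_def)
  qed
  have T1: "\<rho> t = t" "\<pi> t = \<one>" if "t \<in> T" for t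
  proof -
    have "t \<in> carrier G"
      using that Tc by blast
    then have "\<iota> t = (\<one>, t)"
      using \<iota>[OF P.one_closed that] by simp
    then show "\<rho> t = t" "\<pi> t = \<one>"
      by (simp_all add: \<pi>_def \<rho>_def)
  qed
  have step: "\<pi> (x \<otimes> g) = \<pi> x \<otimes> \<pi> (\<rho> x \<otimes> g)" "\<rho> (x \<otimes> g) = \<rho> (\<rho> x \<otimes> g)"
    if "x \<in> carrier G" "g \<in> carrier G" for x g
  proof -
    have "x \<otimes> g = \<pi> x \<otimes> (\<rho> x \<otimes> g)"
      using dec[OF that(1)] \<rho>c[OF that(1)] that(2) P.mem_carrier by (metis m_assoc)
    then show "\<pi> (x \<otimes> g) = \<pi> x \<otimes> \<pi> (\<rho> x \<otimes> g)" "\<rho> (x \<otimes> g) = \<rho> (\<rho> x \<otimes> g)"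
      using left[OF dec(1)[OF that(1)], of "\<rho> x \<otimes> g"] \<rho>c[OF that(1)] that(2) by simp_all
  qed
  define V where "V g = finprod ?K (\<lambda>t. \<pi> (t \<otimes> g)) T" for g
  have tg: "t \<otimes> g \<in> carrier G" if "t \<in> T" "g \<in> carrier G" for t g
    using that Tc by blast
  have Vc: "(\<lambda>t. \<pi> (t \<otimes> g)) \<in> T \<rightarrow> carrier ?K" if "g \<in> carrier G" for g
    using dec(1)[OF tg] that by simp
  \<comment> \<open>The inverse of this permutation of the representatives is the one belonging to
    g^-1.\<close>
  have perm: "(\<lambda>t. \<rho> (t \<otimes> g)) ` T = T" "inj_on (\<lambda>t. \<rho> (t \<otimes> g)) T" if g: "g \<in> carrier G" for g
  proof -
    have inv: "\<rho> (\<rho> (t \<otimes> h) \<otimes> h') = t" if "t \<in> T" "h \<in> carrier G" "h' \<in> carrier G" "h \<otimes> h' = \<one>" for t h h'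
    proof -
      have "\<rho> (\<rho> (t \<otimes> h) \<otimes> h') = \<rho> (t \<otimes> h \<otimes> h')"
        using step(2)[OF tg[OF that(1,2)] that(3)] by simp
      also have "t \<otimes> h \<otimes> h' = t"
        using that Tc by (metis m_assoc r_one subsetD)
      finally show ?thesis
        using T1(1)[OF that(1)] by simp
    qed
    show "inj_on (\<lambda>t. \<rho> (t \<otimes> g)) T"
      by (rule inj_on_inverseI[where g = "\<lambda>t. \<rho> (t \<otimes> inv g)"]) (use inv g in simp)
    then show "(\<lambda>t. \<rho> (t \<otimes> g)) ` T = T"
      using dec(2)[OF tg[OF _ g]] finT by (intro endo_inj_surj) auto
  qed
  have hom: "V \<in> hom G ?K"
  proof (rule homI)
    show "V g \<in> carrier ?K" if "g \<in> carrier G" for g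
      unfolding V_def by (rule K.finprod_closed[OF Vc[OF that]])
    fix g h assume g: "g \<in> carrier G" and h: "h \<in> carrier G"
    have F: "(\<lambda>t. \<pi> (\<rho> (t \<otimes> g) \<otimes> h)) \<in> T \<rightarrow> carrier ?K"
      using dec(1)[OF tg[OF dec(2)[OF tg[OF _ g]] h]] by simp
    have "V (g \<otimes> h) = finprod ?K (\<lambda>t. \<pi> (t \<otimes> g) \<otimes>\<^bsub>?K\<^esub> \<pi> (\<rho> (t \<otimes> g) \<otimes> h)) T"
      unfolding V_def
    proof (rule K.finprod_cong'[OF refl])
      show "(\<lambda>t. \<pi> (t \<otimes> g) \<otimes>\<^bsub>?K\<^esub> \<pi> (\<rho> (t \<otimes> g) \<otimes> h)) \<in> T \<rightarrow> carrier ?K"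
        using Vc[OF g] F by (auto simp: Pi_iff)
      fix t assume t: "t \<in> T"
      have "t \<otimes> (g \<otimes> h) = t \<otimes> g \<otimes> h"
        using t Tc g h by (metis m_assoc subsetD)
      then show "\<pi> (t \<otimes> (g \<otimes> h)) = \<pi> (t \<otimes> g) \<otimes>\<^bsub>?K\<^esub> \<pi> (\<rho> (t \<otimes> g) \<otimes> h)"
        using step(1)[OF tg[OF t g] h] by simp
    qed
    also have "\<dots> = V g \<otimes>\<^bsub>?K\<^esub> finprod ?K (\<lambda>t. \<pi> (\<rho> (t \<otimes> g) \<otimes> h)) T"
      unfolding V_def by (rule K.finprod_multf[OF Vc[OF g] F])
    also have "finprod ?K (\<lambda>t. \<pi> (\<rho> (t \<otimes> g) \<otimes> h)) T = V h"
      using K.finprod_reindex[of "\<lambda>t. \<pi> (t \<otimes> h)" "\<lambda>t. \<rho> (t \<otimes> g)" T] Vc[OF h] perm[OF g]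
      by (simp add: V_def)
    finally show "V (g \<otimes> h) = V g \<otimes>\<^bsub>?K\<^esub> V h" .
  qed
  have pw: "u [^]\<^bsub>?K\<^esub> (n::nat) = u [^] n" for u n
    by (rule nat_pow_consistent[symmetric])
  have ker: "z = \<one>" if z: "z \<in> P" and Vz: "V z = \<one>" for z
  proof -
    have zc: "z \<in> carrier G" using z by simp
    define s where "s t = \<rho> (t \<otimes> z)" for t
    define E where "E = {t \<in> T. s t \<noteq> t}"
    have spow: "(s ^^ n) t = \<rho> (t \<otimes> z [^] n)" if "t \<in> T" for n t
    proof (induction n)
      case 0
      then show ?case using T1(1)[OF that] that Tc by (auto simp: subset_iff)
    next
      case (Suc n)
      have "t \<otimes> z [^] Suc n = t \<otimes> z [^] n \<otimes> z"
        using that Tc zc by (metis m_assoc nat_pow_Suc nat_pow_closed subsetD)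
      then show ?case
        using step(2)[OF tg[OF that nat_pow_closed[OF zc]] zc, of n] Suc by (simp add: s_def)
    qed
    have sp: "(s ^^ p) t = t" if "t \<in> T" for t
      using spow[OF that, of p] exp[OF z] T1(1)[OF that] that Tc by (auto simp: subset_iff)
    have sT: "s t \<in> T" if "t \<in> T" for t
      unfolding s_def by (rule dec(2)[OF tg[OF that zc]])
    have sE: "s t \<in> E" if "t \<in> E" for t
    proof -
      have "s (s t) \<noteq> s t"
        using that sT perm(2)[OF zc] unfolding E_def s_def inj_on_def by blast
      then show ?thesis
        using that sT unfolding E_def by blast
    qed
    \<comment> \<open>The factors telescope along an orbit. For n = p the right-hand side is the
      \<open>P\<close>-part of t, which is 1.\<close>
    have prod: "finprod ?K (\<lambda>i. \<pi> ((s ^^ i) t \<otimes> z)) {..<n} = \<pi> (t \<otimes> z [^] n)" if "t \<in> T" for t n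
    proof (induction n)
      case 0
      then show ?case using T1(2)[OF that] that Tc by (auto simp: subset_iff)
    next
      case (Suc n)
      have c: "\<pi> ((s ^^ i) t \<otimes> z) \<in> P" for i
        unfolding spow[OF that] using dec(1,2) tg that zc by simp
      have "t \<otimes> z [^] Suc n = t \<otimes> z [^] n \<otimes> z"
        using that Tc zc by (metis m_assoc nat_pow_Suc nat_pow_closed subsetD)
      then have "\<pi> (t \<otimes> z [^] Suc n) = \<pi> (t \<otimes> z [^] n) \<otimes> \<pi> ((s ^^ n) t \<otimes> z)"
        using step(1)[OF tg[OF that nat_pow_closed[OF zc]] zc, of n] spow[OF that] by simp
      moreover have "finprod ?K (\<lambda>i. \<pi> ((s ^^ i) t \<otimes> z)) {..<Suc n} =
          \<pi> ((s ^^ n) t \<otimes> z) \<otimes>\<^bsub>?K\<^esub> finprod ?K (\<lambda>i. \<pi> ((s ^^ i) t \<otimes> z)) {..<n}"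
        unfolding lessThan_Suc using c by (intro K.finprod_insert) auto
      ultimately show ?case
        using Suc comm[OF c dec(1)[OF tg[OF that nat_pow_closed[OF zc]]]] by simp
    qed
    have "p dvd card E \<and> finprod ?K (\<lambda>t. \<pi> (t \<otimes> z)) E = \<one>\<^bsub>?K\<^esub>"
    proof (rule K.finprod_prime_orbits[OF _ p, where s = s])
      show "finite E" using finT unfolding E_def by simp
      show "(\<lambda>t. \<pi> (t \<otimes> z)) \<in> E \<rightarrow> carrier ?K"
        using Vc[OF zc] unfolding E_def by auto
      show "finprod ?K (\<lambda>i. \<pi> ((s ^^ i) t \<otimes> z)) {..<p} = \<one>\<^bsub>?K\<^esub>" if "t \<in> E" for t
      proof -
        have t: "t \<in> T" "t \<in> carrier G" using that Tc unfolding E_def by auto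
        show ?thesis
          unfolding prod[OF t(1)] exp[OF z] using t T1(2)[OF t(1)] by simp
      qed
    qed (use sE sp in \<open>auto simp: E_def\<close>)
    then have E: "p dvd card E" "finprod ?K (\<lambda>t. \<pi> (t \<otimes> z)) E = \<one>"
      by simp_all
    have fixed: "\<pi> (t \<otimes> z) = z" if "t \<in> T - E" for t
    proof -
      have t: "t \<in> T" "t \<in> carrier G" "\<rho> (t \<otimes> z) = t"
        using that Tc unfolding E_def s_def by auto
      have "t \<otimes> z = \<pi> (t \<otimes> z) \<otimes> t"
        using dec(3)[OF tg[OF t(1) zc]] t(3) by simp
      then have e: "t \<otimes> z \<otimes> inv t = \<pi> (t \<otimes> z)"
        using conj_eq_iff_commute[OF t(2) zc] dec(1)[OF tg[OF t(1) zc]] by simp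
      have tzP: "t \<otimes> z \<otimes> inv t \<in> P"
        unfolding e by (rule dec(1)[OF tg[OF t(1) zc]])
      have "t \<otimes> z \<otimes> inv t = z"
        by (rule burnside_fusion[OF fin p P comm NC t(2) z tzP])
      then show ?thesis
        by (rule trans[OF e[symmetric]])
    qed
    have cT: "card (T - E) = card T - card E" "card E \<le> card T"
      using finT unfolding E_def by (auto intro!: card_Diff_subset card_mono)
    have "V z = finprod ?K (\<lambda>t. \<pi> (t \<otimes> z)) (E \<union> (T - E))"
      unfolding V_def by (rule arg_cong[where f = "finprod ?K _"]) (auto simp: E_def)
    also have "\<dots> = finprod ?K (\<lambda>t. \<pi> (t \<otimes> z)) E \<otimes>\<^bsub>?K\<^esub> finprod ?K (\<lambda>t. \<pi> (t \<otimes> z)) (T - E)"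
      using finT Vc[OF zc] by (intro K.finprod_Un_disjoint) (auto simp: E_def)
    also have "finprod ?K (\<lambda>t. \<pi> (t \<otimes> z)) (T - E) = finprod ?K (\<lambda>t. z) (T - E)"
      using fixed z by (intro K.finprod_cong') auto
    also have "\<dots> = z [^]\<^bsub>?K\<^esub> card (T - E)"
      by (rule K.finprod_const) (use z in simp)
    finally have "z [^] card (T - E) = \<one>"
      using E(2) Vz pw zc by simp
    moreover have "order G = card P * card T"
      using bij_betw_same_card[OF bij] by (simp add: card_cartesian_product order_def)
    then have "card T = order G div card P"
      using P.finite_imp_card_positive[OF fin] by simp
    then have "\<not> p dvd card (T - E)"
      using P(3) E(1) cT by (metis dvd_diffD)
    moreover have "ord z dvd p"
      using exp[OF z] pow_eq_id[OF zc] by blast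
    then have "ord z = 1 \<or> ord z = p"
      using p by (simp add: prime_nat_iff)
    ultimately show ?thesis
      using pow_eq_id[OF zc] ord_eq_1[OF zc] by auto
  qed
  have "inj_on V P"
  proof (rule inj_onI)
    fix u v assume uv: "u \<in> P" "v \<in> P" "V u = V v"
    interpret V: group_hom G ?K V
      using hom by (auto simp: group_hom_def group_hom_axioms_def)
    have "V (u \<otimes> inv v) = V u \<otimes>\<^bsub>?K\<^esub> inv\<^bsub>?K\<^esub> (V v)"
      using uv V.hom_inv[of v] by simp
    also have "\<dots> = \<one>"
      using uv(3) V.hom_closed[of v] uv(2) K.r_inv[of "V v"] by simp
    finally have "u \<otimes> inv v = \<one>"
      using ker[of "u \<otimes> inv v"] uv by simp
    then show "u = v"
      using uv inv_solve_right'[of \<one> u v] by simp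
  qed
  then show ?thesis
    using hom that by blast
qed

end

section \<open>CI-groups with the k-if property are abelian\<close>

text \<open>For a prime p these are the elements of order exactly p; the identity is left out so
  that divisibility for characteristic subsets of \<open>carrier G - {\<one>}\<close>
  applies.\<close>

definition (in group) prime_torsion :: "nat \<Rightarrow> 'a set" where
  "prime_torsion p = {x \<in> carrier G. x [^] p = \<one> \<and> x \<noteq> \<one>}"

context group
begin

lemma prime_torsion_auto:
  assumes fin: "finite (carrier G)" and \<alpha>: "\<alpha> \<in> auto G"
  shows "\<alpha> ` prime_torsion p = prime_torsion p"
proof (rule card_subset_eq)
  show "finite (prime_torsion p)"
    using fin by (simp add: prime_torsion_def)
  show "\<alpha> ` prime_torsion p \<subseteq> prime_torsion p"
  proof (rule image_subsetI)
    fix x assume "x \<in> prime_torsion p"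
    then have x: "x \<in> carrier G" "x [^] p = \<one>" "x \<noteq> \<one>"
      by (simp_all add: prime_torsion_def)
    have "\<alpha> x [^] p = \<one>"
      using autoD_group(5)[OF \<alpha> x(1), of p] x(2) autoD_group(2)[OF \<alpha>] by simp
    then show "\<alpha> x \<in> prime_torsion p"
      using autoD_group(1)[OF \<alpha> x(1)] auto_one_iff[OF \<alpha> x(1)] x(3) by (simp add: prime_torsion_def)
  qed
  show "card (\<alpha> ` prime_torsion p) = card (prime_torsion p)"
    by (rule autoD_group(8)[OF \<alpha>]) (auto simp: prime_torsion_def)
qed

lemma prime_torsion_inv: "x \<in> prime_torsion p \<Longrightarrow> inv x \<in> prime_torsion p"
  by (auto simp: prime_torsion_def nat_pow_inv)

lemma prime_ord:
  assumes "Factorial_Ring.prime (p::nat)" "x \<in> carrier G" "x [^] p = \<one>" "x \<noteq> \<one>"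
  shows "ord x = p"
  using assms pow_eq_id[OF assms(2)] ord_eq_1[OF assms(2)] by (metis prime_nat_iff)

lemma inv_neq_self:
  assumes p: "Factorial_Ring.prime (p::nat)" "odd p" and x: "x \<in> prime_torsion p"
  shows "inv x \<noteq> x"
proof
  assume e: "inv x = x"
  have x': "x \<in> carrier G" "x [^] p = \<one>" "x \<noteq> \<one>"
    using x by (simp_all add: prime_torsion_def)
  have "x [^] (2::nat) = \<one>"
    using e x'(1) l_inv[OF x'(1)] by (simp add: numeral_2_eq_2)
  then have "p dvd 2"
    using pow_eq_id[OF x'(1)] prime_ord[OF p(1) x'] by blast
  then have "p = 2"
    using primes_dvd_imp_eq[OF p(1) two_is_prime_nat] by blast
  then show False
    using p(2) by simp
qed

lemma k_if_dvd_prime_torsion: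
  assumes CI: "CI_group G" and k: "k_if_property k G" and p: "Factorial_Ring.prime (p::nat)"
  shows "k dvd card (prime_torsion p)" "odd p \<Longrightarrow> 2 * k dvd card (prime_torsion p)"
proof -
  have sub: "prime_torsion p \<subseteq> carrier G - {\<one>}"
    by (auto simp: prime_torsion_def)
  note * = k_if_dvd_card[OF CI k sub prime_torsion_auto[OF CI_groupD(2)[OF CI]]]
  show "k dvd card (prime_torsion p)"
    by (rule *(1))
  show "2 * k dvd card (prime_torsion p)" if "odd p"
  proof (rule *(2))
    fix x assume x: "x \<in> prime_torsion p"
    show "inv x \<in> prime_torsion p \<and> inv x \<noteq> x"
      using prime_torsion_inv[OF x] inv_neq_self[OF p that x] by blast
  qed
qed

section \<open>Conjugacy classes of elements of prime order\<close>

lemma card_conj_class_dvd: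
  assumes z: "z \<in> carrier G"
  shows "card ((\<lambda>g. g \<otimes> z \<otimes> inv g) ` carrier G) dvd order G"
proof -
  interpret C: group_action G "carrier G" "\<lambda>g. \<lambda>h \<in> carrier G. g \<otimes> h \<otimes> inv g"
    by (rule action_by_conjugation)
  have e: "orbit G (\<lambda>g. \<lambda>h \<in> carrier G. g \<otimes> h \<otimes> inv g) z = (\<lambda>g. g \<otimes> z \<otimes> inv g) ` carrier G"
    using z unfolding orbit_def by auto
  show ?thesis
    using C.orbit_stabilizer_theorem[OF z] unfolding e by (rule dvdI[OF sym])
qed

text \<open>A single class of elements of order \<open>p\<close> (up to inversion) has size dividing \<open>|G|\<close>, which is
  prime to \<open>k\<close>, while \<open>k\<close> divides it.\<close>

lemma k_if_several_classes:
  assumes CI: "CI_group G" and k: "k_if_property k G" "2 \<le> k" and p: "Factorial_Ring.prime (p::nat)"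
    and z: "z \<in> prime_torsion p"
  obtains x where "x \<in> prime_torsion p"
    "\<And>g. g \<in> carrier G \<Longrightarrow> x \<noteq> g \<otimes> z \<otimes> inv g \<and> x \<noteq> inv (g \<otimes> z \<otimes> inv g)"
proof (rule ccontr)
  assume no: "\<not> thesis"
  have fin: "finite (carrier G)"
    by (rule CI_groupD[OF CI])
  have zc: "z \<in> carrier G" "z [^] p = \<one>" "z \<noteq> \<one>"
    using z by (simp_all add: prime_torsion_def)
  define Cl where "Cl = (\<lambda>g. g \<otimes> z \<otimes> inv g) ` carrier G"
  have Oc: "Cl \<subseteq> carrier G" and finO: "finite Cl"
    using zc fin by (auto simp: Cl_def)
  have conj_pow: "(g \<otimes> z \<otimes> inv g) [^] (n::nat) = g \<otimes> z [^] n \<otimes> inv g" if "g \<in> carrier G" for g n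
  proof (induction n)
    case (Suc n)
    then show ?case using that zc(1) by (simp add: m_assoc)
  qed (use that in simp)
  have OX: "Cl \<subseteq> prime_torsion p"
  proof
    fix x assume "x \<in> Cl"
    then obtain g where g: "g \<in> carrier G" "x = g \<otimes> z \<otimes> inv g"
      unfolding Cl_def by blast
    have "x \<noteq> \<one>"
      using conj_eq_iff_commute[OF g(1) zc(1) one_closed] g zc by auto
    then show "x \<in> prime_torsion p"
      using g conj_pow[OF g(1), of p] zc by (simp add: prime_torsion_def)
  qed
  have X: "prime_torsion p = Cl \<union> m_inv G ` Cl"
  proof
    show "Cl \<union> m_inv G ` Cl \<subseteq> prime_torsion p"
      using OX prime_torsion_inv by blast
    show "prime_torsion p \<subseteq> Cl \<union> m_inv G ` Cl"
      using no that unfolding Cl_def by blast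
  qed
  have cO: "card Cl dvd order G"
    unfolding Cl_def by (rule card_conj_class_dvd[OF zc(1)])
  \<comment> \<open>If z is conjugate to its inverse, the class contains all elements of order p and
    k divides its size. Otherwise the class and its inverse are disjoint, p is odd, and the factor 2
    cancels: 2 k divides twice the size of the class.\<close>
  have "k dvd card Cl"
  proof (cases "inv z \<in> Cl")
    case True
    then obtain h where h: "h \<in> carrier G" "inv z = h \<otimes> z \<otimes> inv h"
      unfolding Cl_def by blast
    have "m_inv G ` Cl \<subseteq> Cl"
    proof (rule image_subsetI)
      fix x assume "x \<in> Cl"
      then obtain g where g: "g \<in> carrier G" "x = g \<otimes> z \<otimes> inv g"
        unfolding Cl_def by blast
      have "inv x = g \<otimes> inv z \<otimes> inv g"
        using g zc by (simp add: inv_mult_group m_assoc)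
      also have "\<dots> = (g \<otimes> h) \<otimes> z \<otimes> inv (g \<otimes> h)"
        unfolding h(2) using g h(1) zc by (simp add: inv_mult_group m_assoc)
      finally show "inv x \<in> Cl"
        using g h unfolding Cl_def by blast
    qed
    then have "prime_torsion p = Cl"
      using X by blast
    then show ?thesis
      using k_if_dvd_prime_torsion(1)[OF CI k(1) p] by simp
  next
    case False
    have "Cl \<inter> m_inv G ` Cl = {}"
    proof (rule ccontr)
      assume "Cl \<inter> m_inv G ` Cl \<noteq> {}"
      then obtain g h where gh: "g \<in> carrier G" "h \<in> carrier G" "g \<otimes> z \<otimes> inv g = inv (h \<otimes> z \<otimes> inv h)"
        unfolding Cl_def by blast
      have "inv z = inv h \<otimes> inv (h \<otimes> z \<otimes> inv h) \<otimes> h"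
        using gh zc by (simp add: inv_mult_group m_assoc)
      also have "\<dots> = (inv h \<otimes> g) \<otimes> z \<otimes> inv (inv h \<otimes> g)"
        unfolding gh(3)[symmetric] using gh(1,2) zc by (simp add: inv_mult_group m_assoc)
      finally show False
        using False gh unfolding Cl_def by blast
    qed
    moreover have "card (m_inv G ` Cl) = card Cl"
      using inv_inj Oc inj_on_subset by (intro card_image) blast
    ultimately have card: "card (prime_torsion p) = 2 * card Cl"
      unfolding X using finO by (simp add: card_Un_disjoint)
    have "odd p"
    proof (rule ccontr)
      assume "\<not> odd p"
      then have "p = 2"
        using p prime_odd_nat prime_ge_2_nat by (metis le_neq_implies_less)
      then have "inv z = z"
        using zc by (intro inv_equality) (simp_all add: numeral_2_eq_2)
      moreover have "z \<in> Cl"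
        using zc unfolding Cl_def by (intro image_eqI[of _ _ \<one>]) auto
      ultimately show False
        using False by simp
    qed
    then show ?thesis
      using k_if_dvd_prime_torsion(2)[OF CI k(1) p] card by simp
  qed
  then have "k dvd 1"
    using cO k_if_coprime_order[OF CI k(1)] by (metis coprime_common_divisor dvd_refl dvd_trans)
  then show False
    using k(2) by simp
qed

text \<open>\<open>P\<close> acts by conjugation on \<open>P - {\<one>}\<close>, a set of p^a - 1
  elements; a fixed point is central in \<open>P\<close>, and a suitable power of it has order
  p.\<close>

lemma pgroup_center:
  assumes P: "subgroup P G" "card P = p ^ a" "0 < a" and p: "Factorial_Ring.prime (p::nat)"
  obtains z where "z \<in> P" "z \<in> prime_torsion p" "\<And>u. u \<in> P \<Longrightarrow> u \<otimes> z = z \<otimes> u"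
proof -
  interpret P: subgroup P G by fact
  let ?K = "G\<lparr>carrier := P\<rparr>"
  have K: "group ?K"
    by (rule P.subgroup_is_group[OF is_group])
  have finP: "finite P"
    using P(2,3) p by (metis card.infinite power_eq_0_iff prime_gt_0_nat less_irrefl)
  have act: "group_action ?K (P - {\<one>}) (\<lambda>g. restrict ((\<lambda>g x. g \<otimes> x \<otimes> inv g) g) (P - {\<one>}))"
  proof (rule group_actionI[OF K])
    show "g \<otimes> x \<otimes> inv g \<in> P - {\<one>}" if "g \<in> carrier ?K" "x \<in> P - {\<one>}" for g x
      using that conj_eq_iff_commute[of g x \<one>] by auto
    show "g \<otimes>\<^bsub>?K\<^esub> h \<otimes> x \<otimes> inv (g \<otimes>\<^bsub>?K\<^esub> h) = g \<otimes> (h \<otimes> x \<otimes> inv h) \<otimes> inv g"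
      if "g \<in> carrier ?K" "h \<in> carrier ?K" "x \<in> P - {\<one>}" for g h x
      using that by (simp add: inv_mult_group m_assoc)
  qed auto
  have "p dvd card P"
    using P(2,3) by (simp add: dvd_power)
  moreover have "P \<noteq> {}"
    using P.one_closed by blast
  then have "card (P - {\<one>}) = card P - 1" "card P > 0"
    using finP by (simp_all add: card_gt_0_iff)
  ultimately have "\<not> p dvd card (P - {\<one>})"
    using prime_gt_1_nat[OF p] by (metis Suc_pred' dvd_add_right_iff nat_dvd_1_iff_1 less_irrefl plus_1_eq_Suc add.commute)
  then obtain c where c: "c \<in> P - {\<one>}"
    "\<And>g. g \<in> carrier ?K \<Longrightarrow> restrict (\<lambda>x. g \<otimes> x \<otimes> inv g) (P - {\<one>}) c = c"
    using group_action.pgroup_fixed_point[OF act p, of a] P(2) finP by (auto simp: order_def)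
  have comm: "u \<otimes> c = c \<otimes> u" if "u \<in> P" for u
    using c(1) c(2)[of u] that conj_eq_iff_commute[of u c c] by auto
  have cc: "c \<in> carrier G" "c \<noteq> \<one>"
    using c(1) by auto
  have "c [^] (p ^ a) = \<one>"
    using group.pow_order_eq_1[OF K, of c] c(1) P(2)
    by (simp add: order_def flip: nat_pow_consistent)
  then have "ord c dvd p ^ a"
    using pow_eq_id[OF cc(1)] by blast
  then obtain i where i: "ord c = p ^ i"
    using divides_primepow_nat[OF p] by blast
  have "i \<noteq> 0"
    using i cc ord_eq_1[OF cc(1)] by (metis power_0)
  then obtain j where j: "i = Suc j"
    using not0_implies_Suc by blast
  let ?z = "c [^] (p ^ j)"
  have "ord ?z = p"
    using ord_pow[OF cc(1), of "p ^ j"] i j prime_gt_0_nat[OF p] by simp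
  moreover have zc: "?z \<in> carrier G"
    using cc by simp
  ultimately have "?z \<in> prime_torsion p"
    using pow_ord_eq_1[OF zc] ord_eq_1[OF zc] prime_gt_1_nat[OF p] by (auto simp: prime_torsion_def)
  moreover have "?z \<in> P"
    using subgroup_nat_pow[OF P(1)] c(1) by blast
  moreover have "u \<otimes> ?z = ?z \<otimes> u" if "u \<in> P" for u
    using group_commutes_pow[of c u "p ^ j"] comm[OF that] cc(1) that by simp
  ultimately show ?thesis
    using that by blast
qed

section \<open>Rank, exponent and commutativity of Sylow subgroups\<close>

lemma ex_sylow:
  assumes fin: "finite (carrier G)" and p: "Factorial_Ring.prime (p::nat)"
  obtains P where "subgroup P G" "card P = p ^ multiplicity p (order G)" "\<not> p dvd order G div card P"
proof -
  have pos: "order G \<noteq> 0"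
    using fin order_gt_0_iff_finite by simp
  let ?a = "multiplicity p (order G)"
  obtain m where m: "order G = p ^ ?a * m" "\<not> p dvd m"
    using multiplicity_decompose'[OF pos, of p] p by (metis not_prime_unit)
  obtain P where P: "subgroup P G" "card P = p ^ ?a"
    using sylow_thm[OF p is_group m(1) fin] by blast
  have "order G div card P = m"
    using m(1) P(2) p by (metis nonzero_mult_div_cancel_left power_not_zero not_prime_0)
  then show ?thesis
    using P m(2) that by blast
qed

lemma subgroup_adjoin_adjoin:
  assumes p: "Factorial_Ring.prime (p::nat)" and q: "Factorial_Ring.prime (q::nat)"
    and x: "x \<in> carrier G" "x [^] q = \<one>" "x \<noteq> \<one>"
    and y: "y \<in> carrier G" "y [^] p = \<one>" "y \<notin> adjoin {\<one>} x" "y \<otimes> x \<otimes> inv y \<in> adjoin {\<one>} x"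
  shows "subgroup (adjoin (adjoin {\<one>} x) y) G" "card (adjoin (adjoin {\<one>} x) y) = q * p"
    "x \<in> adjoin (adjoin {\<one>} x) y" "y \<in> adjoin (adjoin {\<one>} x) y"
proof -
  let ?A = "adjoin {\<one>} x"
  note A = cyclic_prime_subgroup[OF q x]
  have norm: "y \<otimes> a \<otimes> inv y \<in> ?A" if aA: "a \<in> ?A" for a
  proof -
    obtain n where n: "a = x [^] (n::nat)"
      using aA unfolding adjoin_one_eq[OF x(1)] by blast
    have "y \<otimes> x [^] m \<otimes> inv y = (y \<otimes> x \<otimes> inv y) [^] m" for m :: nat
    proof (induction m)
      case (Suc m)
      have "y \<otimes> x [^] Suc m \<otimes> inv y = (y \<otimes> x [^] m \<otimes> inv y) \<otimes> (y \<otimes> x \<otimes> inv y)"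
        using x(1) y(1) by (simp add: m_assoc)
      then show ?case using Suc by simp
    qed (use y(1) in simp)
    then show ?thesis
      unfolding n using subgroup_nat_pow[OF A(1) y(4)] by simp
  qed
  show "subgroup (adjoin ?A y) G"
    by (rule adjoin_subgroup[OF A(1) y(1,2) prime_gt_0_nat[OF p] norm])
  show "card (adjoin ?A y) = q * p"
    using card_adjoin[OF A(1) y(1-3) p] A(2) by simp
  show "x \<in> adjoin ?A y"
    using subset_adjoin[OF subgroup.subset[OF A(1)]] mem_adjoin[OF triv_subgroup x(1)] by blast
  show "y \<in> adjoin ?A y"
    by (rule mem_adjoin[OF A(1) y(1)])
qed

text \<open>Take z of order p central in a Sylow subgroup \<open>P\<close>, and x of order p not
  conjugate to z or z^-1, with a conjugate w of x in \<open>P\<close>. For p \<le> 3 the group <z>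
  has no elements besides 1, z and z^-1, so it misses w, and the commuting elements z and w span
  \<open>B\<close>.\<close>

lemma k_if_rank_two:
  assumes CI: "CI_group G" and k: "k_if_property k G" "2 \<le> k" and p: "Factorial_Ring.prime (p::nat)" "p \<le> 3"
    and dvd: "p dvd order G"
  obtains B where "subgroup B G" "card B = p ^ 2" "\<And>b. b \<in> B \<Longrightarrow> b [^] p = \<one>"
proof -
  have fin: "finite (carrier G)"
    by (rule CI_groupD[OF CI])
  have pos: "order G \<noteq> 0"
    using fin order_gt_0_iff_finite by simp
  obtain P where P: "subgroup P G" "card P = p ^ multiplicity p (order G)" "\<not> p dvd order G div card P"
    using ex_sylow[OF fin p(1)] by blast
  have "0 < multiplicity p (order G)"
    using dvd pos p(1) by (simp add: prime_multiplicity_gt_zero_iff prime_imp_prime_elem)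
  then obtain z where z: "z \<in> P" "z \<in> prime_torsion p" "\<And>u. u \<in> P \<Longrightarrow> u \<otimes> z = z \<otimes> u"
    using pgroup_center[OF P(1,2) _ p(1)] by blast
  have zc: "z \<in> carrier G" "z [^] p = \<one>" "z \<noteq> \<one>"
    using z(2) by (simp_all add: prime_torsion_def)
  obtain x where x: "x \<in> prime_torsion p"
    "\<And>g. g \<in> carrier G \<Longrightarrow> x \<noteq> g \<otimes> z \<otimes> inv g \<and> x \<noteq> inv (g \<otimes> z \<otimes> inv g)"
    using k_if_several_classes[OF CI k p(1) z(2)] by blast
  have xc: "x \<in> carrier G" "x [^] p = \<one>" "x \<noteq> \<one>"
    using x(1) by (simp_all add: prime_torsion_def)
  obtain c where c: "c \<in> carrier G" "\<And>u. u \<in> adjoin {\<one>} x \<Longrightarrow> c \<otimes> u \<otimes> inv c \<in> P"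
    using sylow_conj_subset[OF fin p(1) P(1,3) cyclic_prime_subgroup(1)[OF p(1) xc], of 1]
      cyclic_prime_subgroup(2)[OF p(1) xc] by auto
  define w where "w = c \<otimes> x \<otimes> inv c"
  have wP: "w \<in> P"
    unfolding w_def by (rule c(2)[OF mem_adjoin[OF triv_subgroup xc(1)]])
  have x_eq: "x = inv c \<otimes> w \<otimes> c"
    using c(1) xc(1) by (simp add: w_def m_assoc)
  have wc: "w \<in> carrier G"
    using c(1) xc(1) by (simp add: w_def)
  have w_pow: "w [^] (n::nat) = c \<otimes> x [^] n \<otimes> inv c" for n
  proof (induction n)
    case (Suc n)
    then show ?case using c(1) xc(1) by (simp add: w_def m_assoc)
  qed (use c(1) in simp)
  have wp: "w [^] p = \<one>"
    unfolding w_pow using xc(2) c(1) by simp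
  have wne: "w \<noteq> z" "w \<noteq> inv z" "w \<noteq> \<one>"
    using x(2)[of "inv c"] c(1) x_eq zc xc(3) by (auto simp: inv_mult_group m_assoc)
  have "adjoin {\<one>} z \<subseteq> {\<one>, z, inv z}"
  proof
    fix a assume "a \<in> adjoin {\<one>} z"
    then obtain n where "a = z [^] n" "n < p"
      unfolding adjoin_eq_image[OF triv_subgroup zc(1,2) p(1)] using zc(1) by auto
    moreover from this(2) have "n = 0 \<or> n = 1 \<or> (p = 3 \<and> n = 2)"
      using p(2) by arith
    ultimately have "a = z [^] (0::nat) \<or> a = z [^] (1::nat) \<or> (p = 3 \<and> a = z [^] (2::nat))"
      by blast
    moreover have "z [^] (2::nat) = inv z" if "p = 3"
      using zc that by (intro inv_equality[symmetric]) (simp_all add: numeral_3_eq_3 numeral_2_eq_2)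
    ultimately show "a \<in> {\<one>, z, inv z}"
      using zc(1) by auto
  qed
  then have wn: "w \<notin> adjoin {\<one>} z"
    using wne by blast
  have wzw: "w \<otimes> z \<otimes> inv w = z"
    using conj_eq_iff_commute[OF wc zc(1) zc(1)] z(3)[OF wP] by blast
  let ?B = "adjoin (adjoin {\<one>} z) w"
  have wzA: "w \<otimes> z \<otimes> inv w \<in> adjoin {\<one>} z"
    unfolding wzw by (rule mem_adjoin[OF triv_subgroup zc(1)])
  note B = subgroup_adjoin_adjoin[OF p(1) p(1) zc wc wp wn wzA]
  have "b [^] p = \<one>" if b: "b \<in> ?B" for b
  proof -
    obtain a i where ai: "a \<in> adjoin {\<one>} z" "b = a \<otimes> w [^] (i::nat)"
      using b by (rule adjoinE)
    obtain n where n: "a = z [^] (n::nat)"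
      using ai(1) unfolding adjoin_one_eq[OF zc(1)] by blast
    have "w \<otimes> z = z \<otimes> w"
      by (rule z(3)[OF wP])
    then have "w [^] i \<otimes> z = z \<otimes> w [^] i"
      using group_commutes_pow[OF _ wc zc(1)] by blast
    then have "z [^] n \<otimes> w [^] i = w [^] i \<otimes> z [^] n"
      using group_commutes_pow[of z "w [^] i" n] zc(1) wc by simp
    then have "b [^] p = (z [^] n) [^] p \<otimes> (w [^] i) [^] p"
      unfolding ai(2) n using zc(1) wc by (intro pow_mult_distrib) auto
    moreover have "(z [^] n) [^] p = (z [^] p) [^] n" "(w [^] i) [^] p = (w [^] p) [^] i"
      using zc(1) wc by (simp_all add: nat_pow_pow mult.commute)
    ultimately show ?thesis
      using zc(2) wp by simp
  qed
  then show ?thesis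
    using that B(1,2) by (simp add: power2_eq_square)
qed

text \<open>An element of order p^2 forces p \<le> 3, and then there are two subgroups of order p^2,
  one of exponent p and one cyclic. The CI property would make one the image of the other under an
  automorphism.\<close>

lemma k_if_no_prime_square:
  assumes CI: "CI_group G" and k: "k_if_property k G" "2 \<le> k" and p: "Factorial_Ring.prime (p::nat)"
    and x: "x \<in> carrier G"
  shows "ord x \<noteq> p ^ 2"
proof
  assume o: "ord x = p ^ 2"
  have fin: "finite (carrier G)"
    by (rule CI_groupD[OF CI])
  have "p dvd order G"
    using ord_dvd_group_order[OF x] unfolding o by (metis dvd_trans dvd_triv_left power2_eq_square)
  then obtain B where B: "subgroup B G" "card B = p ^ 2" "\<And>b. b \<in> B \<Longrightarrow> b [^] p = \<one>"
    using k_if_rank_two[OF CI k p CI_no_prime_square[OF CI p x o]] by blast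
  have C: "subgroup (generate G {x}) G"
    using x by (intro generate_is_subgroup) auto
  have "card (generate G {x}) = p ^ 2"
    using generate_pow_card[OF x] o by simp
  then obtain \<alpha> where \<alpha>: "\<alpha> \<in> auto G" "\<alpha> ` B = generate G {x}"
    using CI_conj_subgroups[OF CI B(1) C] B(2) by metis
  have "x \<in> generate G {x}"
    by (rule generate.incl) simp
  then obtain b where b: "b \<in> B" "x = \<alpha> b"
    using \<alpha>(2) by blast
  have "x [^] p = \<alpha> (b [^] p)"
    unfolding b(2) using autoD_group(5)[OF \<alpha>(1) subgroup.mem_carrier[OF B(1) b(1)]] by simp
  then have "x [^] p = \<one>"
    using B(3)[OF b(1)] autoD_group(2)[OF \<alpha>(1)] by simp
  then have "p ^ 2 dvd p ^ 1"
    using pow_eq_id[OF x] o by simp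
  then show False
    using prime_gt_1_nat[OF p] power_dvd_imp_le[of p 2 1] by simp
qed

text \<open>An element of order p^i with i \<ge> 2 would have a power of order p^2.\<close>

lemma prime_power_exponent:
  assumes sq: "\<And>x. x \<in> carrier G \<Longrightarrow> ord x \<noteq> p ^ 2" and p: "Factorial_Ring.prime (p::nat)"
    and u: "u \<in> carrier G" "u [^] (p ^ a) = \<one>"
  shows "u [^] p = \<one>"
proof -
  have "ord u dvd p ^ a"
    using pow_eq_id[OF u(1)] u(2) by blast
  then obtain i where i: "ord u = p ^ i"
    using divides_primepow_nat[OF p] by blast
  have "\<not> i \<ge> 2"
  proof
    assume "i \<ge> 2"
    then obtain j where j: "i = j + 2"
      by (metis add.commute le_Suc_ex)
    have "ord (u [^] (p ^ j)) = p ^ 2"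
      using ord_pow[OF u(1), of "p ^ j"] prime_gt_0_nat[OF p] by (simp add: i j power_add power2_eq_square)
    then show False
      using sq[of "u [^] (p ^ j)"] u(1) by simp
  qed
  then have "p ^ i dvd p ^ 1"
    by (intro le_imp_power_dvd) simp
  then show ?thesis
    using pow_eq_id[OF u(1)] i by simp
qed

text \<open>A nontrivial \<open>P\<close> is CI and has a central element of order p. Up to
  inversion every nontrivial element of \<open>P\<close> is an automorphic image of it, hence
  central too.\<close>

lemma CI_sylow_abelian:
  assumes CI: "CI_group G" and P: "subgroup P G" "card P = p ^ a" and p: "Factorial_Ring.prime (p::nat)"
    and exp: "\<And>u. u \<in> P \<Longrightarrow> u [^] p = \<one>" and uv: "u \<in> P" "v \<in> P"
  shows "u \<otimes> v = v \<otimes> u"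
proof (cases "a = 0 \<or> u = \<one>")
  case True
  interpret P: subgroup P G by fact
  have "P = {\<one>}" if "a = 0"
  proof -
    have "card P = 1"
      using P(2) that by simp
    then obtain x where "P = {x}"
      by (rule card_1_singletonE)
    then show ?thesis
      using P.one_closed by blast
  qed
  then show ?thesis
    using True uv by auto
next
  case False
  interpret P: subgroup P G by fact
  let ?K = "G\<lparr>carrier := P\<rparr>"
  have CK: "CI_group ?K"
    by (rule CI_subgroup[OF CI P(1)])
  interpret K: group ?K
    by (rule CI_groupD[OF CK])
  obtain z where z: "z \<in> P" "z \<in> prime_torsion p" "\<And>u. u \<in> P \<Longrightarrow> u \<otimes> z = z \<otimes> u"
    using pgroup_center[OF P _ p] False by blast
  have pw: "w [^]\<^bsub>?K\<^esub> (n::nat) = w [^] n" for w n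
    by (rule nat_pow_consistent[symmetric])
  have zK: "z \<in> carrier ?K" "z [^]\<^bsub>?K\<^esub> p = \<one>\<^bsub>?K\<^esub>" "z \<noteq> \<one>\<^bsub>?K\<^esub>"
    using z(1,2) pw by (simp_all add: prime_torsion_def)
  have uK: "u \<in> carrier ?K" "u [^]\<^bsub>?K\<^esub> p = \<one>\<^bsub>?K\<^esub>" "u \<noteq> \<one>\<^bsub>?K\<^esub>"
    using uv(1) exp[OF uv(1)] pw False by simp_all
  obtain \<alpha> where \<alpha>: "\<alpha> \<in> auto ?K" "\<alpha> z = u \<or> \<alpha> z = inv\<^bsub>?K\<^esub> u"
    using K.CI_conj_prime[OF CK p zK uK] by blast
  have "v \<in> \<alpha> ` P"
    using K.autoD_group(7)[OF \<alpha>(1)] uv(2) by simp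
  then obtain w where w: "w \<in> P" "v = \<alpha> w"
    by blast
  have "\<alpha> z \<otimes> v = v \<otimes> \<alpha> z"
    unfolding w(2) using K.autoD_group(3)[OF \<alpha>(1), of z w] K.autoD_group(3)[OF \<alpha>(1), of w z] z(1) w(1) z(3)[OF w(1)]
    by simp
  moreover have "inv\<^bsub>?K\<^esub> u = inv u"
    by (rule m_inv_consistent[OF P(1) uv(1)])
  ultimately have "u \<in> {g \<in> carrier G. g \<otimes> v = v \<otimes> g} \<or> inv u \<in> {g \<in> carrier G. g \<otimes> v = v \<otimes> g}"
    using \<alpha>(2) uv by auto
  then have "u \<in> {g \<in> carrier G. g \<otimes> v = v \<otimes> g}"
    using subgroup.m_inv_closed[OF centralizer_subgroup, of v "inv u"] uv by auto
  then show ?thesis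
    by simp
qed

text \<open>Take y of least order in \<open>N\<close> outside \<open>C\<close>, and let its order be
  r m with r prime. If m > 1, then y^r and y^m have smaller order and lie in \<open>C\<close>; r and
  m are coprime because order r^2 does not occur, so y itself would lie in \<open>C\<close>.\<close>

lemma ex_prime_order_outside:
  assumes fin: "finite (carrier G)" and sq: "\<And>p x. \<lbrakk>Factorial_Ring.prime (p::nat); x \<in> carrier G\<rbrakk> \<Longrightarrow> ord x \<noteq> p ^ 2"
    and C: "subgroup C G" and N: "N \<subseteq> carrier G" "\<And>g n. g \<in> N \<Longrightarrow> g [^] (n::nat) \<in> N" and g: "g \<in> N" "g \<notin> C"
  obtains y r where "y \<in> N" "y \<notin> C" "Factorial_Ring.prime r" "ord y = r"
proof -
  have "\<exists>y. y \<in> N \<and> y \<notin> C \<and> (\<forall>z. z \<in> N \<and> z \<notin> C \<longrightarrow> ord y \<le> ord z)"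
    using ex_has_least_nat[of "\<lambda>y. y \<in> N \<and> y \<notin> C" g ord] g by blast
  then obtain y where y: "y \<in> N" "y \<notin> C" and min: "\<And>z. \<lbrakk>z \<in> N; z \<notin> C\<rbrakk> \<Longrightarrow> ord y \<le> ord z"
    by blast
  have yc: "y \<in> carrier G"
    using y(1) N(1) by blast
  have "y \<noteq> \<one>"
    using y(2) subgroup.one_closed[OF C] by blast
  then have "ord y \<noteq> 1"
    using ord_eq_1[OF yc] by blast
  then obtain r where r: "Factorial_Ring.prime r" "r dvd ord y"
    using prime_factor_nat by blast
  then obtain m where m: "ord y = r * m"
    by blast
  have pos: "ord y > 0"
    using ord_ge_1[OF fin yc] by simp
  have "m = 1"
  proof (rule ccontr)
    assume "m \<noteq> 1"
    then have m1: "m > 1"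
      using pos m by (cases m) auto
    have or: "ord (y [^] r) = m" "ord (y [^] m) = r"
      using ord_pow[OF yc, of r] ord_pow[OF yc, of m] m m1 prime_gt_0_nat[OF r(1)] by auto
    have yC: "y [^] r \<in> C" "y [^] m \<in> C"
      using min[OF N(2)[OF y(1)], of r] min[OF N(2)[OF y(1)], of m] or m m1 prime_gt_1_nat[OF r(1)] pos
      by (auto simp: not_le)
    have "coprime r m"
    proof (rule ccontr)
      assume "\<not> coprime r m"
      then have "r dvd m"
        using r(1) prime_imp_coprime by blast
      then obtain n where n: "m = r * n"
        by blast
      then have "ord (y [^] n) = r ^ 2"
        using ord_pow[OF yc, of n] m m1 by (cases "n = 0") (auto simp: power2_eq_square)
      then show False
        using sq[OF r(1), of "y [^] n"] yc by simp
    qed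
    then obtain a b where ab: "a * int r + b * int m = 1"
      using bezout_int[of "int r" "int m"] by (auto simp: mult.commute)
    have "y = y [^] (a * int r + b * int m)"
      unfolding ab using yc by simp
    also have "\<dots> = (y [^] r) [^] a \<otimes> (y [^] m) [^] b"
      using yc by (simp add: int_pow_mult int_pow_pow mult.commute flip: int_pow_int)
    also have "\<dots> \<in> C"
      by (rule subgroup.m_closed[OF C subgroup_int_pow[OF C yC(1)] subgroup_int_pow[OF C yC(2)]])
    finally show False
      using y(2) by simp
  qed
  then have "ord y = r"
    using m by simp
  then show ?thesis
    using y r(1) that by blast
qed

end

text \<open>A nontrivial square root of 1 modulo a prime is -1. Nontrivial cube roots of 1 are roots
  of X^2 + X + 1, and these are s and -1 - s = s^2. Both cases exhibit t as a power of s.\<close>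

lemma cube_roots_mod_prime:
  assumes q: "Factorial_Ring.prime (q::int)" and p: "p = 2 \<or> p = (3::nat)"
    and s: "q dvd s ^ p - 1" "\<not> q dvd s - 1" and t: "q dvd t ^ p - 1" "\<not> q dvd t - 1"
  shows "q dvd t - s ^ 1 \<or> q dvd t - s ^ 2"
  using p
proof
  assume p2: "p = 2"
  have "q dvd (s - 1) * (s + 1)" "q dvd (t - 1) * (t + 1)"
    using s(1) t(1) p2 by (simp_all add: algebra_simps power2_eq_square)
  then have "q dvd s + 1" "q dvd t + 1"
    using s(2) t(2) q by (meson prime_dvd_mult_iff)+
  then have "q dvd (t + 1) - (s + 1)"
    by (rule dvd_diff[rotated])
  then show ?thesis by simp
next
  assume p3: "p = 3"
  have "q dvd (s - 1) * (s ^ 2 + s + 1)" "q dvd (t - 1) * (t ^ 2 + t + 1)"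
    using s(1) t(1) p3 by (simp_all add: algebra_simps power2_eq_square power3_eq_cube)
  then have *: "q dvd s ^ 2 + s + 1" "q dvd t ^ 2 + t + 1"
    using s(2) t(2) q by (meson prime_dvd_mult_iff)+
  then have "q dvd (t ^ 2 + t + 1) - (s ^ 2 + s + 1)"
    by (rule dvd_diff[rotated])
  moreover have "(t ^ 2 + t + 1) - (s ^ 2 + s + 1) = (t - s) * (t + s + 1)"
    by (simp add: algebra_simps power2_eq_square)
  ultimately have "q dvd t - s \<or> q dvd t + s + 1"
    using q by (simp add: prime_dvd_mult_iff)
  moreover have "q dvd t - s ^ 2" if "q dvd t + s + 1"
  proof -
    have "q dvd (t + s + 1) - (s ^ 2 + s + 1)"
      using that *(1) by (rule dvd_diff)
    then show ?thesis by simp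
  qed
  ultimately show ?thesis by auto
qed

context group
begin

text \<open>Let \<open>p\<close> be the smallest prime divisor of \<open>|G|\<close>. A nontrivial action of \<open>N(P)\<close> on \<open>P\<close> could
  only be that of an element of order \<open>3\<close> on the Klein group; then all involutions are conjugate.\<close>

lemma k_if_sylow_normalizer:
  assumes CI: "CI_group G" and k: "k_if_property k G" "2 \<le> k" and p: "Factorial_Ring.prime (p::nat)" "p dvd order G"
    and min: "\<And>r. \<lbrakk>Factorial_Ring.prime r; r dvd order G\<rbrakk> \<Longrightarrow> p \<le> r"
    and P: "subgroup P G" "card P = p ^ multiplicity p (order G)" "\<not> p dvd order G div card P"
    and g: "g \<in> carrier G" "\<And>u. u \<in> P \<Longrightarrow> g \<otimes> u \<otimes> inv g \<in> P" and z: "z \<in> P"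
  shows "g \<otimes> z = z \<otimes> g"
proof (rule ccontr)
  assume gz: "g \<otimes> z \<noteq> z \<otimes> g"
  interpret P: subgroup P G by fact
  have fin: "finite (carrier G)"
    by (rule CI_groupD[OF CI])
  have sq: "ord x \<noteq> r ^ 2" if "Factorial_Ring.prime (r::nat)" "x \<in> carrier G" for r x
    by (rule k_if_no_prime_square[OF CI k that])
  have exp: "u [^] p = \<one>" if u: "u \<in> P" for u
  proof (rule prime_power_exponent[OF sq[OF p(1)] p(1)])
    show "u \<in> carrier G" using u by simp
    have "u [^]\<^bsub>G\<lparr>carrier := P\<rparr>\<^esub> order (G\<lparr>carrier := P\<rparr>) = \<one>"
      using group.pow_order_eq_1[OF P.subgroup_is_group[OF is_group], of u] u by simp
    then show "u [^] (p ^ multiplicity p (order G)) = \<one>"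
      using P(2) by (simp add: order_def flip: nat_pow_consistent)
  qed
  have comm: "u \<otimes> v = v \<otimes> u" if "u \<in> P" "v \<in> P" for u v
    by (rule CI_sylow_abelian[OF CI P(1,2) p(1) exp that])
  have zc: "z \<in> carrier G" using z by simp
  let ?C = "{h \<in> carrier G. h \<otimes> z = z \<otimes> h}"
  have C: "subgroup ?C G"
    by (rule centralizer_subgroup[OF zc])
  let ?N = "{h \<in> carrier G. \<forall>u\<in>P. h \<otimes> u \<otimes> inv h \<in> P}"
  have N: "h [^] (n::nat) \<in> ?N" if "h \<in> ?N" for h n
    using that conj_pow_mem[OF P.subset, of h _ n] by simp
  obtain y r where y: "y \<in> ?N" "y \<notin> ?C" and r: "Factorial_Ring.prime r" "ord y = r"
    using ex_prime_order_outside[OF fin sq C _ N, of g] g gz by auto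
  have yc: "y \<in> carrier G" and yN: "\<And>u. u \<in> P \<Longrightarrow> y \<otimes> u \<otimes> inv y \<in> P" and yz: "y \<otimes> z \<noteq> z \<otimes> y"
    using y by auto
  have yr: "y [^] r = \<one>"
    using pow_ord_eq_1[OF yc] r(2) by simp
  have y1: "y \<noteq> \<one>"
    using yz zc by auto
  have yP: "y \<notin> P"
    using comm[OF _ z] yz by blast
  have "r dvd order G"
    using ord_dvd_group_order[OF yc] r(2) by simp
  then have pr: "p \<le> r"
    using min[OF r(1)] by blast
  \<comment> \<open>If r were p, then P<y> would be a p-subgroup larger than a Sylow
    subgroup.\<close>
  have rp: "r \<noteq> p"
  proof
    assume e: "r = p"
    have "card (adjoin P y) = p ^ Suc (multiplicity p (order G))"
      using card_adjoin[OF P(1) yc _ yP p(1)] yr e P(2) by (simp add: mult.commute)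
    moreover have "subgroup (adjoin P y) G"
      by (rule adjoin_subgroup[OF P(1) yc yr prime_gt_0_nat[OF r(1)] yN])
    then have "card (adjoin P y) dvd order G"
      using lagrange by (metis dvd_triv_right)
    moreover have "order G \<noteq> 0" "\<not> is_unit p"
      using fin order_gt_0_iff_finite p(1) by auto
    ultimately have "Suc (multiplicity p (order G)) \<le> multiplicity p (order G)"
      by (intro multiplicity_geI) simp_all
    then show False by simp
  qed
  interpret A: prime_action G P y r p
    by (intro prime_action.intro prime_action_axioms.intro)
      (use P(1) p(1) r(1) rp comm exp yc yr y1 yN in simp_all)
  show False
  proof (rule A.CI_trichotomy[OF CI])
    assume "\<And>a. a \<in> P \<Longrightarrow> y \<otimes> a = a \<otimes> y"
    then show False
      using yz z by blast
  next
    assume r3: "r \<le> 3" and sc: "\<And>a. a \<in> P \<Longrightarrow> y \<otimes> a \<otimes> inv y \<in> range (\<lambda>i::nat. a [^] i)"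
    \<comment> \<open>Since r \<le> 3, r \<noteq> p and p \<le> r, only p = 2 is left, and the only
      nontrivial power of an involution is itself.\<close>
    have p2: "p = 2"
      using r3 rp pr prime_ge_2_nat[OF p(1)] by linarith
    obtain i where i: "y \<otimes> z \<otimes> inv y = z [^] (i::nat)"
      using sc[OF z] by blast
    have "z [^] i \<in> adjoin {\<one>} z"
      unfolding adjoin_one_eq[OF zc] by blast
    then obtain j where j: "j < 2" "z [^] i = z [^] (j::nat)"
      using adjoin_eq_image[OF triv_subgroup zc exp[OF z] p(1)] p2 zc by auto
    then have "y \<otimes> z \<otimes> inv y = \<one> \<or> y \<otimes> z \<otimes> inv y = z"
      using i zc by (cases j) (auto simp: less_2_cases_iff)
    then show False
      using conj_eq_iff_commute[OF yc zc] zc yc yz by auto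
  next
    assume p2: "p = 2" and c4: "card P = 4"
    have inv: "inv u = u" if "u \<in> P" for u
      using exp[OF that] that p2 by (intro inv_equality) (auto simp: numeral_2_eq_2)
    define w where "w = y \<otimes> z \<otimes> inv y"
    define v where "v = y \<otimes> w \<otimes> inv y"
    have wv: "w \<in> P" "v \<in> P"
      using yN z by (simp_all add: w_def v_def)
    have wc: "w \<in> carrier G" and vc: "v \<in> carrier G"
      using wv by simp_all
    have z1: "z \<noteq> \<one>"
      using yz yc by auto
    have wz: "w \<noteq> z"
      using conj_eq_iff_commute[OF yc zc zc] yz by (simp add: w_def)
    have w1: "w \<noteq> \<one>"
      using conj_eq_iff_commute[OF yc zc one_closed] yc zc z1 by (simp add: w_def)
    have v1: "v \<noteq> \<one>"
      using conj_eq_iff_commute[OF yc wc one_closed] yc wc w1 by (simp add: v_def)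
    have vw: "v \<noteq> w"
      using wz yc zc wc by (simp add: v_def w_def)
    \<comment> \<open>y^2 does not centralize z, because r is odd and y is a power of y^2.\<close>
    have vz: "v \<noteq> z"
    proof
      assume "v = z"
      moreover have "v = (y \<otimes> y) \<otimes> z \<otimes> inv (y \<otimes> y)"
        using yc zc by (simp add: v_def w_def m_assoc inv_mult_group)
      ultimately have "y \<otimes> y \<in> ?C"
        using conj_eq_iff_commute[of "y \<otimes> y" z z] yc zc by simp
      then have "y [^] (int 2) \<in> ?C"
        unfolding int_pow_int using yc by (simp add: numeral_2_eq_2)
      then have "int r dvd int 2"
        using pow_prime_mem_iff[OF C yc yr y(2) r(1), of "int 2"] by blast
      then have "r = 2"
        using primes_dvd_imp_eq[OF r(1) two_is_prime_nat] int_dvd_int_iff by blast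
      then show False
        using rp p2 by simp
    qed
    have "card {\<one>, z, w, v} = 4"
      using z1 w1 v1 wz vw vz by auto
    moreover have "finite P"
      using c4 by (metis card.infinite zero_neq_numeral)
    ultimately have Peq: "P = {\<one>, z, w, v}"
      using card_subset_eq[of P "{\<one>, z, w, v}"] c4 z wv by auto
    have zt: "z \<in> prime_torsion 2"
      using zc z1 exp[OF z] p2 by (simp add: prime_torsion_def)
    obtain x where x: "x \<in> prime_torsion 2"
      "\<And>h. h \<in> carrier G \<Longrightarrow> x \<noteq> h \<otimes> z \<otimes> inv h \<and> x \<noteq> inv (h \<otimes> z \<otimes> inv h)"
      using k_if_several_classes[OF CI k two_is_prime_nat zt] by blast
    have xc: "x \<in> carrier G" "x [^] (2::nat) = \<one>" "x \<noteq> \<one>"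
      using x(1) by (simp_all add: prime_torsion_def)
    \<comment> \<open>The involution x is conjugate into \<open>P\<close>, hence to one of z, w, v,
      all of which are conjugate to z by powers of y; this contradicts the choice of x.\<close>
    obtain c where c: "c \<in> carrier G" "\<And>u. u \<in> adjoin {\<one>} x \<Longrightarrow> c \<otimes> u \<otimes> inv c \<in> P"
      using sylow_conj_subset[OF fin two_is_prime_nat P(1) _ cyclic_prime_subgroup(1)[OF two_is_prime_nat xc], of 1]
        cyclic_prime_subgroup(2)[OF two_is_prime_nat xc] P(3) p2 by auto
    have cx: "c \<otimes> x \<otimes> inv c \<in> P"
      by (rule c(2)[OF mem_adjoin[OF triv_subgroup xc(1)]])
    have "c \<otimes> x \<otimes> inv c \<noteq> \<one>"
      using conj_eq_iff_commute[OF c(1) xc(1) one_closed] c(1) xc by simp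
    then have "c \<otimes> x \<otimes> inv c \<in> {z, w, v}"
      using cx Peq by blast
    moreover have "z = \<one> \<otimes> z \<otimes> inv \<one>" "v = (y \<otimes> y) \<otimes> z \<otimes> inv (y \<otimes> y)"
      using yc zc by (simp_all add: v_def w_def m_assoc inv_mult_group)
    ultimately obtain h where h: "h \<in> carrier G" "c \<otimes> x \<otimes> inv c = h \<otimes> z \<otimes> inv h"
      using w_def yc by (metis insertE m_closed one_closed singletonD)
    have "x = inv c \<otimes> (c \<otimes> x \<otimes> inv c) \<otimes> c"
      using c(1) xc(1) by (simp add: m_assoc)
    also have "\<dots> = (inv c \<otimes> h) \<otimes> z \<otimes> inv (inv c \<otimes> h)"
      unfolding h(2) using c(1) h(1) zc by (simp add: m_assoc inv_mult_group)
    finally show False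
      using x(2)[of "inv c \<otimes> h"] c(1) h(1) by blast
  qed
qed

text \<open><x, y> and <x, u> are subgroups of the same order q p, so an automorphism carries one to
  the other; the second is abelian.\<close>

lemma CI_same_order_commute:
  assumes CI: "CI_group G" and p: "Factorial_Ring.prime (p::nat)" and q: "Factorial_Ring.prime (q::nat)"
    and x: "x \<in> carrier G" "x [^] q = \<one>" "x \<noteq> \<one>"
    and y: "y \<in> carrier G" "y [^] p = \<one>" "y \<notin> adjoin {\<one>} x" "y \<otimes> x \<otimes> inv y \<in> adjoin {\<one>} x"
    and u: "u \<in> carrier G" "u [^] p = \<one>" "u \<notin> adjoin {\<one>} x" "u \<otimes> x = x \<otimes> u"
  shows "y \<otimes> x = x \<otimes> y"
proof -
  have uxu: "u \<otimes> x \<otimes> inv u = x"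
    using conj_eq_iff_commute[OF u(1) x(1) x(1)] u(4) by blast
  then have ux: "u \<otimes> x \<otimes> inv u \<in> adjoin {\<one>} x"
    using mem_adjoin[OF triv_subgroup x(1)] by simp
  note Y = subgroup_adjoin_adjoin[OF p q x y]
  note U = subgroup_adjoin_adjoin[OF p q x u(1-3) ux]
  have comm: "a \<otimes> b = b \<otimes> a" if "a \<in> adjoin (adjoin {\<one>} x) u" "b \<in> adjoin (adjoin {\<one>} x) u" for a b
  proof -
    have form: "\<exists>m n. c = x [^] (m::nat) \<otimes> u [^] (n::nat)" if "c \<in> adjoin (adjoin {\<one>} x) u" for c
      using that unfolding adjoin_def using x(1) by auto
    obtain m n where a: "a = x [^] (m::nat) \<otimes> u [^] (n::nat)"
      using form[OF \<open>a \<in> _\<close>] by blast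
    obtain m' n' where b: "b = x [^] (m'::nat) \<otimes> u [^] (n'::nat)"
      using form[OF \<open>b \<in> _\<close>] by blast
    have "u [^] i \<otimes> x = x \<otimes> u [^] i" for i :: nat
      by (rule group_commutes_pow[OF u(4) u(1) x(1)])
    then have xu: "x [^] j \<otimes> u [^] i = u [^] i \<otimes> x [^] j" for i j :: nat
      using group_commutes_pow[of x "u [^] i" j] x(1) u(1) by simp
    have "a \<otimes> b = x [^] m \<otimes> (u [^] n \<otimes> x [^] m') \<otimes> u [^] n'"
      unfolding a b using x(1) u(1) by (simp add: m_assoc)
    also have "\<dots> = x [^] (m + m') \<otimes> u [^] (n + n')"
      unfolding xu[symmetric] using x(1) u(1) by (simp add: m_assoc flip: nat_pow_mult)
    also have "\<dots> = x [^] (m' + m) \<otimes> u [^] (n' + n)"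
      by (simp add: add.commute)
    also have "\<dots> = x [^] m' \<otimes> (x [^] m \<otimes> u [^] n') \<otimes> u [^] n"
      using x(1) u(1) by (simp add: m_assoc flip: nat_pow_mult)
    also have "\<dots> = b \<otimes> a"
      unfolding a b xu[of m n'] using x(1) u(1) by (simp add: m_assoc)
    finally show ?thesis .
  qed
  obtain \<alpha> where \<alpha>: "\<alpha> \<in> auto G" "\<alpha> ` adjoin (adjoin {\<one>} x) y = adjoin (adjoin {\<one>} x) u"
    using CI_conj_subgroups[OF CI Y(1) U(1)] Y(2) U(2) by metis
  have "\<alpha> x \<in> adjoin (adjoin {\<one>} x) u" "\<alpha> y \<in> adjoin (adjoin {\<one>} x) u"
    using Y(3,4) \<alpha>(2) by blast+
  then have "\<alpha> y \<otimes> \<alpha> x = \<alpha> x \<otimes> \<alpha> y"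
    using comm by blast
  then have "\<alpha> (y \<otimes> x) = \<alpha> (x \<otimes> y)"
    using autoD_group(3)[OF \<alpha>(1)] x(1) y(1) by simp
  then show ?thesis
    using auto_eq_iff[OF \<alpha>(1)] x(1) y(1) by simp
qed

lemma conj_nat_pow_iter:
  assumes x: "x \<in> carrier G" and y: "y \<in> carrier G" and s: "y \<otimes> x \<otimes> inv y = x [^] (s::nat)"
  shows "y [^] n \<otimes> x \<otimes> inv (y [^] n) = x [^] (s ^ n)"
proof (induction n)
  case (Suc n)
  have pow: "y \<otimes> x [^] m \<otimes> inv y = (y \<otimes> x \<otimes> inv y) [^] m" for m :: nat
  proof (induction m)
    case (Suc m)
    have "y \<otimes> x [^] Suc m \<otimes> inv y = (y \<otimes> x [^] m \<otimes> inv y) \<otimes> (y \<otimes> x \<otimes> inv y)"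
      using x y by (simp add: m_assoc)
    then show ?case using Suc by simp
  qed (use y in simp)
  have "y [^] Suc n = y \<otimes> y [^] n"
    by (rule nat_pow_Suc2[OF y])
  then have "y [^] Suc n \<otimes> x \<otimes> inv (y [^] Suc n) = y \<otimes> (y [^] n \<otimes> x \<otimes> inv (y [^] n)) \<otimes> inv y"
    using x y by (simp add: m_assoc inv_mult_group del: nat_pow_Suc)
  also have "\<dots> = x [^] (s ^ Suc n)"
    unfolding Suc pow s using x by (simp add: nat_pow_pow mult.commute)
  finally show ?case .
qed (use x in simp)

text \<open>The scalars by which elements of order \<open>p \<le> 3\<close> act on \<open>x\<close> generate a cyclic group.\<close>

lemma no_rank_two_scalar_action:
  assumes p: "Factorial_Ring.prime (p::nat)" "p \<le> 3" and q: "Factorial_Ring.prime (q::nat)"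
    and x: "x \<in> carrier G" "x [^] q = \<one>" "x \<noteq> \<one>"
    and y: "y \<in> carrier G" "y [^] p = \<one>" "y \<otimes> x \<otimes> inv y \<in> range (\<lambda>i::nat. x [^] i)" "y \<otimes> x \<noteq> x \<otimes> y"
    and w: "w \<in> carrier G" "w [^] p = \<one>" "w \<otimes> x \<otimes> inv w \<in> range (\<lambda>i::nat. x [^] i)" "w \<otimes> x \<noteq> x \<otimes> w"
  obtains i :: nat where "(inv (y [^] i) \<otimes> w) \<otimes> x = x \<otimes> (inv (y [^] i) \<otimes> w)"
proof -
  have ox: "ord x = q"
    by (rule prime_ord[OF q x])
  have eqiff: "x [^] (a::nat) = x [^] (b::nat) \<longleftrightarrow> int q dvd int b - int a" for a b
    using int_pow_eq[OF x(1), of "int a" "int b"] ox by (simp add: int_pow_int)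
  \<comment> \<open>The scalar s satisfies s^p = 1 modulo q, and it differs from 1 because v does
    not commute with x.\<close>
  have root: "\<exists>s::nat. v \<otimes> x \<otimes> inv v = x [^] s \<and> int q dvd int s ^ p - 1 \<and> \<not> int q dvd int s - 1"
    if v: "v \<in> carrier G" "v [^] p = \<one>" "v \<otimes> x \<otimes> inv v \<in> range (\<lambda>i::nat. x [^] i)" "v \<otimes> x \<noteq> x \<otimes> v" for v
  proof -
    obtain s where s: "v \<otimes> x \<otimes> inv v = x [^] (s::nat)"
      using v(3) by blast
    have "x [^] (1::nat) = x [^] (s ^ p)"
      using conj_nat_pow_iter[OF x(1) v(1) s, of p] v(2) x(1) by simp
    then have "int q dvd int (s ^ p) - int 1"
      using eqiff by blast
    moreover have "x [^] (1::nat) \<noteq> x [^] s"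
      using conj_eq_iff_commute[OF v(1) x(1) x(1)] v(4) s x(1) by auto
    then have "\<not> int q dvd int s - int 1"
      using eqiff by blast
    ultimately show ?thesis
      using s by (intro exI[of _ s]) simp
  qed
  obtain s where s: "y \<otimes> x \<otimes> inv y = x [^] (s::nat)" "int q dvd int s ^ p - 1" "\<not> int q dvd int s - 1"
    using root[OF y] by blast
  obtain t where t: "w \<otimes> x \<otimes> inv w = x [^] (t::nat)" "int q dvd int t ^ p - 1" "\<not> int q dvd int t - 1"
    using root[OF w] by blast
  have "p = 2 \<or> p = 3"
    using p prime_ge_2_nat by (metis le_antisym not_less_eq_eq numeral_2_eq_2 numeral_3_eq_3)
  moreover have "Factorial_Ring.prime (int q)"
    using q by simp
  ultimately obtain i :: nat where "int q dvd int t - int s ^ i"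
    using cube_roots_mod_prime[OF _ _ s(2,3) t(2,3)] by blast
  then have "x [^] (s ^ i) = x [^] t"
    using eqiff by simp
  then have e: "w \<otimes> x \<otimes> inv w = y [^] i \<otimes> x \<otimes> inv (y [^] i)"
    using conj_nat_pow_iter[OF x(1) y(1) s(1), of i] t(1) by simp
  have "(inv (y [^] i) \<otimes> w) \<otimes> x \<otimes> inv (inv (y [^] i) \<otimes> w) = inv (y [^] i) \<otimes> (w \<otimes> x \<otimes> inv w) \<otimes> y [^] i"
    using x(1) y(1) w(1) by (simp add: m_assoc inv_mult_group)
  also have "\<dots> = x"
    unfolding e using x(1) y(1) by (simp add: m_assoc)
  finally have "(inv (y [^] i) \<otimes> w) \<otimes> x = x \<otimes> (inv (y [^] i) \<otimes> w)"
    using conj_eq_iff_commute[of "inv (y [^] i) \<otimes> w" x x] x(1) y(1) w(1) by simp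
  then show ?thesis
    by (rule that)
qed

section \<open>Induction step: the normal complement and the action of the Sylow subgroup on
  it\<close>

lemma CI_k_if_comm_step:
  assumes CI: "CI_group G" and k: "k_if_property k G" "2 \<le> k"
    and IH: "\<And>K. \<lbrakk>subgroup K G; card K < order G; k_if_property k (G\<lparr>carrier := K\<rparr>)\<rbrakk> \<Longrightarrow>
      comm_group (G\<lparr>carrier := K\<rparr>)"
  shows "comm_group G"
proof -
  have fin: "finite (carrier G)"
    by (rule CI_groupD[OF CI])
  show ?thesis
  proof (cases "carrier G = {\<one>}")
    case True
    then show ?thesis
      by (intro group_comm_groupI) simp
  next
    case False
    have pos: "order G \<noteq> 0"
      using fin order_gt_0_iff_finite by simp
    have "order G \<noteq> 1"
      using False order_one_triv_iff by simp
    then have ex: "\<exists>p. Factorial_Ring.prime p \<and> p dvd order G"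
      using prime_factor_nat by blast
    define p where "p = (LEAST p. Factorial_Ring.prime p \<and> p dvd order G)"
    have p: "Factorial_Ring.prime p" "p dvd order G"
      using LeastI_ex[OF ex] unfolding p_def by auto
    have min: "p \<le> r" if "Factorial_Ring.prime r" "r dvd order G" for r
      unfolding p_def by (rule Least_le) (use that in simp)
    obtain P where P: "subgroup P G" "card P = p ^ multiplicity p (order G)" "\<not> p dvd order G div card P"
      using ex_sylow[OF fin p(1)] by blast
    interpret P: subgroup P G by (rule P)
    have sq: "ord x \<noteq> r ^ 2" if "Factorial_Ring.prime (r::nat)" "x \<in> carrier G" for r x
      by (rule k_if_no_prime_square[OF CI k that])
    have exp: "u [^] p = \<one>" if u: "u \<in> P" for u
    proof (rule prime_power_exponent[OF sq[OF p(1)] p(1)])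
      show "u \<in> carrier G" using u by simp
      have "u [^]\<^bsub>G\<lparr>carrier := P\<rparr>\<^esub> order (G\<lparr>carrier := P\<rparr>) = \<one>"
        using group.pow_order_eq_1[OF P.subgroup_is_group[OF is_group], of u] u by simp
      then show "u [^] (p ^ multiplicity p (order G)) = \<one>"
        using P(2) by (simp add: order_def flip: nat_pow_consistent)
    qed
    have comm: "u \<otimes> v = v \<otimes> u" if "u \<in> P" "v \<in> P" for u v
      by (rule CI_sylow_abelian[OF CI P(1,2) p(1) exp that])
    let ?PG = "G\<lparr>carrier := P\<rparr>"
    interpret PG: group ?PG
      by (rule P.subgroup_is_group[OF is_group])
    obtain V where V: "V \<in> hom G ?PG" "inj_on V P"
      using burnside_transfer[OF fin p(1) P comm exp k_if_sylow_normalizer[OF CI k p min P]] by blast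
    interpret V: group_hom G ?PG V
      using V(1) by (auto simp: group_hom_def group_hom_axioms_def)
    have finP: "finite P"
      using fin P.subset finite_subset by blast
    have Vc: "V g \<in> P" if "g \<in> carrier G" for g
      using V.hom_closed[OF that] by simp
    have VP: "V ` P = P"
      by (rule endo_inj_surj[OF finP _ V(2)]) (use Vc in auto)
    define K where "K = kernel G ?PG V"
    have K: "subgroup K G"
      unfolding K_def by (rule V.subgroup_kernel)
    interpret K: subgroup K G by (rule K)
    have K_iff: "g \<in> K \<longleftrightarrow> g \<in> carrier G \<and> V g = \<one>" for g
      unfolding K_def kernel_def by simp
    \<comment> \<open>V maps \<open>P\<close> onto \<open>P\<close>, so each g has the same image as
      some v in \<open>P\<close>: \<open>G\<close> is the product of the kernel and
      \<open>P\<close>.\<close>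
    have dec: "\<exists>v\<in>P. g \<otimes> inv v \<in> K" if g: "g \<in> carrier G" for g
    proof -
      have "V g \<in> V ` P"
        unfolding VP by (rule Vc[OF g])
      then obtain v where v: "v \<in> P" "V g = V v"
        by blast
      have "V (g \<otimes> inv v) = V g \<otimes>\<^bsub>?PG\<^esub> inv\<^bsub>?PG\<^esub> (V v)"
        using g v(1) V.hom_inv[of v] by simp
      also have "\<dots> = \<one>"
        unfolding v(2) using PG.r_inv[of "V v"] Vc[of v] v(1) by simp
      finally show ?thesis
        using v(1) g K_iff by (intro bexI[of _ v]) simp_all
    qed
    have KP: "u = \<one>" if "u \<in> K" "u \<in> P" for u
      using inj_onD[OF V(2), of u \<one>] that K_iff V.hom_one by simp
    have bij: "bij_betw (\<lambda>(a, t). a \<otimes> t) (K \<times> P) (carrier G)"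
      unfolding bij_betw_def
    proof
      show "inj_on (\<lambda>(a, t). a \<otimes> t) (K \<times> P)"
      proof (rule inj_onI)
        fix a b assume "a \<in> K \<times> P" "b \<in> K \<times> P" "(\<lambda>(a, t). a \<otimes> t) a = (\<lambda>(a, t). a \<otimes> t) b"
        then obtain a1 a2 b1 b2 where ab: "a = (a1, a2)" "b = (b1, b2)" "a1 \<in> K" "a2 \<in> P" "b1 \<in> K" "b2 \<in> P"
          "a1 \<otimes> a2 = b1 \<otimes> b2"
          by auto
        have c: "a1 \<in> carrier G" "a2 \<in> carrier G" "b1 \<in> carrier G" "b2 \<in> carrier G"
          using ab by simp_all
        have "inv b1 \<otimes> a1 = inv b1 \<otimes> (a1 \<otimes> a2) \<otimes> inv a2"
          using c by (simp add: m_assoc)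
        also have "\<dots> = b2 \<otimes> inv a2"
          unfolding ab(7) using c by (simp add: m_assoc)
        finally have e: "inv b1 \<otimes> a1 = b2 \<otimes> inv a2" .
        have "inv b1 \<otimes> a1 \<in> K" "b2 \<otimes> inv a2 \<in> P"
          using ab(3-6) by simp_all
        then have "inv b1 \<otimes> a1 = \<one>"
          using KP e by simp
        then have "a1 = b1"
          using c by (metis inv_closed inv_equality inv_inv)
        then show "a = b"
          using ab c by simp
      qed
      show "(\<lambda>(a, t). a \<otimes> t) ` (K \<times> P) = carrier G"
      proof (intro equalityI subsetI)
        fix g assume g: "g \<in> carrier G"
        obtain v where v: "v \<in> P" "g \<otimes> inv v \<in> K"
          using dec[OF g] by blast
        have "g = (g \<otimes> inv v) \<otimes> v"
          using g v(1) by (simp add: m_assoc)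
        then show "g \<in> (\<lambda>(a, t). a \<otimes> t) ` (K \<times> P)"
          using v by (intro image_eqI[of _ _ "(g \<otimes> inv v, v)"]) auto
      qed auto
    qed
    have order: "order G = card K * card P"
      using bij_betw_same_card[OF bij] by (simp add: card_cartesian_product order_def)
    have cP: "card P > 0"
      using P.finite_imp_card_positive[OF fin] .
    have pK: "\<not> p dvd card K"
      using P(3) order cP by simp
    let ?KG = "G\<lparr>carrier := K\<rparr>"
    \<comment> \<open>\<open>K\<close> is given by a power condition, since |K| is prime to p and
      the values of \<open>V\<close> have order 1 or p. So every automorphism preserves it.\<close>
    have K_eq: "K = {g \<in> carrier G. g [^] card K = \<one>}"
    proof (intro equalityI subsetI)
      fix g assume g: "g \<in> K"
      have "g [^]\<^bsub>?KG\<^esub> order ?KG = \<one>"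
        using group.pow_order_eq_1[OF K.subgroup_is_group[OF is_group], of g] g by simp
      then show "g \<in> {g \<in> carrier G. g [^] card K = \<one>}"
        using g by (simp add: order_def flip: nat_pow_consistent)
    next
      fix g assume g: "g \<in> {g \<in> carrier G. g [^] card K = \<one>}"
      then have gc: "g \<in> carrier G" by simp
      have Vg: "V g \<in> carrier G" "V g \<in> P"
        using Vc[OF gc] by simp_all
      have "V g [^] card K = V (g [^] card K)"
        using V.hom_nat_pow[OF gc, of "card K"] by (simp flip: nat_pow_consistent)
      then have "V g [^] card K = \<one>"
        using g V.hom_one by simp
      then have "ord (V g) dvd card K" "ord (V g) dvd p"
        using exp[OF Vg(2)] pow_eq_id[OF Vg(1)] by blast+
      moreover have "coprime p (card K)"
        using pK p(1) prime_imp_coprime by blast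
      ultimately have "ord (V g) = 1"
        by (metis coprime_common_divisor_nat)
      then show "g \<in> K"
        using K_iff gc ord_eq_1[OF Vg(1)] by simp
    qed
    have Kchar: "\<alpha> ` K = K" if \<alpha>: "\<alpha> \<in> auto G" for \<alpha>
    proof (rule card_subset_eq)
      show "finite K"
        using fin K.subset finite_subset by blast
      show "\<alpha> ` K \<subseteq> K"
      proof (rule image_subsetI)
        fix g assume "g \<in> K"
        then have g: "g \<in> carrier G" "g [^] card K = \<one>"
          using K_eq by blast+
        have "\<alpha> g [^] card K = \<one>"
          using autoD_group(5)[OF \<alpha> g(1), of "card K"] g(2) autoD_group(2)[OF \<alpha>] by simp
        then show "\<alpha> g \<in> K"
          using K_eq autoD_group(1)[OF \<alpha> g(1)] by blast
      qed
      show "card (\<alpha> ` K) = card K"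
        by (rule autoD_group(8)[OF \<alpha> K.subset])
    qed
    have Kcomm: "u \<otimes> v = v \<otimes> u" if uv: "u \<in> K" "v \<in> K" for u v
    proof (cases "K = {\<one>}")
      case False
      have "multiplicity p (order G) > 0"
        using p pos by (simp add: prime_multiplicity_gt_zero_iff prime_imp_prime_elem)
      then have "card P > 1"
        unfolding P(2) by (rule one_less_power[OF prime_gt_1_nat[OF p(1)]])
      moreover have "card K > 0"
        using K.finite_imp_card_positive[OF fin] .
      ultimately have "card K < order G"
        using order by simp
      then have "comm_group ?KG"
        using IH[OF K] k_if_characteristic_subgroup[OF CI k(1) K False Kchar] by blast
      then show ?thesis
        using uv comm_monoid.m_comm[of ?KG u v] by (simp add: comm_group_def)
    qed (use uv in auto)
    have PK: "y \<otimes> z = z \<otimes> y" if y: "y \<in> P" and z: "z \<in> K" for y z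
    proof (rule ccontr)
      assume yz: "y \<otimes> z \<noteq> z \<otimes> y"
      have yc: "y \<in> carrier G" and zc: "z \<in> carrier G"
        using y z by simp_all
      let ?C = "{g \<in> carrier G. g \<otimes> y = y \<otimes> g}"
      obtain x q where x: "x \<in> K" "x \<notin> ?C" and q: "Factorial_Ring.prime q" "ord x = q"
        using ex_prime_order_outside[OF fin sq centralizer_subgroup[OF yc] K.subset subgroup_nat_pow[OF K] z]
          yz zc by auto
      have xc: "x \<in> carrier G" and xy: "y \<otimes> x \<noteq> x \<otimes> y"
        using x by auto
      have xq: "x [^] q = \<one>" and x1: "x \<noteq> \<one>"
        using pow_ord_eq_1[OF xc] q(2) xy yc by auto
      have "q dvd card K"
        using pow_eq_id[OF xc] K_eq x(1) q(2) by blast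
      then have qG: "q dvd order G" and qp: "q \<noteq> p"
        using order pK by auto
      then have pq: "p < q"
        using min[OF q(1)] by simp
      \<comment> \<open>The elements of exponent q in the abelian group \<open>K\<close> form an
        elementary abelian subgroup, normal in \<open>G\<close> because both \<open>K\<close> and
        \<open>Q\<close> are given by power conditions.\<close>
      define Q where "Q = {u \<in> K. u [^] q = \<one>}"
      have Q: "subgroup Q G"
      proof (rule subgroupI)
        show "Q \<subseteq> carrier G" unfolding Q_def by auto
        show "Q \<noteq> {}" using x(1) xq unfolding Q_def by blast
        show "inv a \<in> Q" if "a \<in> Q" for a
          using that unfolding Q_def by (simp add: nat_pow_inv)
        show "a \<otimes> b \<in> Q" if "a \<in> Q" "b \<in> Q" for a b
          using that Kcomm pow_mult_distrib[of a b q] unfolding Q_def by simp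
      qed
      have conj_pow: "(g \<otimes> a \<otimes> inv g) [^] (n::nat) = g \<otimes> a [^] n \<otimes> inv g"
        if "g \<in> carrier G" "a \<in> carrier G" for g a n
      proof (induction n)
        case (Suc n)
        then show ?case using that by (simp add: m_assoc)
      qed (use that in simp)
      have Qnorm: "g \<otimes> a \<otimes> inv g \<in> Q" if g: "g \<in> carrier G" and a: "a \<in> Q" for g a
      proof -
        have ac: "a \<in> carrier G" "a [^] q = \<one>" "a [^] card K = \<one>"
          using a K_eq unfolding Q_def by auto
        then have "(g \<otimes> a \<otimes> inv g) [^] q = \<one>" "(g \<otimes> a \<otimes> inv g) [^] card K = \<one>"
          using conj_pow[OF g ac(1)] g by simp_all
        then show ?thesis
          unfolding Q_def using K_eq g ac(1) by blast
      qed
      have xQ: "x \<in> Q"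
        using x(1) xq unfolding Q_def by blast
      have action: "prime_action G Q u p q" if u: "u \<in> P" "u \<noteq> \<one>" for u
      proof (intro prime_action.intro prime_action_axioms.intro)
        show "u [^] p = \<one>" by (rule exp[OF u(1)])
        show "a \<otimes> b = b \<otimes> a" if "a \<in> Q" "b \<in> Q" for a b
          using that Kcomm unfolding Q_def by blast
        show "a [^] q = \<one>" if "a \<in> Q" for a
          using that unfolding Q_def by blast
        show "u \<otimes> a \<otimes> inv u \<in> Q" if "a \<in> Q" for a
          by (rule Qnorm[OF _ that]) (use u in simp)
      qed (use Q p q qp u in simp_all)
      have scalar: "p \<le> 3 \<and> u \<otimes> x \<otimes> inv u \<in> range (\<lambda>i::nat. x [^] i)"
        if u: "u \<in> P" "u \<otimes> x \<noteq> x \<otimes> u" for u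
      proof -
        have "u \<noteq> \<one>"
          using u(2) xc by auto
        from prime_action.CI_trichotomy[OF action[OF u(1) this] CI] show ?thesis
        proof cases
          case 1
          then show ?thesis using u(2) xQ by blast
        next
          case 2
          then show ?thesis using xQ by blast
        next
          \<comment> \<open>Here q = 2, but q exceeds the prime p.\<close>
          case 3
          then show ?thesis using pq prime_ge_2_nat[OF p(1)] by simp
        qed
      qed
      have p3: "p \<le> 3"
        using scalar[OF y xy] by blast
      have cyc: "adjoin {\<one>} x = range (\<lambda>i::nat. x [^] i)"
        by (rule adjoin_one_eq[OF xc])
      have cycK: "adjoin {\<one>} x \<subseteq> K"
        unfolding cyc using subgroup_nat_pow[OF K x(1)] by blast
      have notin: "u \<notin> adjoin {\<one>} x" if "u \<in> P" "u \<noteq> \<one>" for u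
        using KP[of u] that cycK by blast
      have y1: "y \<noteq> \<one>"
        using xy xc by auto
      have yx: "y \<otimes> x \<otimes> inv y \<in> adjoin {\<one>} x"
        unfolding cyc using scalar[OF y xy] by blast
      \<comment> \<open>If some nontrivial u in \<open>P\<close> commuted with x, then <x, u> would
        be abelian, and <x, y>, which has the same order, would be abelian too.\<close>
      have nc: "u \<otimes> x \<noteq> x \<otimes> u" if u: "u \<in> P" "u \<noteq> \<one>" for u
      proof
        assume "u \<otimes> x = x \<otimes> u"
        then have "y \<otimes> x = x \<otimes> y"
          using CI_same_order_commute[OF CI p(1) q(1) xc xq x1 yc exp[OF y] notin[OF y y1] yx
              P.mem_carrier[OF u(1)] exp[OF u(1)] notin[OF u]] by blast
        then show False using xy by blast
      qed
      \<comment> \<open>Since p \<le> 3, the order of \<open>P\<close> is at least p^2, so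
        \<open>P\<close> contains an element w outside <y>. Some y^-i w centralizes x, which
        \<open>nc\<close> allows only for w = y^i.\<close>
      obtain B where B: "subgroup B G" "card B = p ^ 2"
        using k_if_rank_two[OF CI k p(1) p3 p(2)] by blast
      have "p ^ 2 dvd order G"
        using lagrange[OF B(1)] B(2) by (metis dvd_triv_right)
      then have "2 \<le> multiplicity p (order G)"
        using pos p(1) by (intro multiplicity_geI) auto
      then have "p ^ 2 \<le> card P"
        unfolding P(2) using prime_gt_0_nat[OF p(1)] by (intro power_increasing) auto
      moreover have "card (adjoin {\<one>} y) = p"
        by (rule cyclic_prime_subgroup(2)[OF p(1) yc exp[OF y] y1])
      moreover have "p < p ^ 2"
        using prime_gt_1_nat[OF p(1)] by (simp add: power2_eq_square)
      moreover have "adjoin {\<one>} y \<subseteq> P"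
        unfolding adjoin_one_eq[OF yc] using subgroup_nat_pow[OF P(1) y] by blast
      ultimately obtain w where w: "w \<in> P" "w \<notin> adjoin {\<one>} y"
        by (metis leD subsetI subset_antisym)
      then have "w \<noteq> \<one>"
        using subset_adjoin[of "{\<one>}" y] by auto
      note wnc = nc[OF w(1) this]
      obtain i :: nat where i: "(inv (y [^] i) \<otimes> w) \<otimes> x = x \<otimes> (inv (y [^] i) \<otimes> w)"
        using no_rank_two_scalar_action[OF p(1) p3 q(1) xc xq x1 yc exp[OF y] _ xy P.mem_carrier[OF w(1)] exp[OF w(1)] _ wnc]
          scalar[OF y xy] scalar[OF w(1) wnc] by blast
      have "y [^] i \<in> P"
        by (rule subgroup_nat_pow[OF P(1) y])
      then have "inv (y [^] i) \<otimes> w \<in> P"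
        using w(1) by simp
      then have "inv (y [^] i) \<otimes> w = \<one>"
        using nc i by blast
      then have "w = y [^] i"
        using w(1) yc by (metis P.mem_carrier inv_closed inv_equality inv_inv nat_pow_closed)
      then show False
        using w(2) unfolding adjoin_one_eq[OF yc] by blast
    qed
    show ?thesis
    proof (rule group_comm_groupI)
      fix g h assume gh: "g \<in> carrier G" "h \<in> carrier G"
      have "g \<in> (\<lambda>(a, t). a \<otimes> t) ` (K \<times> P)" "h \<in> (\<lambda>(a, t). a \<otimes> t) ` (K \<times> P)"
        using bij gh by (simp_all add: bij_betw_def)
      then obtain a u b v where *: "a \<in> K" "u \<in> P" "b \<in> K" "v \<in> P" "g = a \<otimes> u" "h = b \<otimes> v"
        by auto
      have c: "a \<in> carrier G" "u \<in> carrier G" "b \<in> carrier G" "v \<in> carrier G"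
        using * by simp_all
      have "g \<otimes> h = a \<otimes> (u \<otimes> b) \<otimes> v"
        using * c by (simp add: m_assoc)
      also have "\<dots> = (a \<otimes> b) \<otimes> (u \<otimes> v)"
        using PK[OF *(2,3)] c by (simp add: m_assoc)
      also have "\<dots> = (b \<otimes> a) \<otimes> (v \<otimes> u)"
        using Kcomm[OF *(1,3)] comm[OF *(2,4)] by simp
      also have "\<dots> = b \<otimes> (v \<otimes> a) \<otimes> u"
        using PK[OF *(4,1)] c by (simp add: m_assoc)
      also have "\<dots> = h \<otimes> g"
        using * c by (simp add: m_assoc)
      finally show "g \<otimes> h = h \<otimes> g" .
    qed
  qed
qed

end

theorem CI_k_if_comm_group:
  fixes G :: "('a, 'b) monoid_scheme"
  assumes "CI_group G" and "k_if_property k G" and "2 \<le> k"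
  shows "comm_group G"
  using assms(1,2)
proof (induction "order G" arbitrary: G rule: less_induct)
  case less
  show ?case
  proof (rule group.CI_k_if_comm_step[OF CI_groupD(1)[OF less.prems(1)] less.prems assms(3)])
    fix K assume "subgroup K G" "card K < order G" "k_if_property k (G\<lparr>carrier := K\<rparr>)"
    then show "comm_group (G\<lparr>carrier := K\<rparr>)"
      using less.hyps[of "G\<lparr>carrier := K\<rparr>"] group.CI_subgroup[OF CI_groupD(1)[OF less.prems(1)] less.prems(1)]
      by (simp add: order_def)
  qed
qed

context group
begin

text \<open>\<open>G\<close> is already known to be abelian, so conjugation into \<open>P\<close> is
  trivial and \<open>P\<close> contains all elements of order p. The divisibility is that of
  \<open>prime_torsion p\<close>.\<close>

lemma CI_k_if_sylow:
  assumes CI: "CI_group G" and k: "k_if_property k G" "2 \<le> k" and p: "Factorial_Ring.prime (p::nat)"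
    and P: "sylow_subgroup G p P"
  shows "elementary_abelian (G\<lparr>carrier := P\<rparr>)" "k dvd card P - 1" "odd p \<Longrightarrow> 2 * k dvd card P - 1"
proof -
  interpret comm_group G
    by (rule CI_k_if_comm_group[OF CI k])
  have fin: "finite (carrier G)"
    by (rule CI_groupD[OF CI])
  have P': "subgroup P G" "card P = p ^ multiplicity p (order G)"
    using P by (simp_all add: sylow_subgroup_def)
  interpret P: subgroup P G by (rule P')
  have finP: "finite P"
    using fin P.subset finite_subset by blast
  have sq: "ord x \<noteq> p ^ 2" if "x \<in> carrier G" for x
    by (rule k_if_no_prime_square[OF CI k p that])
  let ?PG = "G\<lparr>carrier := P\<rparr>"
  have gP: "group ?PG"
    by (rule P.subgroup_is_group[OF is_group])
  have exp: "u [^] p = \<one>" if u: "u \<in> P" for u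
  proof (rule prime_power_exponent[OF sq p])
    show "u \<in> carrier G" using u by simp
    have "u [^]\<^bsub>?PG\<^esub> order ?PG = \<one>"
      using group.pow_order_eq_1[OF gP, of u] u by simp
    then show "u [^] (p ^ multiplicity p (order G)) = \<one>"
      using P'(2) by (simp add: order_def flip: nat_pow_consistent)
  qed
  have cPG: "comm_group ?PG"
    by (rule group.group_comm_groupI[OF gP]) (simp add: m_comm)
  moreover have "group.ord ?PG x = p" if "x \<in> carrier ?PG" "x \<noteq> \<one>\<^bsub>?PG\<^esub>" for x
    using group.prime_ord[OF gP p that(1)] exp[of x] that by (simp flip: nat_pow_consistent)
  ultimately show "elementary_abelian ?PG"
    unfolding elementary_abelian_def using p by blast
  have "\<not> p dvd order G div card P"
  proof -
    have pos: "order G \<noteq> 0" "\<not> is_unit p"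
      using fin order_gt_0_iff_finite p by auto
    obtain m where m: "order G = p ^ multiplicity p (order G) * m" "\<not> p dvd m"
      using multiplicity_decompose'[OF pos] by metis
    then have "order G div card P = m"
      using P'(2) prime_gt_0_nat[OF p] by (metis nonzero_mult_div_cancel_left power_not_zero less_irrefl)
    then show ?thesis
      using m(2) by simp
  qed
  note nd = this
  have X: "prime_torsion p = P - {\<one>}"
  proof
    show "P - {\<one>} \<subseteq> prime_torsion p"
      using exp by (auto simp: prime_torsion_def)
    show "prime_torsion p \<subseteq> P - {\<one>}"
    proof
      fix x assume "x \<in> prime_torsion p"
      then have x: "x \<in> carrier G" "x [^] p = \<one>" "x \<noteq> \<one>"
        by (simp_all add: prime_torsion_def)
      obtain c where c: "c \<in> carrier G" "\<And>u. u \<in> adjoin {\<one>} x \<Longrightarrow> c \<otimes> u \<otimes> inv c \<in> P"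
        using sylow_conj_subset[OF fin p P'(1) nd cyclic_prime_subgroup(1)[OF p x], of 1]
          cyclic_prime_subgroup(2)[OF p x] by auto
      have "c \<otimes> x \<otimes> inv c \<in> P"
        by (rule c(2)[OF mem_adjoin[OF triv_subgroup x(1)]])
      moreover have "c \<otimes> x \<otimes> inv c = x"
        using conj_eq_iff_commute[OF c(1) x(1) x(1)] m_comm[OF c(1) x(1)] by blast
      ultimately show "x \<in> P - {\<one>}"
        using x(3) by simp
    qed
  qed
  have "card (prime_torsion p) = card P - 1"
    unfolding X using finP P.one_closed by simp
  then show "k dvd card P - 1" "odd p \<Longrightarrow> 2 * k dvd card P - 1"
    using k_if_dvd_prime_torsion[OF CI k(1) p] by simp_all
qed

end

section \<open>Direct products of elementary abelian groups\<close>

lemma product_group_nat_pow: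
  assumes "\<And>i. i \<in> I \<Longrightarrow> group (H i)" and f: "f \<in> carrier (product_group I H)" and i: "i \<in> I"
  shows "(f [^]\<^bsub>product_group I H\<^esub> (n::nat)) i = f i [^]\<^bsub>H i\<^esub> n"
  by (induction n) (use i in simp_all)

text \<open>In a factor whose nontrivial elements have order r, a coordinate of p-power order is
  trivial or r = p. So every element of p-power order is killed by the exponent p.\<close>

lemma elementary_abelian_sylow_of_product:
  assumes G: "group G" "finite (carrier G)" and D: "direct_product_of_elementary_abelian G"
  shows "comm_group G"
    and "\<lbrakk>Factorial_Ring.prime (p::nat); sylow_subgroup G p P\<rbrakk> \<Longrightarrow> elementary_abelian (G\<lparr>carrier := P\<rparr>)"
proof -
  interpret G: group G by (rule G)
  obtain I :: "nat set" and H :: "nat \<Rightarrow> 'a monoid"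
    where ea: "\<And>i. i \<in> I \<Longrightarrow> elementary_abelian (H i)" and iso: "G \<cong> product_group I H"
    using D unfolding direct_product_of_elementary_abelian_def by blast
  have Hg: "group (H i)" "comm_group (H i)" if "i \<in> I" for i
    using ea[OF that] by (simp_all add: elementary_abelian_def comm_group_def)
  let ?D = "product_group I H"
  interpret D: group ?D
    using Hg by simp
  obtain h where h: "h \<in> iso G ?D"
    using iso by (auto simp: is_iso_def)
  interpret h: group_hom G ?D h
    using h by (auto simp: group_hom_def group_hom_axioms_def iso_def)
  have inj: "inj_on h (carrier G)"
    using h by (auto simp: iso_def bij_betw_def)
  have comm: "x \<otimes>\<^bsub>G\<^esub> y = y \<otimes>\<^bsub>G\<^esub> x" if xy: "x \<in> carrier G" "y \<in> carrier G" for x y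
  proof (rule inj_onD[OF inj])
    have hx: "h x \<in> carrier ?D" "h y \<in> carrier ?D"
      by (rule h.hom_closed[OF xy(1)]) (rule h.hom_closed[OF xy(2)])
    have "h x i \<otimes>\<^bsub>H i\<^esub> h y i = h y i \<otimes>\<^bsub>H i\<^esub> h x i" if i: "i \<in> I" for i
    proof -
      interpret Hi: comm_group "H i" by (rule Hg(2)[OF i])
      show ?thesis
        using hx i by (intro Hi.m_comm) (auto simp: PiE_iff)
    qed
    then have "h x \<otimes>\<^bsub>?D\<^esub> h y = h y \<otimes>\<^bsub>?D\<^esub> h x"
      by (auto intro!: restrict_ext)
    then show "h (x \<otimes>\<^bsub>G\<^esub> y) = h (y \<otimes>\<^bsub>G\<^esub> x)"
      using xy by simp
  qed (use xy in simp_all)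
  then show cG: "comm_group G"
    by (rule G.group_comm_groupI)
  assume p: "Factorial_Ring.prime (p::nat)" and P: "sylow_subgroup G p P"
  have P': "subgroup P G" "card P = p ^ multiplicity p (order G)"
    using P by (simp_all add: sylow_subgroup_def)
  interpret P: subgroup P G by (rule P')
  let ?P = "G\<lparr>carrier := P\<rparr>"
  interpret PG: group ?P
    by (rule P.subgroup_is_group[OF G(1)])
  have pw: "x [^]\<^bsub>?P\<^esub> (n::nat) = x [^]\<^bsub>G\<^esub> n" for x n
    by (rule G.nat_pow_consistent[symmetric])
  have exp: "x [^]\<^bsub>G\<^esub> p = \<one>\<^bsub>G\<^esub>" if x: "x \<in> P" for x
  proof (rule inj_onD[OF inj])
    have xc: "x \<in> carrier G" using x by simp
    have "x [^]\<^bsub>?P\<^esub> order ?P = \<one>\<^bsub>G\<^esub>"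
      using PG.pow_order_eq_1[of x] x by simp
    then have x1: "x [^]\<^bsub>G\<^esub> (p ^ multiplicity p (order G)) = \<one>\<^bsub>G\<^esub>"
      unfolding pw using P'(2) by (simp add: order_def)
    have hxc: "h x \<in> carrier ?D"
      by (rule h.hom_closed[OF xc])
    have "(h x [^]\<^bsub>?D\<^esub> p) i = \<one>\<^bsub>H i\<^esub>" if i: "i \<in> I" for i
    proof -
      interpret Hi: group "H i" by (rule Hg(1)[OF i])
      have hi: "h x i \<in> carrier (H i)"
        using hxc i by (auto simp: PiE_iff)
      have "h x [^]\<^bsub>?D\<^esub> (p ^ multiplicity p (order G)) = \<one>\<^bsub>?D\<^esub>"
        using h.hom_nat_pow[OF xc, of "p ^ multiplicity p (order G)"] x1 by simp
      then have "h x i [^]\<^bsub>H i\<^esub> (p ^ multiplicity p (order G)) = \<one>\<^bsub>H i\<^esub>"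
        using product_group_nat_pow[OF Hg(1) hxc i, of "p ^ multiplicity p (order G)"] i by simp
      then have dv: "Hi.ord (h x i) dvd p ^ multiplicity p (order G)"
        using Hi.pow_eq_id[OF hi] by blast
      obtain r where r: "Factorial_Ring.prime (r::nat)" "\<And>y. y \<in> carrier (H i) \<Longrightarrow> y \<noteq> \<one>\<^bsub>H i\<^esub> \<Longrightarrow> Hi.ord y = r"
        using ea[OF i] unfolding elementary_abelian_def by blast
      have "Hi.ord (h x i) dvd p"
      proof (cases "h x i = \<one>\<^bsub>H i\<^esub>")
        case False
        then have "r dvd p ^ multiplicity p (order G)" "Hi.ord (h x i) = r"
          using dv r(2)[OF hi] by simp_all
        then show ?thesis
          using r(1) p by (metis prime_dvd_power)
      qed simp
      then have "h x i [^]\<^bsub>H i\<^esub> p = \<one>\<^bsub>H i\<^esub>"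
        using Hi.pow_eq_id[OF hi] by blast
      then show ?thesis
        using product_group_nat_pow[OF Hg(1) hxc i, of p] by simp
    qed
    moreover have "h x [^]\<^bsub>?D\<^esub> p \<in> carrier ?D"
      using D.nat_pow_closed[OF hxc] .
    ultimately have "h x [^]\<^bsub>?D\<^esub> p = \<one>\<^bsub>?D\<^esub>"
      by (auto simp: fun_eq_iff PiE_iff extensional_def restrict_def)
    then show "h (x [^]\<^bsub>G\<^esub> p) = h \<one>\<^bsub>G\<^esub>"
      using h.hom_nat_pow[OF xc, of p] h.hom_one by simp
  qed (use x in simp_all)
  have "comm_group ?P"
    by (rule PG.group_comm_groupI) (simp add: comm)
  moreover have "PG.ord x = p" if "x \<in> carrier ?P" "x \<noteq> \<one>\<^bsub>?P\<^esub>" for x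
    using PG.prime_ord[OF p that(1)] exp[of x] that pw by simp
  ultimately show "elementary_abelian ?P"
    unfolding elementary_abelian_def using p by blast
qed

section \<open>Decomposition of a finite abelian group into Sylow subgroups\<close>

definition sylow_choice :: "('a, 'b) monoid_scheme \<Rightarrow> nat \<Rightarrow> 'a set" where
  "sylow_choice G p = (SOME P. sylow_subgroup G p P)"

text \<open>\<open>G\<close> may carry additional record fields, whereas the factors in
  \<open>direct_product_of_elementary_abelian\<close> have type \<open>'a monoid\<close>; the
  operations are copied into a plain record.\<close>

definition sylow_group :: "('a, 'b) monoid_scheme \<Rightarrow> nat \<Rightarrow> 'a monoid" where
  "sylow_group G p = \<lparr>carrier = sylow_choice G p, monoid.mult = monoid.mult G, one = \<one>\<^bsub>G\<^esub>\<rparr>"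

lemma (in group) sylow_choice:
  assumes "finite (carrier G)" "Factorial_Ring.prime (p::nat)"
  shows "sylow_subgroup G p (sylow_choice G p)"
proof -
  obtain P where "subgroup P G" "card P = p ^ multiplicity p (order G)"
    using ex_sylow[OF assms] by blast
  then have "sylow_subgroup G p P"
    by (simp add: sylow_subgroup_def)
  then show ?thesis
    unfolding sylow_choice_def by (rule someI)
qed

lemma sylow_group_simps [simp]:
  "carrier (sylow_group G p) = sylow_choice G p" "x \<otimes>\<^bsub>sylow_group G p\<^esub> y = x \<otimes>\<^bsub>G\<^esub> y"
  "\<one>\<^bsub>sylow_group G p\<^esub> = \<one>\<^bsub>G\<^esub>"
  by (simp_all add: sylow_group_def)

lemma sylow_group_nat_pow [simp]: "x [^]\<^bsub>sylow_group G p\<^esub> (n::nat) = x [^]\<^bsub>G\<^esub> n"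
  by (induction n) simp_all

lemma (in group) sylow_group_group:
  assumes "finite (carrier G)" "Factorial_Ring.prime (p::nat)"
  shows "group (sylow_group G p)"
proof -
  have S: "subgroup (sylow_choice G p) G"
    using sylow_choice[OF assms] by (simp add: sylow_subgroup_def)
  interpret S: subgroup "sylow_choice G p" G by (rule S)
  show ?thesis
  proof (rule groupI)
    show "\<exists>y\<in>carrier (sylow_group G p). y \<otimes>\<^bsub>sylow_group G p\<^esub> x = \<one>\<^bsub>sylow_group G p\<^esub>"
      if "x \<in> carrier (sylow_group G p)" for x
      using that by (intro bexI[of _ "inv x"]) simp_all
  qed (simp_all add: m_assoc)
qed

text \<open>The coordinate at p is g^e, where e is the part of |G| prime to p. The order of an
  element killed by all these exponents has no prime divisor, so the map is injective; surjectivity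
  follows by counting.\<close>

lemma (in comm_group) iso_product_sylow:
  assumes fin: "finite (carrier G)"
  shows "G \<cong> product_group (prime_factors (order G)) (sylow_group G)"
proof -
  let ?n = "order G"
  let ?I = "prime_factors ?n"
  let ?D = "product_group ?I (sylow_group G)"
  have pos: "?n \<noteq> 0"
    using fin order_gt_0_iff_finite by simp
  define e where "e p = ?n div p ^ multiplicity p ?n" for p
  have e: "?n = p ^ multiplicity p ?n * e p" for p
    unfolding e_def by (simp add: multiplicity_dvd)
  have pr: "Factorial_Ring.prime p" if "p \<in> ?I" for p
    using that by blast
  have ne: "\<not> p dvd e p" if pI: "p \<in> ?I" for p
  proof -
    obtain m where m: "?n = p ^ multiplicity p ?n * m" "\<not> p dvd m"
      using multiplicity_decompose'[OF pos, of p] pr[OF pI] not_prime_unit by metis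
    then have "e p = m"
      using e[of p] prime_gt_0_nat[OF pr[OF pI]] by (metis mult_cancel1 power_not_zero less_irrefl)
    then show ?thesis
      using m(2) by simp
  qed
  have S: "subgroup (sylow_choice G p) G" "card (sylow_choice G p) = p ^ multiplicity p ?n" if "p \<in> ?I" for p
    using sylow_choice[OF fin pr[OF that]] by (simp_all add: sylow_subgroup_def)
  \<comment> \<open>In an abelian group conjugation into the chosen Sylow subgroup is trivial, so
    that subgroup already contains the element.\<close>
  have mem: "x \<in> sylow_choice G p" if p: "p \<in> ?I" and x: "x \<in> carrier G" "x [^] (p ^ multiplicity p ?n) = \<one>" for p x
  proof -
    have "ord x dvd p ^ multiplicity p ?n"
      using pow_eq_id[OF x(1)] x(2) by blast
    then obtain b where b: "ord x = p ^ b"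
      using divides_primepow_nat[OF pr[OF p]] by blast
    have U: "subgroup (generate G {x}) G" "card (generate G {x}) = p ^ b"
      using generate_is_subgroup[of "{x}"] generate_pow_card[OF x(1)] x(1) b by simp_all
    have "order G div card (sylow_choice G p) = e p"
      using S(2)[OF p] by (simp add: e_def)
    then obtain c where c: "c \<in> carrier G" "\<And>u. u \<in> generate G {x} \<Longrightarrow> c \<otimes> u \<otimes> inv c \<in> sylow_choice G p"
      using sylow_conj_subset[OF fin pr[OF p] S(1)[OF p] _ U] ne[OF p] by auto
    have "c \<otimes> x \<otimes> inv c \<in> sylow_choice G p"
      by (rule c(2)[OF generate.incl]) simp
    moreover have "c \<otimes> x \<otimes> inv c = x"
      using conj_eq_iff_commute[OF c(1) x(1) x(1)] m_comm[OF c(1) x(1)] by blast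
    ultimately show ?thesis by simp
  qed
  define \<phi> where "\<phi> g = (\<lambda>p\<in>?I. g [^] e p)" for g
  have \<phi>c: "\<phi> g \<in> carrier ?D" if g: "g \<in> carrier G" for g
  proof -
    have "g [^] e p \<in> sylow_choice G p" if p: "p \<in> ?I" for p
    proof (rule mem[OF p])
      have "(g [^] e p) [^] (p ^ multiplicity p ?n) = g [^] ?n"
        using e[of p] g by (simp add: nat_pow_pow mult.commute)
      then show "(g [^] e p) [^] (p ^ multiplicity p ?n) = \<one>"
        using pow_order_eq_1[OF g] by simp
    qed (use g in simp)
    then show ?thesis
      unfolding \<phi>_def by auto
  qed
  have "\<phi> \<in> hom G ?D"
  proof (rule homI[OF \<phi>c])
    fix g h assume "g \<in> carrier G" "h \<in> carrier G"
    then show "\<phi> (g \<otimes> h) = \<phi> g \<otimes>\<^bsub>?D\<^esub> \<phi> h"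
      unfolding \<phi>_def by (auto simp: nat_pow_distrib intro!: restrict_ext)
  qed
  moreover have inj: "inj_on \<phi> (carrier G)"
  proof (rule inj_onI)
    fix g h assume g: "g \<in> carrier G" and h: "h \<in> carrier G" and eq: "\<phi> g = \<phi> h"
    let ?x = "g \<otimes> inv h"
    have xc: "?x \<in> carrier G" using g h by simp
    have dv: "ord ?x dvd e p" if p: "p \<in> ?I" for p
    proof -
      have "g [^] e p = h [^] e p"
        using fun_cong[OF eq, of p] p by (simp add: \<phi>_def)
      then have "?x [^] e p = \<one>"
        using g h by (simp add: nat_pow_distrib nat_pow_inv)
      then show ?thesis
        using pow_eq_id[OF xc] by blast
    qed
    have "ord ?x = 1"
    proof (rule ccontr)
      assume "ord ?x \<noteq> 1"
      then obtain r where r: "Factorial_Ring.prime r" "r dvd ord ?x"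
        using prime_factor_nat by blast
      then have "r dvd ?n"
        using ord_dvd_group_order[OF xc] dvd_trans by blast
      then have "r \<in> ?I"
        using r(1) pos by (simp add: prime_factors_dvd)
      then show False
        using dv ne r(2) dvd_trans by blast
    qed
    then have "?x = \<one>"
      using ord_eq_1[OF xc] by blast
    then show "g = h"
      using g h inv_solve_right'[of \<one> g h] by simp
  qed
  moreover have "\<phi> ` carrier G = carrier ?D"
  proof (rule card_subset_eq)
    have "finite (sylow_choice G p)" if "p \<in> ?I" for p
      using subgroup.subset[OF S(1)[OF that]] fin finite_subset by blast
    then show "finite (carrier ?D)"
      by (auto intro!: finite_PiE)
    show "\<phi> ` carrier G \<subseteq> carrier ?D"
      using \<phi>c by blast
    have "card (carrier ?D) = (\<Prod>p\<in>?I. card (sylow_choice G p))"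
      by (simp add: card_PiE)
    also have "\<dots> = (\<Prod>p\<in>?I. p ^ multiplicity p ?n)"
      using S(2) by (intro prod.cong) auto
    also have "\<dots> = ?n"
      using prime_factorization_nat[of ?n] pos by simp
    finally show "card (\<phi> ` carrier G) = card (carrier ?D)"
      using inj by (simp add: card_image order_def)
  qed
  ultimately have "\<phi> \<in> iso G ?D"
    by (simp add: iso_def bij_betw_def)
  then show ?thesis
    by (rule is_isoI)
qed

lemma sylow_group_elementary_abelian:
  assumes G: "comm_group G" "finite (carrier G)" and p: "Factorial_Ring.prime (p::nat)"
    and ea: "elementary_abelian (G\<lparr>carrier := sylow_choice G p\<rparr>)"
  shows "elementary_abelian (sylow_group G p)"
proof -
  interpret G: comm_group G by (rule G)
  let ?K = "G\<lparr>carrier := sylow_choice G p\<rparr>"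
  interpret S: group "sylow_group G p"
    by (rule G.sylow_group_group[OF G(2) p])
  have sub: "subgroup (sylow_choice G p) G"
    using G.sylow_choice[OF G(2) p] by (simp add: sylow_subgroup_def)
  interpret K: group ?K
    by (rule subgroup.subgroup_is_group[OF sub G.is_group])
  obtain r where r: "Factorial_Ring.prime (r::nat)" "\<And>x. x \<in> carrier ?K \<Longrightarrow> x \<noteq> \<one>\<^bsub>?K\<^esub> \<Longrightarrow> K.ord x = r"
    using ea unfolding elementary_abelian_def by blast
  have "S.ord x = r" if x: "x \<in> carrier (sylow_group G p)" "x \<noteq> \<one>\<^bsub>sylow_group G p\<^esub>" for x
  proof (rule S.prime_ord[OF r(1) x(1) _ x(2)])
    have "x [^]\<^bsub>?K\<^esub> K.ord x = \<one>\<^bsub>?K\<^esub>"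
      using K.pow_ord_eq_1[of x] x(1) by simp
    then show "x [^]\<^bsub>sylow_group G p\<^esub> r = \<one>\<^bsub>sylow_group G p\<^esub>"
      using r(2)[of x] x by (simp flip: G.nat_pow_consistent)
  qed
  moreover have "comm_group (sylow_group G p)"
    by (rule S.group_comm_groupI) (use subgroup.mem_carrier[OF sub] in \<open>auto intro!: G.m_comm\<close>)
  ultimately show ?thesis
    unfolding elementary_abelian_def using r(1) by blast
qed

lemma direct_product_of_elementary_abelian_iff:
  assumes G: "group G" "finite (carrier G)"
  shows "direct_product_of_elementary_abelian G \<longleftrightarrow> comm_group G \<and>
    (\<forall>p\<in>prime_factors (order G). \<forall>P. sylow_subgroup G p P \<longrightarrow> elementary_abelian (G\<lparr>carrier := P\<rparr>))"
proof
  assume "direct_product_of_elementary_abelian G"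
  then show "comm_group G \<and>
    (\<forall>p\<in>prime_factors (order G). \<forall>P. sylow_subgroup G p P \<longrightarrow> elementary_abelian (G\<lparr>carrier := P\<rparr>))"
    using elementary_abelian_sylow_of_product[OF G] by blast
next
  assume *: "comm_group G \<and>
    (\<forall>p\<in>prime_factors (order G). \<forall>P. sylow_subgroup G p P \<longrightarrow> elementary_abelian (G\<lparr>carrier := P\<rparr>))"
  then interpret comm_group G by simp
  have "elementary_abelian (sylow_group G p)" if p: "p \<in> prime_factors (order G)" for p
  proof -
    have pp: "Factorial_Ring.prime p"
      using p by blast
    show ?thesis
      using sylow_group_elementary_abelian[OF _ G(2) pp] * p sylow_choice[OF G(2) pp] by blast
  qed
  then show "direct_product_of_elementary_abelian G"
    unfolding direct_product_of_elementary_abelian_def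
    using iso_product_sylow[OF G(2)] by (intro exI[of _ "prime_factors (order G)"] exI[of _ "sylow_group G"]) simp
qed

section \<open>Fixed-point-free roots of inversion\<close>

text \<open>The case j = k is excluded from the last condition because inversion fixes the elements
  of order 2.\<close>

definition inversion_root :: "nat \<Rightarrow> ('a, 'b) monoid_scheme \<Rightarrow> ('a \<Rightarrow> 'a) \<Rightarrow> bool" where
  "inversion_root k G \<beta> \<longleftrightarrow> \<beta> \<in> iso G G \<and> (\<forall>x\<in>carrier G. (\<beta> ^^ k) x = inv\<^bsub>G\<^esub> x) \<and>
    (\<forall>x\<in>carrier G. \<forall>j. x \<noteq> \<one>\<^bsub>G\<^esub> \<longrightarrow> 0 < j \<longrightarrow> j < k \<longrightarrow> (\<beta> ^^ j) x \<noteq> x)"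

lemma iso_funpow: "\<beta> \<in> iso G G \<Longrightarrow> \<beta> ^^ n \<in> iso G G"
proof (induction n)
  case 0
  then show ?case using id_iso[of G] by (simp only: funpow.simps)
next
  case (Suc n)
  then show ?case
    using iso_set_trans[of "\<beta> ^^ n" G G \<beta> G] by (simp only: funpow.simps)
qed

text \<open>Every orbit of \<open>\<beta>\<close> on \<open>G\<^sup>*\<close> has length divisible by \<open>k\<close>, so its elements can be coloured
  cyclically with \<open>k\<close> colours; \<open>\<beta>\<close> permutes the colours and \<open>\<beta>\<^sup>k\<close>, which is inversion, fixes them.\<close>

lemma (in group) k_if_of_inversion_root:
  assumes G: "carrier G \<noteq> {\<one>}" and \<beta>: "inversion_root k G \<beta>" and k: "2 \<le> k"
  shows "k_if_property k G"
proof -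
  define D where "D = carrier G - {\<one>}"
  have iso: "\<beta> ^^ n \<in> iso G G" for n
    using \<beta> iso_funpow unfolding inversion_root_def by blast
  have closed: "(\<beta> ^^ n) x \<in> carrier G" if "x \<in> carrier G" for n x
    using iso[of n] that unfolding iso_def hom_def by blast
  have inj: "(\<beta> ^^ n) x = (\<beta> ^^ n) y \<longleftrightarrow> x = y" if "x \<in> carrier G" "y \<in> carrier G" for n x y
    using iso[of n] that unfolding iso_def bij_betw_def by (auto simp: inj_on_eq_iff)
  have one: "(\<beta> ^^ n) \<one> = \<one>" for n
    using iso[of n] hom_one[OF _ is_group is_group] unfolding iso_def by blast
  have XX: "(\<beta> ^^ n) x \<in> D" if "x \<in> D" for n x
    using that closed inj[of x \<one> n] one[of n] unfolding D_def by auto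
  have root: "(\<beta> ^^ k) x = inv x" if "x \<in> D" for x
    using \<beta> that unfolding inversion_root_def D_def by blast
  have free: "(\<beta> ^^ j) x \<noteq> x" if "x \<in> D" "0 < j" "j < k" for x j
    using \<beta> that unfolding inversion_root_def D_def by blast
  have Xc: "x \<in> carrier G" if "x \<in> D" for x
    using that unfolding D_def by blast
  have add: "(\<beta> ^^ (m + n)) x = (\<beta> ^^ m) ((\<beta> ^^ n) x)" for m n x
    by (simp add: funpow_add)
  have period: "(\<beta> ^^ (2 * k * n)) x = x" if "x \<in> D" for n x
  proof (induction n)
    case (Suc n)
    have "(\<beta> ^^ (2 * k)) x = x"
      using add[of k k x] root[OF that] root[OF XX[OF that, of k]] Xc[OF that] by (simp add: mult_2)
    then show ?case
      using add[of "2 * k" "2 * k * n" x] Suc by simp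
  qed simp
  \<comment> \<open>Write d = k m + e with 0 < e < k. Since \<beta>^k is inversion, \<beta>^(k m) x
    is x or \<beta>^k x. The first gives a fixed point of \<beta>^e; the second gives \<beta>^(e +
    k) x = x and, as \<beta>^(2 k) is the identity, a fixed point of \<beta>^(k - e).\<close>
  have fix_dvd: "k dvd d" if x: "x \<in> D" and d: "(\<beta> ^^ d) x = x" for x d
  proof (rule ccontr)
    assume nd: "\<not> k dvd d"
    define e where "e = d mod k"
    have e: "0 < e" "e < k"
      using nd k unfolding e_def by (auto simp: dvd_eq_mod_eq_0)
    have "(\<beta> ^^ (k * n)) x = x \<or> (\<beta> ^^ (k * n)) x = inv x" for n
    proof (induction n)
      case (Suc n)
      have "(\<beta> ^^ (k * Suc n)) x = (\<beta> ^^ k) ((\<beta> ^^ (k * n)) x)"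
        using add[of k "k * n" x] by simp
      then show ?case
        using Suc root[OF XX[OF x, of "k * n"]] Xc[OF x] by auto
    qed simp
    then have "(\<beta> ^^ (k * (d div k))) x = x \<or> (\<beta> ^^ (k * (d div k))) x = (\<beta> ^^ k) x"
      using root[OF x] by simp
    moreover have "(\<beta> ^^ e) ((\<beta> ^^ (k * (d div k))) x) = x"
      using add[of e "k * (d div k)" x] d by (simp add: e_def)
    ultimately have "(\<beta> ^^ e) x = x \<or> (\<beta> ^^ e) ((\<beta> ^^ k) x) = x"
      by auto
    then have ex: "(\<beta> ^^ e) ((\<beta> ^^ k) x) = x"
      using free[OF x e] by blast
    have "(\<beta> ^^ k) x = (\<beta> ^^ (k - e)) ((\<beta> ^^ e) x)"
      using add[of "k - e" e x] e by simp
    have "(\<beta> ^^ (e + k)) x = x"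
      using ex add by simp
    then have "(\<beta> ^^ (k - e)) x = (\<beta> ^^ (k - e)) ((\<beta> ^^ (e + k)) x)"
      by simp
    also have "\<dots> = (\<beta> ^^ (2 * k * 1)) x"
      using add[of "k - e" "e + k" x] e by (simp add: mult_2)
    also have "\<dots> = x"
      by (rule period[OF x])
    finally show False
      using free[OF x, of "k - e"] e by simp
  qed
  define Orb where "Orb x = range (\<lambda>n. (\<beta> ^^ n) x)" for x
  \<comment> \<open>The base point is chosen from the orbit as a set, so all points of an orbit
    share it.\<close>
  define \<rho> where "\<rho> x = (SOME y. y \<in> Orb x)" for x
  have self: "x \<in> Orb x" for x
    unfolding Orb_def using rangeI[of "\<lambda>n. (\<beta> ^^ n) x" 0] by simp
  \<comment> \<open>The inverse of \<beta>^n is expressed with the natural exponent 2 k n -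
    n.\<close>
  have back_pow: "x = (\<beta> ^^ (2 * k * n - n)) ((\<beta> ^^ n) x)" if "x \<in> D" for n x
  proof -
    have "n \<le> 2 * k * n"
      using k by simp
    then show ?thesis
      using add[of "2 * k * n - n" n x] period[OF that, of n] by simp
  qed
  have Orb_eq: "Orb ((\<beta> ^^ n) x) = Orb x" if x: "x \<in> D" for n x
  proof
    show "Orb ((\<beta> ^^ n) x) \<subseteq> Orb x"
      unfolding Orb_def using add[symmetric] by auto
    show "Orb x \<subseteq> Orb ((\<beta> ^^ n) x)"
    proof
      fix y assume "y \<in> Orb x"
      then obtain m where m: "y = (\<beta> ^^ m) x"
        unfolding Orb_def by blast
      then have "y = (\<beta> ^^ (m + (2 * k * n - n))) ((\<beta> ^^ n) x)"
        using back_pow[OF x, of n] add[of m "2 * k * n - n" "(\<beta> ^^ n) x"] by simp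
      then show "y \<in> Orb ((\<beta> ^^ n) x)"
        unfolding Orb_def by blast
    qed
  qed
  have \<rho>_eq: "\<rho> ((\<beta> ^^ n) x) = \<rho> x" if "x \<in> D" for n x
    unfolding \<rho>_def Orb_eq[OF that] ..
  have \<rho>_Orb: "\<rho> x \<in> Orb x" for x
    unfolding \<rho>_def using self by (rule someI)
  have \<rho>X: "\<rho> x \<in> D" if "x \<in> D" for x
    using \<rho>_Orb[of x] XX[OF that] unfolding Orb_def by auto
  have \<rho>\<rho>: "\<rho> (\<rho> x) = \<rho> x" if "x \<in> D" for x
    using \<rho>_Orb[of x] \<rho>_eq[OF that] unfolding Orb_def by auto
  have ex_pow: "\<exists>j. x = (\<beta> ^^ j) (\<rho> x)" if x: "x \<in> D" for x
  proof -
    obtain n where "\<rho> x = (\<beta> ^^ n) x"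
      using \<rho>_Orb[of x] unfolding Orb_def by blast
    then show ?thesis
      using back_pow[OF x, of n] by metis
  qed
  \<comment> \<open>The colour of x is its distance from the base point modulo k; by
    \<open>fix_dvd\<close> it does not depend on the exponent chosen.\<close>
  define T where "T i = {x \<in> D. \<exists>j. x = (\<beta> ^^ j) (\<rho> x) \<and> j mod k = i}" for i
  have T_X: "(\<Union>i<k. T i) = D"
  proof (intro equalityI subsetI)
    fix x assume "x \<in> (\<Union>i<k. T i)"
    then show "x \<in> D"
      unfolding T_def by blast
  next
    fix x assume x: "x \<in> D"
    obtain j where "x = (\<beta> ^^ j) (\<rho> x)"
      using ex_pow[OF x] by blast
    then have "x \<in> T (j mod k)" "j mod k < k"
      using x k unfolding T_def by auto
    then show "x \<in> (\<Union>i<k. T i)"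
      by blast
  qed
  have T_unique: "i = i'" if ti: "x \<in> T i" "x \<in> T i'" for x i i'
  proof -
    obtain j j' where j: "x \<in> D" "x = (\<beta> ^^ j) (\<rho> x)" "x = (\<beta> ^^ j') (\<rho> x)" "j mod k = i" "j' mod k = i'"
      using ti unfolding T_def by blast
    have *: "a mod k = b mod k" if "a \<le> b" "(\<beta> ^^ a) (\<rho> x) = (\<beta> ^^ b) (\<rho> x)" for a b
    proof -
      have "(\<beta> ^^ a) ((\<beta> ^^ (b - a)) (\<rho> x)) = (\<beta> ^^ a) (\<rho> x)"
        using add[of a "b - a" "\<rho> x"] that by simp
      then have "(\<beta> ^^ (b - a)) (\<rho> x) = \<rho> x"
        using inj closed Xc[OF \<rho>X[OF j(1)]] by blast
      then have "k dvd b - a"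
        by (rule fix_dvd[OF \<rho>X[OF j(1)]])
      then show ?thesis
        using that(1) by (metis mod_eq_dvd_iff_nat)
    qed
    have "(\<beta> ^^ j) (\<rho> x) = (\<beta> ^^ j') (\<rho> x)"
      using j(2,3) by (rule trans[OF sym])
    then show ?thesis
      using *[of j j'] *[of j' j] j(4,5) by (metis nat_le_linear)
  qed
  have T_step: "(\<beta> ^^ n) x \<in> T ((i + n) mod k)" if xT: "x \<in> T i" for n x i
  proof -
    obtain j where j: "x \<in> D" "x = (\<beta> ^^ j) (\<rho> x)" "j mod k = i"
      using xT unfolding T_def by blast
    have "(\<beta> ^^ n) x = (\<beta> ^^ (n + j)) (\<rho> x)"
      using add[of n j "\<rho> x"] j(2) by simp
    then have "(\<beta> ^^ n) x = (\<beta> ^^ (n + j)) (\<rho> ((\<beta> ^^ n) x))"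
      unfolding \<rho>_eq[OF j(1)] .
    moreover have "(n + j) mod k = (i + n) mod k"
      using j(3) by (metis add.commute mod_add_left_eq)
    ultimately show ?thesis
      using XX[OF j(1)] unfolding T_def by blast
  qed
  have T_image: "(\<beta> ^^ i) ` T 0 = T i" if i: "i < k" for i
  proof
    show "(\<beta> ^^ i) ` T 0 \<subseteq> T i"
      using T_step[of _ 0 i] i by auto
    show "T i \<subseteq> (\<beta> ^^ i) ` T 0"
    proof
      fix x assume xT: "x \<in> T i"
      then have x: "x \<in> D"
        unfolding T_def by blast
      let ?n = "2 * k * i - i"
      have "(i + ?n) mod k = 0"
        using k by simp
      then have "(\<beta> ^^ ?n) x \<in> T 0"
        using T_step[OF xT, of ?n] by simp
      moreover have "(\<beta> ^^ i) ((\<beta> ^^ ?n) x) = x"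
        using add[of i ?n x] period[OF x, of i] k by simp
      ultimately show "x \<in> (\<beta> ^^ i) ` T 0"
        by (metis imageI)
    qed
  qed
  have T_ic: "inverse_closed G (T i)" if i: "i < k" for i
  proof (rule inverse_closedI)
    show "T i \<subseteq> carrier G" "\<one> \<notin> T i"
      unfolding T_def D_def by auto
    fix x assume xT: "x \<in> T i"
    then have "x \<in> D"
      unfolding T_def by blast
    then have "inv x = (\<beta> ^^ k) x"
      using root by simp
    then show "inv x \<in> T i"
      using T_step[OF xT, of k] i by simp
  qed
  obtain x0 where x0: "x0 \<in> D"
    using G unfolding D_def by blast
  have "\<rho> x0 = (\<beta> ^^ 0) (\<rho> (\<rho> x0)) \<and> 0 mod k = 0"
    unfolding funpow_0 mod_0 by (rule conjI[OF \<rho>\<rho>[OF x0, symmetric] refl])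
  then have \<rho>x0: "\<rho> x0 \<in> T 0"
    unfolding T_def mem_Collect_eq by (intro conjI[OF \<rho>X[OF x0]] exI[of _ 0])
  then have T_ne: "T i \<noteq> {}" if "i < k" for i
    unfolding T_image[OF that, symmetric] image_is_empty using \<rho>x0 by (rule_tac ex_in_conv[THEN iffD1, OF exI])
  have T_inj: "inj_on T {..<k}"
  proof (rule inj_onI)
    fix i j assume ij: "i \<in> {..<k}" "j \<in> {..<k}" "T i = T j"
    then obtain x where x: "x \<in> T i"
      using T_ne[of i] by auto
    from x show "i = j"
      by (rule T_unique) (use x ij(3) in simp)
  qed
  have "partition_on D (T ` {..<k})"
  proof (rule partition_onI)
    show "\<Union> (T ` {..<k}) = D"
      using T_X by blast
    show "disjnt A B" if AB: "A \<in> T ` {..<k}" "B \<in> T ` {..<k}" "A \<noteq> B" for A B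
    proof -
      obtain i j where ij: "A = T i" "B = T j"
        using AB(1,2) by (elim imageE)
      then have "i \<noteq> j"
        using AB(3) ij by (intro notI) simp
      then show ?thesis
        unfolding disjnt_iff ij using T_unique by metis
    qed
    show "{} \<notin> T ` {..<k}"
      using T_ne by (auto simp del: lessThan_iff simp: image_iff lessThan_iff)
  qed
  moreover have "card (T ` {..<k}) = k"
    using T_inj by (simp add: card_image)
  moreover have "inverse_closed G A \<and> graph_iso (cayley_graph G A) (cayley_graph G (T 0))" if A: "A \<in> T ` {..<k}" for A
  proof -
    obtain i where i: "i < k" "A = T i"
      using A by blast
    have "graph_iso (cayley_graph G (T 0)) (cayley_graph G (T i))"
      using auto_graph_iso(2)[OF T_ic[of 0] iso[of i]] T_image[OF i(1)] k by simp
    then show ?thesis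
      using graph_iso_sym T_ic i by blast
  qed
  moreover have "T 0 \<in> T ` {..<k}" "inverse_closed G (T 0)"
    using k T_ic[of 0] by auto
  ultimately show ?thesis
    unfolding k_if_property_def k_if_cayley_graph_def D_def
    by (intro exI[of _ "T 0"] conjI exI[of _ "T ` {..<k}"]) blast+
qed

text \<open>All factors share the same k, and a nontrivial element has a nontrivial coordinate,
  which is moved by every power with exponent strictly between 0 and k.\<close>

lemma inversion_root_product:
  assumes H: "\<And>i. i \<in> I \<Longrightarrow> group (H i)" and \<beta>: "\<And>i. i \<in> I \<Longrightarrow> inversion_root k (H i) (\<beta> i)"
  shows "inversion_root k (product_group I H) (\<lambda>f. \<lambda>i\<in>I. \<beta> i (f i))"
proof -
  let ?D = "product_group I H"
  let ?b = "\<lambda>f. \<lambda>i\<in>I. \<beta> i (f i)"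
  have b: "\<beta> i \<in> hom (H i) (H i)" "bij_betw (\<beta> i) (carrier (H i)) (carrier (H i))" if "i \<in> I" for i
    using \<beta>[OF that] by (auto simp: inversion_root_def iso_def)
  have c: "\<beta> i x \<in> carrier (H i)" if "i \<in> I" "x \<in> carrier (H i)" for i x
    using b(1)[OF that(1)] that(2) by (auto simp: hom_def)
  have bc: "?b f \<in> carrier ?D" if "f \<in> carrier ?D" for f
    using that c by (auto simp: PiE_iff)
  have pw: "(?b ^^ n) f = (\<lambda>i\<in>I. (\<beta> i ^^ n) (f i))" if "f \<in> carrier ?D" for n f
  proof (induction n)
    case 0
    then show ?case using that by (auto simp: fun_eq_iff PiE_iff extensional_def)
  next
    case (Suc n)
    show ?case
      unfolding funpow.simps comp_apply Suc by (auto intro!: restrict_ext)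
  qed
  have "?b \<in> iso ?D ?D"
  proof (rule isoI)
    show "?b \<in> hom ?D ?D"
    proof (rule homI[OF bc])
      fix f g assume "f \<in> carrier ?D" "g \<in> carrier ?D"
      then show "?b (f \<otimes>\<^bsub>?D\<^esub> g) = ?b f \<otimes>\<^bsub>?D\<^esub> ?b g"
        using b(1) by (auto simp: hom_def PiE_iff intro!: restrict_ext)
    qed
    define b' where "b' f = (\<lambda>i\<in>I. inv_into (carrier (H i)) (\<beta> i) (f i))" for f
    show "bij_betw ?b (carrier ?D) (carrier ?D)"
    proof (rule bij_betw_byWitness[where f' = b'])
      show "\<forall>f\<in>carrier ?D. b' (?b f) = f"
        using bij_betw_inv_into_left[OF b(2)] by (auto simp: b'_def fun_eq_iff PiE_iff extensional_def)
      show "\<forall>f\<in>carrier ?D. ?b (b' f) = f"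
        using bij_betw_inv_into_right[OF b(2)] by (auto simp: b'_def fun_eq_iff PiE_iff extensional_def)
      show "?b ` carrier ?D \<subseteq> carrier ?D"
        using bc by blast
      show "b' ` carrier ?D \<subseteq> carrier ?D"
        using bij_betwE[OF bij_betw_inv_into[OF b(2)]] by (auto simp: b'_def PiE_iff)
    qed
  qed
  moreover have "(?b ^^ k) f = inv\<^bsub>?D\<^esub> f" if f: "f \<in> carrier ?D" for f
  proof -
    have "inv\<^bsub>?D\<^esub> f = (\<lambda>i\<in>I. inv\<^bsub>H i\<^esub> (f i))"
      using f H by (intro inv_product_group) auto
    then show ?thesis
      unfolding pw[OF f] using \<beta> f by (auto simp: inversion_root_def PiE_iff intro!: restrict_ext)
  qed
  moreover have "(?b ^^ j) f \<noteq> f" if f: "f \<in> carrier ?D" and ne: "f \<noteq> \<one>\<^bsub>?D\<^esub>" and j: "0 < j" "j < k" for f j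
  proof
    assume e: "(?b ^^ j) f = f"
    obtain i where i: "i \<in> I" "f i \<noteq> \<one>\<^bsub>H i\<^esub>"
      using f ne by (auto simp: fun_eq_iff PiE_iff extensional_def restrict_def split: if_splits)
    have "(\<beta> i ^^ j) (f i) = f i"
      using fun_cong[OF e, of i] i(1) unfolding pw[OF f] by simp
    then show False
      using \<beta>[OF i(1)] i j f by (auto simp: inversion_root_def PiE_iff)
  qed
  ultimately show ?thesis
    unfolding inversion_root_def by blast
qed

lemma inversion_root_transport:
  assumes G: "group G" and H: "group H" and h: "h \<in> iso G H" and \<beta>: "inversion_root k H \<beta>"
  obtains \<gamma> where "inversion_root k G \<gamma>"
proof -
  interpret G: group G by fact
  interpret H: group H by fact
  define h' where "h' = inv_into (carrier G) h"
  have h'iso: "h' \<in> iso H G"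
    unfolding h'_def by (rule G.iso_set_sym[OF h])
  have hb: "bij_betw h (carrier G) (carrier H)"
    using h by (simp add: iso_def)
  have hh': "h (h' y) = y" if "y \<in> carrier H" for y
    unfolding h'_def using bij_betw_inv_into_right[OF hb that] .
  have h'h: "h' (h x) = x" if "x \<in> carrier G" for x
    unfolding h'_def using bij_betw_inv_into_left[OF hb that] .
  have hc: "h x \<in> carrier H" if "x \<in> carrier G" for x
    using hb that by (auto simp: bij_betw_def)
  have \<beta>iso: "\<beta> \<in> iso H H"
    using \<beta> by (simp add: inversion_root_def)
  have bc: "(\<beta> ^^ n) y \<in> carrier H" if "y \<in> carrier H" for n y
    using iso_funpow[OF \<beta>iso, of n] that by (auto simp: iso_def hom_def)
  define \<gamma> where "\<gamma> = h' \<circ> \<beta> \<circ> h"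
  have \<gamma>iso: "\<gamma> \<in> iso G G"
    unfolding \<gamma>_def by (metis comp_assoc h h'iso iso_set_trans \<beta>iso)
  have pw: "(\<gamma> ^^ n) x = h' ((\<beta> ^^ n) (h x))" if x: "x \<in> carrier G" for n x
  proof (induction n)
    case (Suc n)
    then show ?case
      using hh'[OF bc[OF hc[OF x]]] by (simp add: \<gamma>_def)
  qed (simp add: h'h[OF x])
  have h'hom: "group_hom H G h'"
    using h'iso by (auto simp: group_hom_def group_hom_axioms_def iso_def)
  have "(\<gamma> ^^ k) x = inv\<^bsub>G\<^esub> x" if x: "x \<in> carrier G" for x
    unfolding pw[OF x] using \<beta> hc[OF x] group_hom.hom_inv[OF h'hom hc[OF x]] h'h[OF x]
    by (simp add: inversion_root_def)
  moreover have "(\<gamma> ^^ j) x \<noteq> x" if x: "x \<in> carrier G" "x \<noteq> \<one>\<^bsub>G\<^esub>" and j: "0 < j" "j < k" for x j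
  proof
    assume "(\<gamma> ^^ j) x = x"
    then have "h (h' ((\<beta> ^^ j) (h x))) = h x"
      unfolding pw[OF x(1)] by simp
    then have "(\<beta> ^^ j) (h x) = h x"
      using hh'[OF bc[OF hc[OF x(1)]]] by simp
    moreover have "h x \<noteq> \<one>\<^bsub>H\<^esub>"
    proof
      assume "h x = \<one>\<^bsub>H\<^esub>"
      then have "h' (h x) = \<one>\<^bsub>G\<^esub>"
        using group_hom.hom_one[OF h'hom] by simp
      then show False
        using h'h[OF x(1)] x(2) by simp
    qed
    ultimately show False
      using \<beta> hc[OF x(1)] j by (simp add: inversion_root_def)
  qed
  ultimately have "inversion_root k G \<gamma>"
    unfolding inversion_root_def using \<gamma>iso by blast
  then show ?thesis
    by (rule that)
qed

section \<open>Finite fields\<close>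

context cring
begin

lemma binomial_cring:
  assumes x: "x \<in> carrier R" and y: "y \<in> carrier R"
  shows "(x \<oplus> y) [^] (n::nat) = (\<Oplus>k\<in>{..n}. [(n choose k)] \<cdot> (x [^] k \<otimes> y [^] (n - k)))"
proof (induction n)
  case 0
  then show ?case using x y by simp
next
  case (Suc n)
  let ?f = "\<lambda>k. [(n choose k)] \<cdot> (x [^] k \<otimes> y [^] (n - k))"
  have c: "[m] \<cdot> (x [^] (i::nat) \<otimes> y [^] (j::nat)) \<in> carrier R" for m i j :: nat
    using x y by simp
  have fx: "?f k \<otimes> x = [(n choose k)] \<cdot> (x [^] Suc k \<otimes> y [^] (Suc n - Suc k))" for k
    using x y by (subst add_pow_ldistr) (auto simp: m_ac)
  have fy: "?f k \<otimes> y = [(n choose k)] \<cdot> (x [^] k \<otimes> y [^] (Suc n - k))" if "k \<in> {..n}" for k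
    using x y that by (simp add: add_pow_ldistr m_assoc Suc_diff_le)
  let ?a = "\<lambda>k. [(n choose k)] \<cdot> (x [^] Suc k \<otimes> y [^] (Suc n - Suc k))"
  let ?b = "\<lambda>k. [(n choose Suc k)] \<cdot> (x [^] Suc k \<otimes> y [^] (Suc n - Suc k))"
  let ?g = "\<lambda>k. [(n choose k)] \<cdot> (x [^] k \<otimes> y [^] (Suc n - k))"
  let ?h = "\<lambda>k. [(Suc n choose k)] \<cdot> (x [^] k \<otimes> y [^] (Suc n - k))"
  have "(x \<oplus> y) [^] Suc n = finsum R ?f {..n} \<otimes> x \<oplus> finsum R ?f {..n} \<otimes> y"
    unfolding nat_pow_Suc Suc using x y by (intro r_distr) auto
  also have "finsum R ?f {..n} \<otimes> x = finsum R ?a {..n}"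
    using x c by (subst finsum_ldistr) (auto simp: fx)
  also have "finsum R ?f {..n} \<otimes> y = finsum R ?g {..n}"
  proof -
    have "finsum R ?f {..n} \<otimes> y = finsum R (\<lambda>k. ?f k \<otimes> y) {..n}"
      using y c by (intro finsum_ldistr) auto
    also have "\<dots> = finsum R ?g {..n}"
      using c by (intro add.finprod_cong' fy) auto
    finally show ?thesis .
  qed
  \<comment> \<open>The added term of index n + 1 has coefficient 0; it makes room for the index
    shift that follows.\<close>
  also have "finsum R ?g {..n} = finsum R ?g {..Suc n}"
    using x y c by (subst finsum_Suc) (auto simp: binomial_eq_0 simp del: nat_pow_Suc)
  also have "finsum R ?g {..Suc n} = finsum R ?b {..n} \<oplus> ?g 0"
    using x y by (intro finsum_Suc2) auto
  also have "finsum R ?a {..n} \<oplus> (finsum R ?b {..n} \<oplus> ?g 0) = (finsum R ?a {..n} \<oplus> finsum R ?b {..n}) \<oplus> ?g 0"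
    using x y by (intro a_assoc[symmetric] finsum_closed) auto
  also have "finsum R ?a {..n} \<oplus> finsum R ?b {..n} = finsum R (\<lambda>k. ?a k \<oplus> ?b k) {..n}"
    using x y by (intro finsum_addf[symmetric]) auto
  also have "finsum R (\<lambda>k. ?a k \<oplus> ?b k) {..n} = finsum R (\<lambda>k. ?h (Suc k)) {..n}"
  proof (rule add.finprod_cong')
    show "(\<lambda>k. ?h (Suc k)) \<in> {..n} \<rightarrow> carrier R"
      using x y by auto
    show "?a k \<oplus> ?b k = ?h (Suc k)" if "k \<in> {..n}" for k
      using x y add.nat_pow_mult[of "x [^] Suc k \<otimes> y [^] (Suc n - Suc k)" "n choose k" "n choose Suc k"] by simp
  qed simp
  also have "finsum R (\<lambda>k. ?h (Suc k)) {..n} \<oplus> ?g 0 = finsum R ?h {..Suc n}"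
    using x y by (subst finsum_Suc2) auto
  finally show ?case .
qed

text \<open>For n = 1 the inner binomial coefficients of p vanish in \<open>R\<close>; the general
  case iterates this.\<close>

lemma frobenius_add:
  assumes p: "Factorial_Ring.prime (p::nat)" and char: "[p] \<cdot> \<one> = \<zero>"
    and x: "x \<in> carrier R" and y: "y \<in> carrier R"
  shows "(x \<oplus> y) [^] (p ^ n) = x [^] (p ^ n) \<oplus> y [^] (p ^ n)"
proof (induction n)
  case 0
  then show ?case using x y by simp
next
  case (Suc n)
  have step: "(a \<oplus> b) [^] p = a [^] p \<oplus> b [^] p" if ab: "a \<in> carrier R" "b \<in> carrier R" for a b
  proof -
    \<comment> \<open>With p = m + 2 the inner terms are those of index \<open>Suc k\<close> with k
      \<le> m, that is, 1 up to p - 1.\<close>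
    obtain m where m: "p = Suc (Suc m)"
      using prime_ge_2_nat[OF p] by (metis Suc_le_D numeral_2_eq_2 Suc_le_mono)
    let ?f = "\<lambda>k. [(p choose k)] \<cdot> (a [^] k \<otimes> b [^] (p - k))"
    have c: "?f k \<in> carrier R" for k
      using ab by simp
    have van: "?f (Suc k) = \<zero>" if "k \<in> {..m}" for k
    proof -
      have "p dvd p choose Suc k"
        using p that m by (intro dvd_choose_prime) auto
      then obtain d where d: "p choose Suc k = p * d"
        by blast
      let ?t = "a [^] Suc k \<otimes> b [^] (p - Suc k)"
      have t: "?t \<in> carrier R" using ab by simp
      have "[p] \<cdot> ?t = \<zero>"
        using add_pow_ldistr[OF one_closed t, of p] char t by simp
      then have "[(p * d)] \<cdot> ?t = \<zero>"
        using add.nat_pow_pow[OF t, of d p] by simp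
      then show ?thesis
        unfolding d .
    qed
    have "(a \<oplus> b) [^] p = finsum R ?f {..p}"
      by (rule binomial_cring[OF ab])
    also have "\<dots> = finsum R (\<lambda>k. ?f (Suc k)) {..Suc m} \<oplus> ?f 0"
      unfolding m using ab by (intro finsum_Suc2) auto
    also have "finsum R (\<lambda>k. ?f (Suc k)) {..Suc m} = ?f (Suc (Suc m)) \<oplus> finsum R (\<lambda>k. ?f (Suc k)) {..m}"
      using ab by (intro finsum_Suc) auto
    also have "finsum R (\<lambda>k. ?f (Suc k)) {..m} = \<zero>"
      by (rule add.finprod_one_eqI[OF van])
    finally show ?thesis
      using ab by (simp add: m)
  qed
  have "(x \<oplus> y) [^] (p ^ Suc n) = ((x \<oplus> y) [^] (p ^ n)) [^] p"
    using x y by (simp add: nat_pow_pow mult.commute)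
  also have "\<dots> = (x [^] (p ^ n)) [^] p \<oplus> (y [^] (p ^ n)) [^] p"
    unfolding Suc using x y by (intro step) auto
  finally show ?case
    using x y by (simp add: nat_pow_pow mult.commute)
qed

end

section \<open>The polynomial X^q - X and the field formed by its roots\<close>

lemma ring_hom_add_pow_one:
  assumes R: "ring R" and S: "ring S" and h: "h \<in> ring_hom R S"
  shows "h ([(n::nat)] \<cdot>\<^bsub>R\<^esub> \<one>\<^bsub>R\<^esub>) = [n] \<cdot>\<^bsub>S\<^esub> \<one>\<^bsub>S\<^esub>"
proof -
  interpret R: ring R by fact
  interpret S: ring S by fact
  interpret ring_hom_ring R S h
    by (rule ring_hom_ringI2[OF R S h])
  show ?thesis
    by (induction n) simp_all
qed

text \<open>With \<open>l = X - a\<close>, the Frobenius identity turns \<open>X\<^sup>q - X\<close> into \<open>l\<^sup>q - l = l (l\<^sup>q\<^sup>-\<^sup>1 - 1)\<close>, whose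
  second factor is \<open>-1\<close> at \<open>a\<close>.\<close>

lemma (in domain) pow_diff_root_simple:
  assumes p: "Factorial_Ring.prime (p::nat)" and char: "[p] \<cdot> \<one> = \<zero>" and n: "0 < n"
    and a: "a \<in> carrier R" "a [^] (p ^ n) = a"
    and P: "P = X [^]\<^bsub>poly_ring R\<^esub> (p ^ n) \<ominus>\<^bsub>poly_ring R\<^esub> X"
  shows "\<not> [\<one>, \<ominus> a] [^]\<^bsub>poly_ring R\<^esub> (2::nat) pdivides P"
proof
  assume dv: "[\<one>, \<ominus> a] [^]\<^bsub>poly_ring R\<^esub> (2::nat) pdivides P"
  let ?U = "poly_ring R"
  interpret U: domain ?U
    by (rule univ_poly_is_domain[OF carrier_is_subring])
  have hom: "poly_of_const \<in> ring_hom R ?U"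
    using canonical_embedding_is_hom[OF carrier_is_subring] by simp
  interpret c: ring_hom_ring R ?U poly_of_const
    by (rule ring_hom_ringI2[OF ring_axioms U.ring_axioms hom])
  have charU: "[p] \<cdot>\<^bsub>?U\<^esub> \<one>\<^bsub>?U\<^esub> = \<zero>\<^bsub>?U\<^esub>"
    using ring_hom_add_pow_one[OF ring_axioms U.ring_axioms hom, of p] char c.hom_zero by simp
  define q where "q = p ^ n"
  have q2: "q \<ge> 2"
    using prime_ge_2_nat[OF p] n self_le_power[of p n] by (simp add: q_def)
  let ?A = "poly_of_const a"
  have Ac: "?A \<in> carrier ?U"
    using a(1) by simp
  have Xc: "X \<in> carrier ?U"
    by (rule var_closed(1)[OF carrier_is_subring])
  define l where "l = [\<one>, \<ominus> a]"
  have lc: "l \<in> carrier ?U"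
    using a(1) unfolding l_def sym[OF univ_poly_carrier] polynomial_def by auto
  have lA: "l \<oplus>\<^bsub>?U\<^esub> ?A = X"
    using a(1) by (auto simp: univ_poly_add l_def poly_of_const_def var_def l_neg)
  have Aq: "?A [^]\<^bsub>?U\<^esub> q = ?A"
    using c.hom_nat_pow[OF a(1), of q] a(2) by (simp add: q_def)
  have "X [^]\<^bsub>?U\<^esub> q = l [^]\<^bsub>?U\<^esub> q \<oplus>\<^bsub>?U\<^esub> ?A"
    using U.frobenius_add[OF p charU lc Ac, of n] Aq unfolding lA q_def by simp
  then have "P = (l [^]\<^bsub>?U\<^esub> q \<oplus>\<^bsub>?U\<^esub> ?A) \<ominus>\<^bsub>?U\<^esub> (l \<oplus>\<^bsub>?U\<^esub> ?A)"
    unfolding P lA q_def by simp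
  also have "\<dots> = l [^]\<^bsub>?U\<^esub> q \<ominus>\<^bsub>?U\<^esub> l"
    using lc Ac U.nat_pow_closed[OF lc, of q] by algebra
  also have "l [^]\<^bsub>?U\<^esub> q = l \<otimes>\<^bsub>?U\<^esub> l [^]\<^bsub>?U\<^esub> (q - 1)"
    using U.nat_pow_Suc2[OF lc, of "q - 1"] q2 by simp
  also have "l \<otimes>\<^bsub>?U\<^esub> l [^]\<^bsub>?U\<^esub> (q - 1) \<ominus>\<^bsub>?U\<^esub> l = l \<otimes>\<^bsub>?U\<^esub> (l [^]\<^bsub>?U\<^esub> (q - 1) \<ominus>\<^bsub>?U\<^esub> \<one>\<^bsub>?U\<^esub>)"
    using lc U.nat_pow_closed[OF lc, of "q - 1"] U.one_closed by algebra
  finally have P1: "P = l \<otimes>\<^bsub>?U\<^esub> (l [^]\<^bsub>?U\<^esub> (q - 1) \<ominus>\<^bsub>?U\<^esub> \<one>\<^bsub>?U\<^esub>)" .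
  obtain r where r: "r \<in> carrier ?U" "P = l [^]\<^bsub>?U\<^esub> (2::nat) \<otimes>\<^bsub>?U\<^esub> r"
    using dv unfolding pdivides_def factor_def l_def by blast
  have P2: "P = l \<otimes>\<^bsub>?U\<^esub> (l \<otimes>\<^bsub>?U\<^esub> r)"
    unfolding r(2) using lc r(1) by (simp add: numeral_2_eq_2 U.m_assoc)
  have l0: "l \<noteq> \<zero>\<^bsub>?U\<^esub>"
    by (simp add: l_def univ_poly_zero)
  have mc: "l [^]\<^bsub>?U\<^esub> (q - 1) \<ominus>\<^bsub>?U\<^esub> \<one>\<^bsub>?U\<^esub> \<in> carrier ?U"
    by (intro U.minus_closed U.nat_pow_closed lc U.one_closed)
  have e: "l \<otimes>\<^bsub>?U\<^esub> r = l [^]\<^bsub>?U\<^esub> (q - 1) \<ominus>\<^bsub>?U\<^esub> \<one>\<^bsub>?U\<^esub>"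
    using trans[OF P2[symmetric] P1] unfolding U.m_lcancel[OF l0 lc U.m_closed[OF lc r(1)] mc] .
  interpret E: ring_hom_cring ?U R "\<lambda>p. eval p a"
    by (rule eval_cring_hom[OF carrier_is_subring a(1)])
  have el: "eval l a = \<zero>"
    using a(1) by (simp add: l_def r_neg)
  have "eval (l \<otimes>\<^bsub>?U\<^esub> r) a = \<zero>"
    using E.hom_mult[OF lc r(1)] el E.hom_closed[OF r(1)] by simp
  moreover have "eval (l [^]\<^bsub>?U\<^esub> (q - 1)) a = \<zero> [^] (q - 1)"
    using E.ring.hom_nat_pow[OF lc, of "q - 1"] el by simp
  moreover have "\<zero> [^] (q - 1) = \<zero>"
    using q2 nat_pow_zero[of "q - 1"] by simp
  ultimately have "\<zero> \<ominus> \<one> = \<zero>"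
    unfolding e using E.hom_sub[OF U.nat_pow_closed[OF lc, of "q - 1"] U.one_closed] E.hom_one by simp
  then have "\<one> = \<zero>"
    using r_right_minus_eq[OF zero_closed one_closed] by simp
  then show False
    using one_not_zero by blast
qed

text \<open>For q at least 2 the degrees q and 1 of the two terms differ, so the leading terms
  cannot cancel.\<close>

lemma (in domain) pow_diff_degree:
  assumes q: "2 \<le> (q::nat)" and P: "P = X [^]\<^bsub>poly_ring R\<^esub> q \<ominus>\<^bsub>poly_ring R\<^esub> X"
  shows "P \<in> carrier (poly_ring R)" "degree P = q" "a \<in> carrier R \<Longrightarrow> eval P a = a [^] q \<ominus> a"
proof -
  let ?U = "poly_ring R"
  interpret U: domain ?U
    by (rule univ_poly_is_domain[OF carrier_is_subring])
  have Xc: "X \<in> carrier ?U"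
    by (rule var_closed(1)[OF carrier_is_subring])
  show Pc: "P \<in> carrier ?U"
    unfolding P using Xc by simp
  have "degree (X [^]\<^bsub>?U\<^esub> q) = q"
    unfolding unitary_monom_eq_var_pow[OF carrier_is_subring, symmetric] by (simp add: monom_def)
  moreover have "degree (\<ominus>\<^bsub>?U\<^esub> X) = 1"
    using univ_poly_a_inv_degree[OF carrier_is_subring Xc] by (simp add: var_def)
  moreover have "polynomial (carrier R) (X [^]\<^bsub>?U\<^esub> q)" "polynomial (carrier R) (\<ominus>\<^bsub>?U\<^esub> X)"
    using U.nat_pow_closed[OF Xc] U.a_inv_closed[OF Xc] unfolding univ_poly_carrier by simp_all
  ultimately show "degree P = q"
    unfolding P a_minus_def univ_poly_add using q poly_add_degree_eq[OF carrier_is_subring] by simp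
  assume a: "a \<in> carrier R"
  interpret E: ring_hom_cring ?U R "\<lambda>p. eval p a"
    by (rule eval_cring_hom[OF carrier_is_subring a])
  show "eval P a = a [^] q \<ominus> a"
    unfolding P using E.hom_sub[OF U.nat_pow_closed[OF Xc, of q] Xc] E.ring.hom_nat_pow[OF Xc, of q] eval_var[OF a] by simp
qed

text \<open>The field consists of the roots of X^q - X, q = p^n, in an algebraic closure of the
  prime field; there are q of them because the polynomial splits and its roots are simple. The
  element type is the one in which that closure is built.\<close>

theorem ex_finite_field:
  assumes p: "Factorial_Ring.prime (p::nat)" and n: "0 < n"
  obtains F :: "((int list \<times> nat) multiset \<Rightarrow> int) ring"
  where "field F" "card (carrier F) = p ^ n" "\<And>x. x \<in> carrier F \<Longrightarrow> [p] \<cdot>\<^bsub>F\<^esub> x = \<zero>\<^bsub>F\<^esub>"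
proof -
  interpret Z: residues_prime p "residue_ring (int p)"
    using p by unfold_locales simp_all
  interpret Z: field "residue_ring (int p)"
    by (rule Z.is_field)
  obtain L :: "((int list \<times> nat) multiset \<Rightarrow> int) ring"
    where L: "algebraic_closure L (Z.indexed_const ` carrier (residue_ring (int p)))"
      "Z.indexed_const \<in> ring_hom (residue_ring (int p)) L"
    by (rule Z.exists_closure)
  interpret L: algebraic_closure L "Z.indexed_const ` carrier (residue_ring (int p))"
    by (rule L(1))
  have "order (add_monoid (residue_ring (int p))) = p"
    using Z.res_carrier_eq prime_gt_0_nat[OF p] by (simp add: order_def)
  then have "[p] \<cdot>\<^bsub>residue_ring (int p)\<^esub> \<one>\<^bsub>residue_ring (int p)\<^esub> = \<zero>\<^bsub>residue_ring (int p)\<^esub>"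
    using Z.add.pow_order_eq_1[OF Z.one_closed] by simp
  moreover have "Z.indexed_const \<zero>\<^bsub>residue_ring (int p)\<^esub> = \<zero>\<^bsub>L\<^esub>"
    by (rule ring_hom_zero[OF L(2) Z.ring_axioms L.ring_axioms])
  ultimately have char: "[p] \<cdot>\<^bsub>L\<^esub> \<one>\<^bsub>L\<^esub> = \<zero>\<^bsub>L\<^esub>"
    using ring_hom_add_pow_one[OF Z.ring_axioms L.ring_axioms L(2), of p] by simp
  define q where "q = p ^ n"
  have q2: "q \<ge> 2"
    using prime_ge_2_nat[OF p] n self_le_power[of p n] by (simp add: q_def)
  define P where "P = X\<^bsub>L\<^esub> [^]\<^bsub>poly_ring L\<^esub> q \<ominus>\<^bsub>poly_ring L\<^esub> X\<^bsub>L\<^esub>"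
  note deg = L.pow_diff_degree[OF q2 P_def]
  have P0: "P \<noteq> []"
    using deg(2) q2 by auto
  define K where "K = {a \<in> carrier L. a [^]\<^bsub>L\<^esub> q = a}"
  have root: "L.is_root P a \<longleftrightarrow> a \<in> K" for a
  proof -
    have "a [^]\<^bsub>L\<^esub> q \<ominus>\<^bsub>L\<^esub> a = \<zero>\<^bsub>L\<^esub> \<longleftrightarrow> a [^]\<^bsub>L\<^esub> q = a" if "a \<in> carrier L"
      using that by (intro L.r_right_minus_eq) auto
    then show ?thesis
      using P0 unfolding L.is_root_def K_def mem_Collect_eq by (cases "a \<in> carrier L") (simp_all only: deg(3) simp_thms)
  qed
  have count: "count (L.roots P) a = (if a \<in> K then 1 else 0)" for a
  proof (cases "a \<in> K")
    case True
    have "\<not> 2 \<le> L.alg_mult P a"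
      using L.le_alg_mult_imp_pdivides[OF _ deg(1), of a 2] L.pow_diff_root_simple[OF p char n _ _ P_def[unfolded q_def]] True
      unfolding K_def q_def by blast
    moreover have "0 < L.alg_mult P a"
      using L.alg_mult_gt_zero_iff_is_root[OF deg(1)] root True by simp
    ultimately have "L.alg_mult P a = 1"
      by linarith
    then show ?thesis
      using True L.alg_mult_eq_count_roots[OF deg(1)] by simp
  next
    case False
    then have "a \<notin># L.roots P"
      using L.roots_mem_iff_is_root[OF deg(1)] root by simp
    then have "count (L.roots P) a = 0"
      unfolding not_in_iff .
    then show ?thesis
      using False by simp
  qed
  have set: "set_mset (L.roots P) = K"
    using count by (auto simp: set_mset_def split: if_splits)
  then have finK: "finite K"
    by (metis finite_set_mset)
  have "size (L.roots P) = card K"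
    unfolding size_multiset_overloaded_eq set using count by simp
  moreover have "L.splitted P"
    by (rule L.roots_over_carrier[OF deg(1)])
  ultimately have cK: "card K = q"
    using deg(2) by (simp add: L.splitted_def)
  have Kc: "K \<subseteq> carrier L"
    unfolding K_def by blast
  have frob: "(x \<oplus>\<^bsub>L\<^esub> y) [^]\<^bsub>L\<^esub> q = x [^]\<^bsub>L\<^esub> q \<oplus>\<^bsub>L\<^esub> y [^]\<^bsub>L\<^esub> q" if "x \<in> carrier L" "y \<in> carrier L" for x y
    unfolding q_def by (rule L.frobenius_add[OF p char that])
  have zq: "\<zero>\<^bsub>L\<^esub> [^]\<^bsub>L\<^esub> q = \<zero>\<^bsub>L\<^esub>"
    using q2 L.nat_pow_zero[of q] by simp
  \<comment> \<open>Closure under addition and negation comes from the additivity of the q-th power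
    map, closure under products from commutativity.\<close>
  have "subring K L"
  proof (rule L.subringI[OF Kc])
    show "\<one>\<^bsub>L\<^esub> \<in> K" unfolding K_def by simp
    show "\<ominus>\<^bsub>L\<^esub> x \<in> K" if "x \<in> K" for x
    proof -
      have x: "x \<in> carrier L" "x [^]\<^bsub>L\<^esub> q = x"
        using that unfolding K_def by auto
      have "x \<oplus>\<^bsub>L\<^esub> (\<ominus>\<^bsub>L\<^esub> x) [^]\<^bsub>L\<^esub> q = \<zero>\<^bsub>L\<^esub>"
        using frob[OF x(1) L.a_inv_closed[OF x(1)]] x zq by (simp add: L.r_neg)
      then have "(\<ominus>\<^bsub>L\<^esub> x) [^]\<^bsub>L\<^esub> q = \<ominus>\<^bsub>L\<^esub> x"
        using x(1) by (metis L.a_comm L.a_inv_closed L.minus_equality L.nat_pow_closed)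
      then show ?thesis
        using x(1) unfolding K_def by simp
    qed
    show "x \<otimes>\<^bsub>L\<^esub> y \<in> K" if "x \<in> K" "y \<in> K" for x y
      using that L.nat_pow_distrib[of x y q] unfolding K_def by simp
    show "x \<oplus>\<^bsub>L\<^esub> y \<in> K" if "x \<in> K" "y \<in> K" for x y
      using that frob[of x y] unfolding K_def by simp
  qed
  moreover have "inv\<^bsub>L\<^esub> x \<in> K" if "x \<in> K - {\<zero>\<^bsub>L\<^esub>}" for x
  proof -
    have x: "x \<in> carrier L" "x [^]\<^bsub>L\<^esub> q = x" and u: "x \<in> Units L"
      using that L.field_Units unfolding K_def by auto
    have ic: "inv\<^bsub>L\<^esub> x \<in> carrier L"
      using u by simp
    have "(inv\<^bsub>L\<^esub> x) [^]\<^bsub>L\<^esub> q \<otimes>\<^bsub>L\<^esub> x = (inv\<^bsub>L\<^esub> x \<otimes>\<^bsub>L\<^esub> x) [^]\<^bsub>L\<^esub> q"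
      using L.nat_pow_distrib[OF ic x(1), of q] x(2) by simp
    then have "(inv\<^bsub>L\<^esub> x) [^]\<^bsub>L\<^esub> q \<otimes>\<^bsub>L\<^esub> x = \<one>\<^bsub>L\<^esub>"
      using u by simp
    then have "inv\<^bsub>L\<^esub> x = (inv\<^bsub>L\<^esub> x) [^]\<^bsub>L\<^esub> q"
      using L.comm_inv_char[OF x(1) L.nat_pow_closed[OF ic]] L.m_comm[OF x(1) L.nat_pow_closed[OF ic, of q]] by simp
    then show ?thesis
      using ic unfolding K_def by simp
  qed
  ultimately have "subfield K L"
    by (rule L.subfieldI')
  then have F: "field (L\<lparr>carrier := K\<rparr>)"
    by (rule L.subfield_iff(2))
  have charF: "[p] \<cdot>\<^bsub>L\<lparr>carrier := K\<rparr>\<^esub> x = \<zero>\<^bsub>L\<lparr>carrier := K\<rparr>\<^esub>" if "x \<in> K" for x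
  proof -
    have xc: "x \<in> carrier L" using that Kc by blast
    have "[m] \<cdot>\<^bsub>L\<lparr>carrier := K\<rparr>\<^esub> x = [m] \<cdot>\<^bsub>L\<^esub> x" for m :: nat
      by (induction m) (simp_all add: add_pow_def)
    moreover have "[p] \<cdot>\<^bsub>L\<^esub> x = \<zero>\<^bsub>L\<^esub>"
      using L.add_pow_ldistr[OF ring.ring_simprules(6)[OF L.ring_axioms] xc, of p] char xc by simp
    ultimately show ?thesis by simp
  qed
  show ?thesis
    by (rule that[OF F]) (use cK charF in \<open>simp_all add: q_def\<close>)
qed

section \<open>Sufficiency of the divisibility conditions\<close>

text \<open>A power of a generator of the cyclic multiplicative group, with exponent (|R| - 1) /
  d.\<close>

lemma (in field) ex_mult_elem_of_ord:
  assumes fin: "finite (carrier R)" and d: "d dvd card (carrier R) - 1" and card: "2 \<le> card (carrier R)"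
  obtains z where "z \<in> carrier R" "z \<noteq> \<zero>" "\<And>j. z [^] (j::nat) = \<one> \<longleftrightarrow> d dvd j"
proof -
  let ?q = "card (carrier R)"
  interpret M: group "Multiplicative_Group.mult_of R"
    by (rule field_mult_group)
  have finM: "finite (carrier (Multiplicative_Group.mult_of R))"
    using fin by simp
  have cM: "card (carrier (Multiplicative_Group.mult_of R)) = ?q - 1"
    using fin by simp
  obtain a where a: "a \<in> carrier (Multiplicative_Group.mult_of R)" "carrier (Multiplicative_Group.mult_of R) = {a [^] i | i::nat. i \<in> UNIV}"
    using finite_field_mult_group_has_gen[OF fin] by blast
  have "generate (Multiplicative_Group.mult_of R) {a} = {a [^]\<^bsub>Multiplicative_Group.mult_of R\<^esub> i | i::nat. i \<in> UNIV}"
    by (rule M.generate_pow_on_finite_carrier[OF finM a(1)])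
  then have "generate (Multiplicative_Group.mult_of R) {a} = carrier (Multiplicative_Group.mult_of R)"
    unfolding Multiplicative_Group.nat_pow_mult_of a(2)[symmetric] .
  then have ord: "M.ord a = ?q - 1"
    using M.generate_pow_card[OF a(1)] cM by simp
  define z where "z = a [^] ((?q - 1) div d)"
  obtain e where e: "?q - 1 = d * e"
    using d by blast
  moreover from this card have de: "0 < d" "0 < e"
    by (auto intro!: Nat.gr0I)
  ultimately have m: "(?q - 1) div d dvd ?q - 1" "(?q - 1) div d \<noteq> 0" "(?q - 1) div ((?q - 1) div d) = d"
    by simp_all
  have zM: "z \<in> carrier (Multiplicative_Group.mult_of R)"
    using M.nat_pow_closed[OF a(1), of "(?q - 1) div d"] unfolding z_def Multiplicative_Group.nat_pow_mult_of .
  have "M.ord z = d"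
    using M.ord_pow[OF a(1), of "(?q - 1) div d"] m unfolding ord z_def Multiplicative_Group.nat_pow_mult_of by simp
  then have "z [^] j = \<one> \<longleftrightarrow> d dvd j" for j :: nat
    using M.pow_eq_id[OF zM, of j] unfolding Multiplicative_Group.nat_pow_mult_of Multiplicative_Group.one_mult_of by simp
  moreover have "z \<in> carrier R" "z \<noteq> \<zero>"
    using zM by simp_all
  ultimately show ?thesis
    using that by blast
qed

text \<open>The k-th iterate is multiplication by z^k = -1, and a nonzero fixed point of the j-th
  iterate can be cancelled to give z^j = 1.\<close>

lemma (in field) inversion_root_add_monoid:
  assumes fin: "finite (carrier R)" and z: "z \<in> carrier R" "z \<noteq> \<zero>"
    and root: "z [^] k \<oplus> \<one> = \<zero>" and free: "\<And>j. 0 < j \<Longrightarrow> j < k \<Longrightarrow> z [^] j \<noteq> \<one>"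
  shows "inversion_root k (add_monoid R) (\<lambda>x. z \<otimes> x)"
proof -
  let ?b = "\<lambda>x. z \<otimes> x"
  have pw: "(?b ^^ j) x = z [^] j \<otimes> x" if x: "x \<in> carrier R" for j x
  proof (induction j)
    case 0
    then show ?case using x by simp
  next
    case (Suc j)
    have "(?b ^^ Suc j) x = z \<otimes> (z [^] j \<otimes> x)"
      using Suc by simp
    also have "\<dots> = z [^] Suc j \<otimes> x"
      unfolding nat_pow_Suc2[OF z(1)] using z(1) x by (intro m_assoc[symmetric]) auto
    finally show ?case .
  qed
  have "inj_on ?b (carrier R)"
    using z by (intro inj_onI) (simp add: m_lcancel)
  moreover have im: "?b ` carrier R \<subseteq> carrier R"
    using z(1) by auto
  ultimately have "bij_betw ?b (carrier R) (carrier R)"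
    using endo_inj_surj[OF fin im] by (simp add: bij_betw_def)
  then have "?b \<in> iso (add_monoid R) (add_monoid R)"
    using z(1) by (auto simp: iso_def hom_def r_distr)
  moreover have "(?b ^^ k) x = inv\<^bsub>add_monoid R\<^esub> x" if x: "x \<in> carrier R" for x
  proof -
    have "\<ominus> \<one> = z [^] k"
      using minus_equality[OF root] z(1) by simp
    then have "z [^] k \<otimes> x = \<ominus> x"
      using x by (metis l_minus l_one one_closed)
    then show ?thesis
      unfolding pw[OF x] a_inv_def .
  qed
  moreover have "(?b ^^ j) x \<noteq> x" if x: "x \<in> carrier R" "x \<noteq> \<zero>" and j: "0 < j" "j < k" for x j
  proof
    assume "(?b ^^ j) x = x"
    then have "z [^] j \<otimes> x = \<one> \<otimes> x"
      unfolding pw[OF x(1)] using x(1) by simp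
    then have "z [^] j = \<one>"
      using m_rcancel[OF x(2,1)] z(1) by simp
    then show False
      using free[OF j] by blast
  qed
  ultimately show ?thesis
    unfolding inversion_root_def by simp
qed

text \<open>\<open>E\<close> and the additive group of the field with p^n elements are vector spaces
  of equal size over the prime field, so \<open>ext_iso_elementary\<close>, started from the trivial
  subgroup, identifies them; the multiplication map is carried back to \<open>E\<close>.\<close>

lemma elementary_inversion_root:
  assumes E: "comm_group E" and fin: "finite (carrier E)" and p: "Factorial_Ring.prime (p::nat)"
    and Ep: "\<And>x. x \<in> carrier E \<Longrightarrow> x [^]\<^bsub>E\<^esub> p = \<one>\<^bsub>E\<^esub>" and card: "card (carrier E) = p ^ n"
    and k: "2 \<le> k" and odd: "odd p \<Longrightarrow> 2 * k dvd p ^ n - 1" and two: "p = 2 \<Longrightarrow> k dvd p ^ n - 1"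
  shows "\<exists>\<beta>. inversion_root k E \<beta>"
proof -
  interpret E: comm_group E by (rule E)
  show ?thesis
  proof (cases "n = 0")
    \<comment> \<open>There is no field with one element, so the trivial group is treated
      separately, with the identity map.\<close>
    case True
    then have "card (carrier E) = 1"
      using card by simp
    then have "carrier E = {\<one>\<^bsub>E\<^esub>}"
      by (metis E.one_closed card_1_singletonE singletonD)
    moreover have "((\<lambda>x. x) ^^ k) x = x" for x :: 'a
      by (induction k) simp_all
    ultimately have "inversion_root k E (\<lambda>x. x)"
      using id_iso[of E] by (simp add: inversion_root_def id_def)
    then show ?thesis by blast
  next
    case False
    then have n: "0 < n" by simp
    have q2: "2 \<le> p ^ n"
      using prime_ge_2_nat[OF p] self_le_power[of p n] n by linarith
    obtain F :: "((int list \<times> nat) multiset \<Rightarrow> int) ring"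
      where F: "field F" "card (carrier F) = p ^ n" "\<And>x. x \<in> carrier F \<Longrightarrow> [p] \<cdot>\<^bsub>F\<^esub> x = \<zero>\<^bsub>F\<^esub>"
      using ex_finite_field[OF p n] by blast
    interpret F: field F by (rule F(1))
    have finF: "finite (carrier F)"
      using F(2) q2 by (intro card_ge_0_finite) linarith
    have triv: "subgroup {\<one>\<^bsub>E\<^esub>} E"
      by (rule E.triv_subgroup)
    have hom: "(\<lambda>_. \<zero>\<^bsub>F\<^esub>) \<in> hom (E\<lparr>carrier := {\<one>\<^bsub>E\<^esub>}\<rparr>) (add_monoid F)"
      by (simp add: hom_def)
    obtain h where h: "h \<in> iso E (add_monoid F)"
      using ext_iso_elementary[OF E F.a_comm_group p Ep _ fin _ _ triv hom] F(2,3) card finF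
      by (auto simp: add_pow_def)
    define d where "d = (if p = 2 then k else 2 * k)"
    have pe: "odd p" if "p \<noteq> 2"
      using prime_odd_nat[OF p] that prime_ge_2_nat[OF p] by linarith
    have "d dvd card (carrier F) - 1"
      using odd two pe unfolding d_def F(2) by simp
    then obtain z where z: "z \<in> carrier F" "z \<noteq> \<zero>\<^bsub>F\<^esub>" "\<And>j. z [^]\<^bsub>F\<^esub> (j::nat) = \<one>\<^bsub>F\<^esub> \<longleftrightarrow> d dvd j"
      using F.ex_mult_elem_of_ord[OF finF, of d] q2 F(2) by metis
    let ?w = "z [^]\<^bsub>F\<^esub> k"
    have wc: "?w \<in> carrier F"
      using z(1) by simp
    have root: "?w \<oplus>\<^bsub>F\<^esub> \<one>\<^bsub>F\<^esub> = \<zero>\<^bsub>F\<^esub>"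
    proof (cases "p = 2")
      case True
      have "?w = \<one>\<^bsub>F\<^esub>"
        using z(3)[of k] True by (simp add: d_def)
      moreover have "[(2::nat)] \<cdot>\<^bsub>F\<^esub> \<one>\<^bsub>F\<^esub> = \<one>\<^bsub>F\<^esub> \<oplus>\<^bsub>F\<^esub> \<one>\<^bsub>F\<^esub>"
        by (simp add: add_pow_def numeral_2_eq_2)
      ultimately show ?thesis
        using F(3)[OF F.one_closed] True by simp
    next
      case False
      have w1: "?w \<noteq> \<one>\<^bsub>F\<^esub>"
        using z(3)[of k] False k by (auto simp: d_def dest: dvd_imp_le)
      have "?w \<otimes>\<^bsub>F\<^esub> ?w = z [^]\<^bsub>F\<^esub> (2 * k)"
        using F.nat_pow_mult[OF z(1), of k k] by (simp add: mult_2)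
      then have ww: "?w \<otimes>\<^bsub>F\<^esub> ?w = \<one>\<^bsub>F\<^esub>"
        using z(3)[of "2 * k"] False by (simp add: d_def)
      have "(?w \<ominus>\<^bsub>F\<^esub> \<one>\<^bsub>F\<^esub>) \<otimes>\<^bsub>F\<^esub> (?w \<oplus>\<^bsub>F\<^esub> \<one>\<^bsub>F\<^esub>) = ?w \<otimes>\<^bsub>F\<^esub> ?w \<ominus>\<^bsub>F\<^esub> \<one>\<^bsub>F\<^esub>"
        using wc F.one_closed by algebra
      then have "(?w \<ominus>\<^bsub>F\<^esub> \<one>\<^bsub>F\<^esub>) \<otimes>\<^bsub>F\<^esub> (?w \<oplus>\<^bsub>F\<^esub> \<one>\<^bsub>F\<^esub>) = \<zero>\<^bsub>F\<^esub>"
        using ww F.r_right_minus_eq[OF F.one_closed F.one_closed] by simp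
      then have "?w \<ominus>\<^bsub>F\<^esub> \<one>\<^bsub>F\<^esub> = \<zero>\<^bsub>F\<^esub> \<or> ?w \<oplus>\<^bsub>F\<^esub> \<one>\<^bsub>F\<^esub> = \<zero>\<^bsub>F\<^esub>"
        using wc by (intro F.integral) auto
      then show ?thesis
        using w1 F.r_right_minus_eq[OF wc F.one_closed] by blast
    qed
    have "z [^]\<^bsub>F\<^esub> j \<noteq> \<one>\<^bsub>F\<^esub>" if j: "0 < j" "j < k" for j
      using z(3)[of j] j by (auto simp: d_def dest: dvd_imp_le)
    then have "inversion_root k (add_monoid F) (\<lambda>x. z \<otimes>\<^bsub>F\<^esub> x)"
      by (intro F.inversion_root_add_monoid[OF finF z(1,2) root]) blast
    then show ?thesis
      using inversion_root_transport[OF E.is_group F.a_group h] by blast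
  qed
qed

lemma (in comm_group) k_if_of_elementary_sylow:
  assumes fin: "finite (carrier G)" and G: "carrier G \<noteq> {\<one>}" and k: "2 \<le> k"
    and el: "\<And>p P. p \<in> prime_factors (order G) \<Longrightarrow> sylow_subgroup G p P \<Longrightarrow> elementary_abelian (G\<lparr>carrier := P\<rparr>)"
    and odd: "\<And>p P. p \<in> prime_factors (order G) \<Longrightarrow> sylow_subgroup G p P \<Longrightarrow> odd p \<Longrightarrow> 2 * k dvd card P - 1"
    and two: "\<And>p P. p \<in> prime_factors (order G) \<Longrightarrow> sylow_subgroup G p P \<Longrightarrow> p = 2 \<Longrightarrow> k dvd card P - 1"
  shows "k_if_property k G"
proof -
  let ?I = "prime_factors (order G)"
  have pr: "Factorial_Ring.prime p" if "p \<in> ?I" for p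
    using that by blast
  have grp: "group (sylow_group G p)" if "p \<in> ?I" for p
    by (rule sylow_group_group[OF fin pr[OF that]])
  have root: "\<exists>\<beta>. inversion_root k (sylow_group G p) \<beta>" if pI: "p \<in> ?I" for p
  proof -
    let ?S = "sylow_group G p"
    have P: "sylow_subgroup G p (sylow_choice G p)"
      by (rule sylow_choice[OF fin pr[OF pI]])
    have cP: "card (sylow_choice G p) = p ^ multiplicity p (order G)" and sub: "subgroup (sylow_choice G p) G"
      using P by (simp_all add: sylow_subgroup_def)
    have ea: "elementary_abelian ?S"
      by (rule sylow_group_elementary_abelian[OF comm_group_axioms fin pr[OF pI] el[OF pI P]])
    interpret S: comm_group ?S
      using ea by (simp add: elementary_abelian_def)
    obtain r where r: "Factorial_Ring.prime (r::nat)" "\<And>x. x \<in> carrier ?S \<Longrightarrow> x \<noteq> \<one>\<^bsub>?S\<^esub> \<Longrightarrow> S.ord x = r"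
      using ea unfolding elementary_abelian_def by blast
    have finS: "finite (carrier ?S)"
      using subgroup.subset[OF sub] fin finite_subset by auto
    have "x [^]\<^bsub>?S\<^esub> p = \<one>\<^bsub>?S\<^esub>" if x: "x \<in> carrier ?S" for x
    proof (cases "x = \<one>\<^bsub>?S\<^esub>")
      case True
      then show ?thesis using S.nat_pow_one by simp
    next
      case False
      have "S.ord x dvd order ?S"
        by (rule S.ord_dvd_group_order[OF x])
      then have "r dvd p ^ multiplicity p (order G)"
        unfolding r(2)[OF x False] order_def[of ?S] sylow_group_simps cP .
      then have "r = p"
        using r(1) pr[OF pI] prime_dvd_power primes_dvd_imp_eq by blast
      then show ?thesis
        using S.pow_ord_eq_1[OF x] r(2)[OF x False] by simp
    qed
    then show ?thesis
    proof (rule elementary_inversion_root[OF S.comm_group_axioms finS pr[OF pI] _ _ k])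
      show "card (carrier (sylow_group G p)) = p ^ multiplicity p (order G)"
        using cP by simp
    qed (use odd[OF pI P] two[OF pI P] in \<open>unfold cP\<close>)
  qed
  then obtain \<beta> where \<beta>: "\<And>p. p \<in> ?I \<Longrightarrow> inversion_root k (sylow_group G p) (\<beta> p)"
    by metis
  obtain h where "h \<in> iso G (product_group ?I (sylow_group G))"
    using iso_product_sylow[OF fin] unfolding is_iso_def by blast
  moreover have "inversion_root k (product_group ?I (sylow_group G)) (\<lambda>f. \<lambda>i\<in>?I. \<beta> i (f i))"
    by (rule inversion_root_product[OF grp \<beta>])
  moreover have "group (product_group ?I (sylow_group G))"
    using grp by (rule product_group)
  ultimately obtain \<gamma> where "inversion_root k G \<gamma>"
    using inversion_root_transport[OF is_group] by blast
  then show ?thesis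
    by (rule k_if_of_inversion_root[OF G _ k])
qed

theorem theorem1p1:
  fixes G :: "('a, 'b) monoid_scheme" and k :: nat
  assumes "2 \<le> k"
    and "CI_group G"
    and "carrier G \<noteq> {\<one>\<^bsub>G\<^esub>}"
  shows "(k_if_property k G \<longleftrightarrow>
      direct_product_of_elementary_abelian G \<and>
      (\<forall>p\<in>prime_factors (order G). \<forall>P. sylow_subgroup G p P \<longrightarrow>
        (odd p \<longrightarrow> 2 * k dvd card P - 1) \<and> (p = 2 \<longrightarrow> k dvd card P - 1))) \<and>
    (direct_product_of_elementary_abelian G \<longleftrightarrow>
      comm_group G \<and>
      (\<forall>p\<in>prime_factors (order G). \<forall>P. sylow_subgroup G p P \<longrightarrow>
        elementary_abelian (G\<lparr>carrier := P\<rparr>)))"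
proof
  note k = assms(1) and CI = assms(2) and nontriv = assms(3)
  have "group G" and fin: "finite (carrier G)"
    using CI by (simp_all add: CI_group_def)
  interpret group G by fact
  show dp: "direct_product_of_elementary_abelian G \<longleftrightarrow>
      comm_group G \<and>
      (\<forall>p\<in>prime_factors (order G). \<forall>P. sylow_subgroup G p P \<longrightarrow>
        elementary_abelian (G\<lparr>carrier := P\<rparr>))"
    by (rule direct_product_of_elementary_abelian_iff[OF is_group fin])
  show "k_if_property k G \<longleftrightarrow>
      direct_product_of_elementary_abelian G \<and>
      (\<forall>p\<in>prime_factors (order G). \<forall>P. sylow_subgroup G p P \<longrightarrow>
        (odd p \<longrightarrow> 2 * k dvd card P - 1) \<and> (p = 2 \<longrightarrow> k dvd card P - 1))" (is "_ \<longleftrightarrow> _ \<and> ?D")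
  proof
    assume kif: "k_if_property k G"
    have "comm_group G"
      by (rule CI_k_if_comm_group[OF CI kif k])
    moreover have "elementary_abelian (G\<lparr>carrier := P\<rparr>)"
      if "p \<in> prime_factors (order G)" "sylow_subgroup G p P" for p P
      using CI_k_if_sylow(1)[OF CI kif k in_prime_factors_imp_prime[OF that(1)] that(2)] .
    moreover have ?D
      using CI_k_if_sylow(2,3)[OF CI kif k in_prime_factors_imp_prime] by blast
    ultimately show "direct_product_of_elementary_abelian G \<and> ?D"
      unfolding dp by blast
  next
    assume R: "direct_product_of_elementary_abelian G \<and> ?D"
    then have el: "comm_group G" "\<And>p P. p \<in> prime_factors (order G) \<Longrightarrow> sylow_subgroup G p P \<Longrightarrow>
        elementary_abelian (G\<lparr>carrier := P\<rparr>)"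
      unfolding dp by blast+
    show "k_if_property k G"
    proof (rule comm_group.k_if_of_elementary_sylow[OF el(1) fin nontriv k el(2)])
      show "2 * k dvd card P - 1" if "p \<in> prime_factors (order G)" "sylow_subgroup G p P" "odd p" for p P
        using R that by blast
      show "k dvd card P - 1" if "p \<in> prime_factors (order G)" "sylow_subgroup G p P" "p = 2" for p P
        using R that by blast
    qed
  qed
qed

end
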